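(* For any quaternionic $C_n$-representation $W$ and any integer $k$, there is a cofiber sequence of based $C_n$-spaces $$\mathrm{P}_{\mathbb{H}}(W)_{+}\to\mathrm{P}_{\mathbb{H}}(W\oplus \Psi_k)_{+}\to S^{\Phi_{-k}\otimes_{\mathbb{C}} W},$$ the first map being the inclusion. Thus to form $\mathrm{P}_{\mathbb{H}}(W\oplus \Psi_k)$ from $\mathrm{P}_{\mathbb{H}}(W)$, one attaches a cell of the form $\mathbf{D}(\Phi_{-k}\otimes_{\mathbb{C}} W)$.
   Context: Let $n\ge1$, $\mathbf{1}_n$ the usual generator of the cyclic group $C_n$, $\zeta_n=e^{2\pi i/n}$. A quaternionic $C_n$-representation is a left $\mathbb{H}$-module with $C_n$ acting by left $\mathbb{H}$-linear maps; it is regarded as a complex representation by restriction of scalars along $\mathbb{C}\subset\mathbb{H}$. For an integer $r$, $\Phi_r$ is the complex representation $\mathbb{C}$ with $\mathbf{1}_n\cdot z=z\zeta_n^r$, and $\Psi_r$ is the quaternionic representation $\mathbb{H}$ with $\mathbf{1}_n\cdot q=q\zeta_n^r$. $\mathrm{P}_{\mathbb{H}}(W)=(W\setminus\{0\})/{\sim}$, $w\sim\lambda w$ for $\lambda\in\mathbb{H}^\times$, with the quotient topology and action $g\langle w\rangle=\langle gw\rangle$. $X_+$ is $X$ with a disjoint fixed basepoint. For a representation $V$ considered as a real orthogonal representation, $S^V$ is its one-point compactification, $\mathbf{D}(V)$ its unit disk; attaching a cell $\mathbf{D}(V)$ means attaching along a $C_n$-map from the unit sphere of $V$. *)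

theory Defs
  imports "HOL-Analysis.Analysis" "HOL-Algebra.Group_Action" "HOL-Algebra.Elementary_Groups" "HOL-Library.Poly_Mapping"
begin

section \<open>Quaternions\<close>

datatype quat = Quat (qre: real) (qi: real) (qj: real) (qk: real)

instantiation quat :: real_algebra_1
begin

definition "0 = Quat 0 0 0 0"
definition "1 = Quat 1 0 0 0"
definition "x + y = Quat (qre x + qre y) (qi x + qi y) (qj x + qj y) (qk x + qk y)"
definition "- x = Quat (- qre x) (- qi x) (- qj x) (- qk x)"
definition "x - y = Quat (qre x - qre y) (qi x - qi y) (qj x - qj y) (qk x - qk y)"
definition "scaleR r x = Quat (r * qre x) (r * qi x) (r * qj x) (r * qk x)"
definition "x * y = Quat
   (qre x * qre y - qi x * qi y - qj x * qj y - qk x * qk y)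
   (qre x * qi y + qi x * qre y + qj x * qk y - qk x * qj y)
   (qre x * qj y - qi x * qk y + qj x * qre y + qk x * qi y)
   (qre x * qk y + qi x * qj y - qj x * qi y + qk x * qre y)"

instance
  by standard (simp_all add: zero_quat_def one_quat_def plus_quat_def uminus_quat_def
      minus_quat_def scaleR_quat_def times_quat_def algebra_simps)

end

instantiation quat :: division_ring
begin

definition "inverse x = (let m = (qre x)\<^sup>2 + (qi x)\<^sup>2 + (qj x)\<^sup>2 + (qk x)\<^sup>2 in
   Quat (qre x / m) (- qi x / m) (- qj x / m) (- qk x / m))"
definition "x div (y :: quat) = x * inverse y"

instance
proof
  fix x :: quat
  assume "x \<noteq> 0"
  then have nz: "(qre x)\<^sup>2 + (qi x)\<^sup>2 + (qj x)\<^sup>2 + (qk x)\<^sup>2 \<noteq> 0"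
    by (cases x) (auto simp: zero_quat_def add_nonneg_eq_0_iff)
  define m where "m = (qre x)\<^sup>2 + (qi x)\<^sup>2 + (qj x)\<^sup>2 + (qk x)\<^sup>2"
  have inv: "inverse x = Quat (qre x / m) (- qi x / m) (- qj x / m) (- qk x / m)"
    unfolding inverse_quat_def m_def Let_def ..
  have one: "(qre x)\<^sup>2 / m + (qi x)\<^sup>2 / m + (qj x)\<^sup>2 / m + (qk x)\<^sup>2 / m = 1"
    using nz unfolding m_def add_divide_distrib [symmetric] by simp
  show "inverse x * x = 1" "x * inverse x = 1"
    unfolding inv using one by (simp_all add: times_quat_def one_quat_def power2_eq_square)
qed (simp_all add: divide_quat_def inverse_quat_def zero_quat_def)

end

definition quat_of_complex :: "complex \<Rightarrow> quat" where
  "quat_of_complex z = Quat (Re z) (Im z) 0 0"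

section \<open>Complex vector spaces and left quaternionic modules\<close>

class complex_vector = real_vector +
  fixes scaleC :: "complex \<Rightarrow> 'a \<Rightarrow> 'a"
  assumes scaleC_add_right: "scaleC c (x + y) = scaleC c x + scaleC c y"
    and scaleC_add_left: "scaleC (c + d) x = scaleC c x + scaleC d x"
    and scaleC_scaleC: "scaleC c (scaleC d x) = scaleC (c * d) x"
    and scaleC_one: "scaleC 1 x = x"
    and scaleC_of_real: "scaleC (complex_of_real r) x = r *\<^sub>R x"

text \<open>The real and complex structures of a left quaternionic module are those obtained by
  restriction of scalars; the last axiom makes this explicit. The one-element module is allowed.\<close>

class quaternion_module = complex_vector +
  fixes scaleH :: "quat \<Rightarrow> 'a \<Rightarrow> 'a"
  assumes scaleH_add_right: "scaleH p (x + y) = scaleH p x + scaleH p y"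
    and scaleH_add_left: "scaleH (p + q) x = scaleH p x + scaleH q x"
    and scaleH_scaleH: "scaleH p (scaleH q x) = scaleH (p * q) x"
    and scaleH_one: "scaleH 1 x = x"
    and scaleH_of_complex: "scaleH (quat_of_complex c) x = scaleC c x"

instantiation complex :: complex_vector
begin
definition scaleC_complex :: "complex \<Rightarrow> complex \<Rightarrow> complex" where "scaleC_complex c z = c * z"
instance
  by standard (simp_all add: scaleC_complex_def distrib_left distrib_right mult.assoc scaleR_conv_of_real)
end

instantiation quat :: quaternion_module
begin
definition scaleC_quat :: "complex \<Rightarrow> quat \<Rightarrow> quat" where "scaleC_quat c q = quat_of_complex c * q"
definition scaleH_quat :: "quat \<Rightarrow> quat \<Rightarrow> quat" where "scaleH_quat p q = p * q"
instance
  by standard (simp_all add: scaleC_quat_def scaleH_quat_def quat_of_complex_def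
      one_quat_def plus_quat_def scaleR_quat_def times_quat_def algebra_simps)
end

instantiation prod :: (complex_vector, complex_vector) complex_vector
begin
definition scaleC_prod :: "complex \<Rightarrow> 'a \<times> 'b \<Rightarrow> 'a \<times> 'b" where
  "scaleC_prod c x = (scaleC c (fst x), scaleC c (snd x))"
instance
  by standard (simp_all add: scaleC_prod_def prod_eq_iff scaleC_add_right scaleC_add_left
      scaleC_scaleC scaleC_one scaleC_of_real)
end

instantiation prod :: (quaternion_module, quaternion_module) quaternion_module
begin
definition scaleH_prod :: "quat \<Rightarrow> 'a \<times> 'b \<Rightarrow> 'a \<times> 'b" where
  "scaleH_prod p x = (scaleH p (fst x), scaleH p (snd x))"
instance
  by standard (simp_all add: scaleH_prod_def scaleC_prod_def prod_eq_iff scaleH_add_right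
      scaleH_add_left scaleH_scaleH scaleH_one scaleH_of_complex)
end

definition complex_linear :: "('a::complex_vector \<Rightarrow> 'b::complex_vector) \<Rightarrow> bool" where
  "complex_linear f \<longleftrightarrow>
     (\<forall>x y. f (x + y) = f x + f y) \<and> (\<forall>c x. f (scaleC c x) = scaleC c (f x))"

definition quat_linear :: "('a::quaternion_module \<Rightarrow> 'b::quaternion_module) \<Rightarrow> bool" where
  "quat_linear f \<longleftrightarrow>
     (\<forall>x y. f (x + y) = f x + f y) \<and> (\<forall>p x. f (scaleH p x) = scaleH p (f x))"

section \<open>The tensor product over the complex numbers\<close>

text \<open>The tensor product is the free abelian group on pairs modulo the subgroup generated by
  the biadditivity and balancing relations.\<close>

inductive_set tensor_relators :: "('a::complex_vector \<times> 'b::complex_vector \<Rightarrow>\<^sub>0 int) set" where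
  zero: "0 \<in> tensor_relators"
| diff: "x \<in> tensor_relators \<Longrightarrow> y \<in> tensor_relators \<Longrightarrow> x - y \<in> tensor_relators"
| add_left: "frag_of (a + a', b) - frag_of (a, b) - frag_of (a', b) \<in> tensor_relators"
| add_right: "frag_of (a, b + b') - frag_of (a, b) - frag_of (a, b') \<in> tensor_relators"
| balanced: "frag_of (scaleC c a, b) - frag_of (a, scaleC c b) \<in> tensor_relators"

lemma tensor_relators_uminus: "x \<in> tensor_relators \<Longrightarrow> - x \<in> tensor_relators"
  using tensor_relators.diff [OF tensor_relators.zero, of x] by simp

lemma tensor_relators_add:
  "x \<in> tensor_relators \<Longrightarrow> y \<in> tensor_relators \<Longrightarrow> x + y \<in> tensor_relators"
  using tensor_relators.diff [of x "- y"] tensor_relators_uminus [of y] by simp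

definition tensor_equiv ::
    "('a::complex_vector \<times> 'b::complex_vector \<Rightarrow>\<^sub>0 int) \<Rightarrow> ('a \<times> 'b \<Rightarrow>\<^sub>0 int) \<Rightarrow> bool" where
  "tensor_equiv x y \<longleftrightarrow> x - y \<in> tensor_relators"

lemma equivp_tensor_equiv:
  "equivp (tensor_equiv :: ('a::complex_vector \<times> 'b::complex_vector \<Rightarrow>\<^sub>0 int) \<Rightarrow> _ \<Rightarrow> bool)"
proof (rule equivpI)
  show "reflp (tensor_equiv :: ('a \<times> 'b \<Rightarrow>\<^sub>0 int) \<Rightarrow> _ \<Rightarrow> bool)"
    by (rule reflpI) (simp add: tensor_equiv_def tensor_relators.zero)
  show "symp (tensor_equiv :: ('a \<times> 'b \<Rightarrow>\<^sub>0 int) \<Rightarrow> _ \<Rightarrow> bool)"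
  proof (rule sympI)
    fix x y :: "'a \<times> 'b \<Rightarrow>\<^sub>0 int"
    assume "tensor_equiv x y"
    then have "- (x - y) \<in> tensor_relators"
      unfolding tensor_equiv_def by (rule tensor_relators_uminus)
    then show "tensor_equiv y x" by (simp add: tensor_equiv_def)
  qed
  show "transp (tensor_equiv :: ('a \<times> 'b \<Rightarrow>\<^sub>0 int) \<Rightarrow> _ \<Rightarrow> bool)"
  proof (rule transpI)
    fix x y z :: "'a \<times> 'b \<Rightarrow>\<^sub>0 int"
    assume "tensor_equiv x y" "tensor_equiv y z"
    then have "(x - y) + (y - z) \<in> tensor_relators"
      unfolding tensor_equiv_def by (rule tensor_relators_add)
    then show "tensor_equiv x z" by (simp add: tensor_equiv_def)
  qed
qed

quotient_type (overloaded) ('a, 'b) ctensor =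
    "('a::complex_vector \<times> 'b::complex_vector) \<Rightarrow>\<^sub>0 int" / tensor_equiv
  by (rule equivp_tensor_equiv)

lift_definition tensor :: "'a::complex_vector \<Rightarrow> 'b::complex_vector \<Rightarrow> ('a, 'b) ctensor"
  is "\<lambda>a b. frag_of (a, b)" .

definition frag_map2 :: "('a \<Rightarrow> 'c) \<Rightarrow> ('b \<Rightarrow> 'd) \<Rightarrow> ('a \<times> 'b \<Rightarrow>\<^sub>0 int) \<Rightarrow> ('c \<times> 'd \<Rightarrow>\<^sub>0 int)" where
  "frag_map2 f h = frag_extend (\<lambda>(a, b). frag_of (f a, h b))"

lemma frag_map2_simps:
  "frag_map2 f h 0 = 0"
  "frag_map2 f h (frag_of (a, b)) = frag_of (f a, h b)"
  "frag_map2 f h (x + y) = frag_map2 f h x + frag_map2 f h y"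
  "frag_map2 f h (x - y) = frag_map2 f h x - frag_map2 f h y"
  by (simp_all add: frag_map2_def frag_extend_add frag_extend_diff)

lemma frag_pair_induct [case_names zero one diff]:
  assumes "P 0" "\<And>a b. P (frag_of (a, b))" "\<And>x y. P x \<Longrightarrow> P y \<Longrightarrow> P (x - y)"
  shows "P (x :: 'a \<times> 'b \<Rightarrow>\<^sub>0 int)"
  by (rule frag_induction [where S = UNIV]) (use assms in auto)

lemma frag_map2_relators:
  fixes f :: "'a::complex_vector \<Rightarrow> 'c::complex_vector"
    and h :: "'b::complex_vector \<Rightarrow> 'd::complex_vector"
  assumes "complex_linear f" "complex_linear h" "x \<in> tensor_relators"
  shows "frag_map2 f h x \<in> tensor_relators"
  using assms(3)
proof induction
  case zero
  show ?case unfolding frag_map2_simps by (rule tensor_relators.zero)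
next
  case (diff x y)
  show ?case unfolding frag_map2_simps by (rule tensor_relators.diff [OF diff.IH])
next
  case (add_left a a' b)
  have "f (a + a') = f a + f a'" using assms(1) by (simp add: complex_linear_def)
  then show ?case unfolding frag_map2_simps by (simp only: tensor_relators.add_left)
next
  case (add_right a b b')
  have "h (b + b') = h b + h b'" using assms(2) by (simp add: complex_linear_def)
  then show ?case unfolding frag_map2_simps by (simp only: tensor_relators.add_right)
next
  case (balanced c a b)
  have "f (scaleC c a) = scaleC c (f a)" "h (scaleC c b) = scaleC c (h b)"
    using assms(1,2) by (simp_all add: complex_linear_def)
  then show ?case unfolding frag_map2_simps by (simp only: tensor_relators.balanced)
qed

lemma complex_linear_id: "complex_linear (\<lambda>x. x)"
  by (simp add: complex_linear_def)

lemma complex_linear_scaleC: "complex_linear (scaleC c)"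
  by (simp add: complex_linear_def scaleC_add_right scaleC_scaleC mult.commute)

instantiation ctensor :: (complex_vector, complex_vector) complex_vector
begin

lift_definition zero_ctensor :: "('a, 'b) ctensor" is 0 .

lift_definition plus_ctensor :: "('a, 'b) ctensor \<Rightarrow> ('a, 'b) ctensor \<Rightarrow> ('a, 'b) ctensor" is "(+)"
  unfolding tensor_equiv_def add_diff_add by (rule tensor_relators_add)

lift_definition uminus_ctensor :: "('a, 'b) ctensor \<Rightarrow> ('a, 'b) ctensor" is uminus
  unfolding tensor_equiv_def minus_diff_minus by (rule tensor_relators_uminus)

lift_definition minus_ctensor :: "('a, 'b) ctensor \<Rightarrow> ('a, 'b) ctensor \<Rightarrow> ('a, 'b) ctensor" is "(-)"
proof -
  fix x x' y y' :: "'a \<times> 'b \<Rightarrow>\<^sub>0 int"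
  assume "tensor_equiv x x'" "tensor_equiv y y'"
  then have "(x - x') - (y - y') \<in> tensor_relators"
    unfolding tensor_equiv_def by (rule tensor_relators.diff)
  moreover have "(x - x') - (y - y') = (x - y) - (x' - y')" by simp
  ultimately show "tensor_equiv (x - y) (x' - y')"
    by (simp only: tensor_equiv_def)
qed

lift_definition scaleC_ctensor :: "complex \<Rightarrow> ('a, 'b) ctensor \<Rightarrow> ('a, 'b) ctensor"
  is "\<lambda>c. frag_map2 (scaleC c) (\<lambda>b. b)"
  unfolding tensor_equiv_def frag_map2_simps(4) [symmetric]
  by (rule frag_map2_relators [OF complex_linear_scaleC complex_linear_id])

definition scaleR_ctensor :: "real \<Rightarrow> ('a, 'b) ctensor \<Rightarrow> ('a, 'b) ctensor" where
  "scaleR_ctensor r = scaleC (complex_of_real r)"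

instance
proof
  fix x y z :: "('a, 'b) ctensor" and c d :: complex and r s :: real
  show "x + y + z = x + (y + z)"
    by transfer (simp add: tensor_equiv_def tensor_relators.zero add.assoc)
  show "x + y = y + x"
    by transfer (simp add: tensor_equiv_def tensor_relators.zero add.commute)
  show "0 + x = x"
    by transfer (simp add: tensor_equiv_def tensor_relators.zero)
  show "- x + x = 0"
    by transfer (simp add: tensor_equiv_def tensor_relators.zero)
  show "x - y = x + - y"
    by transfer (simp add: tensor_equiv_def tensor_relators.zero)
  show C1: "scaleC c (x + y) = scaleC c x + scaleC c y" for c :: complex and x y :: "('a, 'b) ctensor"
    by transfer (simp add: tensor_equiv_def tensor_relators.zero frag_map2_simps)
  show C2: "scaleC (c + d) x = scaleC c x + scaleC d x" for c d :: complex and x :: "('a, 'b) ctensor"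
  proof transfer
    fix c d :: complex and x :: "'a \<times> 'b \<Rightarrow>\<^sub>0 int"
    let ?D = "\<lambda>x. frag_map2 (scaleC (c + d)) (\<lambda>b. b) x
       - (frag_map2 (scaleC c) (\<lambda>b. b) x + frag_map2 (scaleC d) (\<lambda>b. b) x)"
    have "?D x \<in> tensor_relators"
    proof (induction x rule: frag_pair_induct)
      case zero
      show ?case by (simp add: frag_map2_simps tensor_relators.zero)
    next
      case (one a b)
      show ?case
        using tensor_relators.add_left [of "scaleC c a" "scaleC d a" b]
        by (simp add: frag_map2_simps scaleC_add_left diff_diff_add)
    next
      case (diff u v)
      have "?D (u - v) = ?D u - ?D v"
        by (simp add: frag_map2_simps)
      then show ?case using diff by (simp only: tensor_relators.diff)
    qed
    then show "tensor_equiv (frag_map2 (scaleC (c + d)) (\<lambda>b. b) x)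
       (frag_map2 (scaleC c) (\<lambda>b. b) x + frag_map2 (scaleC d) (\<lambda>b. b) x)"
      by (simp add: tensor_equiv_def)
  qed
  show C3: "scaleC c (scaleC d x) = scaleC (c * d) x" for c d :: complex and x :: "('a, 'b) ctensor"
  proof transfer
    fix c d :: complex and x :: "'a \<times> 'b \<Rightarrow>\<^sub>0 int"
    have "frag_map2 (scaleC c) (\<lambda>b. b) (frag_map2 (scaleC d) (\<lambda>b. b) x)
       = frag_map2 (scaleC (c * d)) (\<lambda>b. b) x"
      by (induction x rule: frag_pair_induct)
        (auto simp: frag_map2_simps scaleC_scaleC)
    then show "tensor_equiv (frag_map2 (scaleC c) (\<lambda>b. b) (frag_map2 (scaleC d) (\<lambda>b. b) x))
       (frag_map2 (scaleC (c * d)) (\<lambda>b. b) x)"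
      by (simp add: tensor_equiv_def tensor_relators.zero)
  qed
  show C4: "scaleC 1 x = x" for x :: "('a, 'b) ctensor"
  proof transfer
    fix x :: "'a \<times> 'b \<Rightarrow>\<^sub>0 int"
    have "frag_map2 (scaleC 1) (\<lambda>b. b) x = x"
      by (induction x rule: frag_pair_induct)
        (auto simp: frag_map2_simps scaleC_one)
    then show "tensor_equiv (frag_map2 (scaleC 1) (\<lambda>b. b) x) x"
      by (simp add: tensor_equiv_def tensor_relators.zero)
  qed
  show "scaleC (complex_of_real r) x = r *\<^sub>R x" by (simp add: scaleR_ctensor_def)
  show "r *\<^sub>R (x + y) = r *\<^sub>R x + r *\<^sub>R y" by (simp add: scaleR_ctensor_def C1)
  show "(r + s) *\<^sub>R x = r *\<^sub>R x + s *\<^sub>R x" by (simp add: scaleR_ctensor_def C2)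
  show "r *\<^sub>R s *\<^sub>R x = (r * s) *\<^sub>R x" by (simp add: scaleR_ctensor_def C3)
  show "1 *\<^sub>R x = x" by (simp add: scaleR_ctensor_def C4)
qed

end

text \<open>The map induced by a pair of maps, meaningful when both are complex linear; in general
  its value depends on the chosen representative.\<close>

definition ctensor_map :: "('a::complex_vector \<Rightarrow> 'c::complex_vector) \<Rightarrow>
    ('b::complex_vector \<Rightarrow> 'd::complex_vector) \<Rightarrow> ('a, 'b) ctensor \<Rightarrow> ('c, 'd) ctensor" where
  "ctensor_map f h t = abs_ctensor (frag_map2 f h (rep_ctensor t))"

lemma ctensor_map_abs:
  assumes "complex_linear f" "complex_linear h"
  shows "ctensor_map f h (abs_ctensor x) = abs_ctensor (frag_map2 f h x)"
proof -
  have "tensor_equiv (rep_ctensor (abs_ctensor x)) x"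
    using Quotient_ctensor equivp_tensor_equiv by (metis Quotient_rep_abs equivp_reflp)
  then have "tensor_equiv (frag_map2 f h (rep_ctensor (abs_ctensor x))) (frag_map2 f h x)"
    unfolding tensor_equiv_def by (metis assms frag_map2_relators frag_map2_simps(4))
  then show ?thesis
    by (simp add: ctensor_map_def ctensor.abs_eq_iff)
qed

lemma ctensor_map_tensor:
  assumes "complex_linear f" "complex_linear h"
  shows "ctensor_map f h (tensor a b) = tensor (f a) (h b)"
  using ctensor_map_abs [OF assms, of "frag_of (a, b)"]
  by (simp add: tensor.abs_eq frag_map2_simps)

lemma ctensor_map_add:
  assumes "complex_linear f" "complex_linear h"
  shows "ctensor_map f h (s + t) = ctensor_map f h s + ctensor_map f h t"
proof -
  have "\<exists>x. s = abs_ctensor x" "\<exists>y. t = abs_ctensor y"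
    by (induct s rule: ctensor.abs_induct, blast) (induct t rule: ctensor.abs_induct, blast)
  then obtain x y where "s = abs_ctensor x" "t = abs_ctensor y"
    by blast
  then show ?thesis
    by (simp add: plus_ctensor.abs_eq ctensor_map_abs [OF assms] frag_map2_simps)
qed

section \<open>The topology of a finite-dimensional real vector space\<close>

text \<open>On a finite-dimensional space the coarsest topology making all linear functionals
  continuous is its unique Hausdorff vector space topology.\<close>

definition vector_topology :: "'v::real_vector topology" where
  "vector_topology = topology_generated_by {f -` U | (f :: 'v \<Rightarrow> real) U. linear f \<and> open U}"

lemma vector_topology_eq_euclidean:
  "(vector_topology :: 'v::euclidean_space topology) = euclidean"
proof (rule topology_eq [THEN iffD2], intro allI iffI)
  let ?S = "{f -` U | (f :: 'v \<Rightarrow> real) U. linear f \<and> open U}"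
  fix A :: "'v set"
  {
    assume "openin vector_topology A"
    then have "generate_topology_on ?S A"
      by (simp add: vector_topology_def openin_topology_generated_by_iff)
    then have "open A"
    proof induction
      case (Basis s)
      then show ?case
        by (auto intro!: open_vimage linear_continuous_on simp: linear_conv_bounded_linear)
    qed auto
    then show "openin euclidean A" by simp
  next
    assume "openin euclidean A"
    then have A: "open A" by simp
    show "openin vector_topology A"
    proof (subst openin_subopen, intro ballI)
      fix x assume "x \<in> A"
      then obtain a b where box: "x \<in> box a b" "box a b \<subseteq> A"
        by (metis A open_contains_box order_refl box_subset_cbox subset_trans)
      have "box a b = (\<Inter>i\<in>Basis. (\<lambda>v. v \<bullet> i) -` {a \<bullet> i<..<b \<bullet> i})"
        by (auto simp: box_def)
      moreover have "openin vector_topology ((\<lambda>v::'v. v \<bullet> i) -` {a \<bullet> i<..<b \<bullet> i})" for i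
        unfolding vector_topology_def
        by (rule topology_generated_by_Basis)
          (use bounded_linear_inner_left bounded_linear.linear open_greaterThanLessThan in blast)
      ultimately have "openin vector_topology (box a b)"
        by (auto intro!: openin_Inter)
      with box show "\<exists>T. openin vector_topology T \<and> x \<in> T \<and> T \<subseteq> A" by blast
    qed
  }
qed

section \<open>Spaces with a group action\<close>

record ('g, 'a) gspace =
  spc :: "'a topology"
  act :: "'g \<Rightarrow> 'a \<Rightarrow> 'a"

record ('g, 'a) based_gspace = "('g, 'a) gspace" +
  base :: 'a

definition is_gspace :: "('g, 'm) monoid_scheme \<Rightarrow> ('g, 'a, 'z) gspace_scheme \<Rightarrow> bool" where
  "is_gspace G X \<longleftrightarrow>
     group_action G (topspace (spc X)) (\<lambda>g. restrict (act X g) (topspace (spc X))) \<and>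
     (\<forall>g\<in>carrier G. continuous_map (spc X) (spc X) (act X g))"

definition is_based_gspace :: "('g, 'm) monoid_scheme \<Rightarrow> ('g, 'a) based_gspace \<Rightarrow> bool" where
  "is_based_gspace G X \<longleftrightarrow> is_gspace G X \<and> base X \<in> topspace (spc X) \<and>
     (\<forall>g\<in>carrier G. act X g (base X) = base X)"

definition gmap :: "('g, 'm) monoid_scheme \<Rightarrow> ('g, 'a, 'y) gspace_scheme \<Rightarrow>
    ('g, 'b, 'z) gspace_scheme \<Rightarrow> ('a \<Rightarrow> 'b) \<Rightarrow> bool" where
  "gmap G X Y f \<longleftrightarrow> continuous_map (spc X) (spc Y) f \<and>
     (\<forall>g\<in>carrier G. \<forall>x\<in>topspace (spc X). f (act X g x) = act Y g (f x))"

definition ghomeomorphism :: "('g, 'm) monoid_scheme \<Rightarrow> ('g, 'a, 'y) gspace_scheme \<Rightarrow>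
    ('g, 'b, 'z) gspace_scheme \<Rightarrow> ('a \<Rightarrow> 'b) \<Rightarrow> bool" where
  "ghomeomorphism G X Y f \<longleftrightarrow> gmap G X Y f \<and> homeomorphic_map (spc X) (spc Y) f"

definition based_gmap :: "('g, 'm) monoid_scheme \<Rightarrow> ('g, 'a) based_gspace \<Rightarrow>
    ('g, 'b) based_gspace \<Rightarrow> ('a \<Rightarrow> 'b) \<Rightarrow> bool" where
  "based_gmap G X Y f \<longleftrightarrow> gmap G X Y f \<and> f (base X) = base Y"

definition based_ghomotopic :: "('g, 'm) monoid_scheme \<Rightarrow> ('g, 'a) based_gspace \<Rightarrow>
    ('g, 'b) based_gspace \<Rightarrow> ('a \<Rightarrow> 'b) \<Rightarrow> ('a \<Rightarrow> 'b) \<Rightarrow> bool" where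
  "based_ghomotopic G X Y = homotopic_with (based_gmap G X Y) (spc X) (spc Y)"

definition based_ghomotopy_equivalence :: "('g, 'm) monoid_scheme \<Rightarrow>
    ('g, 'a) based_gspace \<Rightarrow> ('g, 'b) based_gspace \<Rightarrow> ('a \<Rightarrow> 'b) \<Rightarrow> bool" where
  "based_ghomotopy_equivalence G X Y e \<longleftrightarrow> based_gmap G X Y e \<and>
     (\<exists>e'. based_gmap G Y X e' \<and>
        based_ghomotopic G X X (e' \<circ> e) (\<lambda>x. x) \<and>
        based_ghomotopic G Y Y (e \<circ> e') (\<lambda>y. y))"

subsection \<open>Quotients, disjoint unions and disjoint basepoints\<close>

definition quotient_topology :: "'a topology \<Rightarrow> ('a \<times> 'a) set \<Rightarrow> 'a set topology" where
  "quotient_topology X r = topology (\<lambda>U. U \<subseteq> topspace X // r \<and>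
     openin X {x \<in> topspace X. r `` {x} \<in> U})"

lemma openin_quotient_topology:
  "openin (quotient_topology X r) U \<longleftrightarrow> U \<subseteq> topspace X // r \<and>
     openin X {x \<in> topspace X. r `` {x} \<in> U}"
proof -
  have "istopology (\<lambda>U. U \<subseteq> topspace X // r \<and> openin X {x \<in> topspace X. r `` {x} \<in> U})"
    unfolding istopology_def
  proof (intro conjI allI impI)
    fix S T
    assume "S \<subseteq> topspace X // r \<and> openin X {x \<in> topspace X. r `` {x} \<in> S}"
      and "T \<subseteq> topspace X // r \<and> openin X {x \<in> topspace X. r `` {x} \<in> T}"
    moreover have "{x \<in> topspace X. r `` {x} \<in> S \<inter> T} =
        {x \<in> topspace X. r `` {x} \<in> S} \<inter> {x \<in> topspace X. r `` {x} \<in> T}" by blast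
    ultimately show "S \<inter> T \<subseteq> topspace X // r" "openin X {x \<in> topspace X. r `` {x} \<in> S \<inter> T}"
      by auto
  next
    fix K
    assume K: "\<forall>S\<in>K. S \<subseteq> topspace X // r \<and> openin X {x \<in> topspace X. r `` {x} \<in> S}"
    then show "\<Union>K \<subseteq> topspace X // r" by blast
    have "{x \<in> topspace X. r `` {x} \<in> \<Union>K} = (\<Union>S\<in>K. {x \<in> topspace X. r `` {x} \<in> S})" by blast
    then show "openin X {x \<in> topspace X. r `` {x} \<in> \<Union>K}" using K by auto
  qed
  then show ?thesis
    by (simp add: quotient_topology_def)
qed

text \<open>The action on a quotient moves equivalence classes as sets; this is the induced action
  whenever the relation is invariant.\<close>

definition quotient_gspace ::
    "('g, 'a, 'z) gspace_scheme \<Rightarrow> ('a \<times> 'a) set \<Rightarrow> ('g, 'a set) gspace" where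
  "quotient_gspace X r = \<lparr>spc = quotient_topology (spc X) r, act = (\<lambda>g c. act X g ` c)\<rparr>"

definition generated_equiv :: "'a set \<Rightarrow> ('a \<times> 'a) set \<Rightarrow> ('a \<times> 'a) set" where
  "generated_equiv A S = \<Inter>{r. equiv A r \<and> S \<inter> A \<times> A \<subseteq> r}"

definition disjoint_union_topology :: "'a topology \<Rightarrow> 'b topology \<Rightarrow> ('a + 'b) topology" where
  "disjoint_union_topology X Y = topology (\<lambda>U. openin X (Inl -` U) \<and> openin Y (Inr -` U))"

lemma openin_disjoint_union_topology:
  "openin (disjoint_union_topology X Y) U \<longleftrightarrow> openin X (Inl -` U) \<and> openin Y (Inr -` U)"
proof -
  have "istopology (\<lambda>U. openin X (Inl -` U) \<and> openin Y (Inr -` U))"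
    unfolding istopology_def by (auto simp: vimage_Union)
  then show ?thesis
    by (simp add: disjoint_union_topology_def)
qed

definition disjoint_union_gspace :: "('g, 'a, 'y) gspace_scheme \<Rightarrow> ('g, 'b, 'z) gspace_scheme \<Rightarrow>
    ('g, 'a + 'b) gspace" where
  "disjoint_union_gspace X Y = \<lparr>spc = disjoint_union_topology (spc X) (spc Y),
     act = (\<lambda>g. map_sum (act X g) (act Y g))\<rparr>"

definition plus_topology :: "'a topology \<Rightarrow> 'a option topology" where
  "plus_topology X = topology (\<lambda>U. openin X (Some -` U))"

lemma openin_plus_topology: "openin (plus_topology X) U \<longleftrightarrow> openin X (Some -` U)"
proof -
  have "istopology (\<lambda>U. openin X (Some -` U))"
    unfolding istopology_def by (auto simp: vimage_Union)
  then show ?thesis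
    by (simp add: plus_topology_def)
qed

definition disjoint_basepoint :: "('g, 'a) gspace \<Rightarrow> ('g, 'a option) based_gspace" where
  "disjoint_basepoint X = \<lparr>spc = plus_topology (spc X), act = (\<lambda>g. map_option (act X g)),
     base = None\<rparr>"

subsection \<open>Cofiber sequences and cell attachments\<close>

definition cylinder :: "('g, 'a, 'z) gspace_scheme \<Rightarrow> ('g, 'a \<times> real) gspace" where
  "cylinder A = \<lparr>spc = prod_topology (spc A) (top_of_set {0..1}),
     act = (\<lambda>g. map_prod (act A g) (\<lambda>t. t))\<rparr>"

definition cone_equiv :: "('g, 'a) based_gspace \<Rightarrow> ('g, 'b) based_gspace \<Rightarrow> ('a \<Rightarrow> 'b) \<Rightarrow>
    (('b + 'a \<times> real) \<times> ('b + 'a \<times> real)) set" where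
  "cone_equiv A X f =
     generated_equiv (topspace (spc (disjoint_union_gspace X (cylinder A))))
       ({(Inr (a, 1), Inl (f a)) | a. a \<in> topspace (spc A)} \<union>
        {(Inr (a, 0), Inl (base X)) | a. a \<in> topspace (spc A)} \<union>
        {(Inr (base A, t), Inl (base X)) | t. t \<in> {0..1}})"

text \<open>The reduced mapping cone, the canonical map into it, and the notion of a cofiber sequence:
  up to based equivariant homotopy equivalence under \<open>X\<close> (commuting up to homotopy), the
  sequence is the one formed by a map and its mapping cone.\<close>

definition mapping_cone :: "('g, 'a) based_gspace \<Rightarrow> ('g, 'b) based_gspace \<Rightarrow> ('a \<Rightarrow> 'b) \<Rightarrow>
    ('g, ('b + 'a \<times> real) set) based_gspace" where
  "mapping_cone A X f =
     (let C = quotient_gspace (disjoint_union_gspace X (cylinder A)) (cone_equiv A X f)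
      in \<lparr>spc = spc C, act = act C, base = cone_equiv A X f `` {Inl (base X)}\<rparr>)"

definition mapping_cone_incl :: "('g, 'a) based_gspace \<Rightarrow> ('g, 'b) based_gspace \<Rightarrow>
    ('a \<Rightarrow> 'b) \<Rightarrow> 'b \<Rightarrow> ('b + 'a \<times> real) set" where
  "mapping_cone_incl A X f x = cone_equiv A X f `` {Inl x}"

definition cofiber_sequence :: "('g, 'm) monoid_scheme \<Rightarrow> ('g, 'a) based_gspace \<Rightarrow>
    ('g, 'b) based_gspace \<Rightarrow> ('g, 'c) based_gspace \<Rightarrow> ('a \<Rightarrow> 'b) \<Rightarrow> ('b \<Rightarrow> 'c) \<Rightarrow> bool" where
  "cofiber_sequence G A X C f q \<longleftrightarrow>
     is_based_gspace G A \<and> is_based_gspace G X \<and> is_based_gspace G C \<and>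
     based_gmap G A X f \<and> based_gmap G X C q \<and>
     (\<exists>e. based_ghomotopy_equivalence G (mapping_cone A X f) C e \<and>
          based_ghomotopic G X C (e \<circ> mapping_cone_incl A X f) q)"

definition attach_equiv :: "('g, 'a) gspace \<Rightarrow> ('g, 'd) gspace \<Rightarrow> ('g, 'd) gspace \<Rightarrow>
    ('d \<Rightarrow> 'a) \<Rightarrow> (('a + 'd) \<times> ('a + 'd)) set" where
  "attach_equiv A D S \<phi> = generated_equiv (topspace (spc (disjoint_union_gspace A D)))
     {(Inr s, Inl (\<phi> s)) | s. s \<in> topspace (spc S)}"

definition attach :: "('g, 'a) gspace \<Rightarrow> ('g, 'd) gspace \<Rightarrow> ('g, 'd) gspace \<Rightarrow>
    ('d \<Rightarrow> 'a) \<Rightarrow> ('g, ('a + 'd) set) gspace" where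
  "attach A D S \<phi> = quotient_gspace (disjoint_union_gspace A D) (attach_equiv A D S \<phi>)"

text \<open>\<open>X\<close>, with \<open>A\<close> mapped into it by \<open>j\<close>, arises from \<open>A\<close> by attaching \<open>D\<close> along an
  equivariant map defined on \<open>S \<subseteq> D\<close>.\<close>

definition obtained_by_attaching :: "('g, 'm) monoid_scheme \<Rightarrow> ('g, 'a) gspace \<Rightarrow>
    ('g, 'b) gspace \<Rightarrow> ('a \<Rightarrow> 'b) \<Rightarrow> ('g, 'd) gspace \<Rightarrow> ('g, 'd) gspace \<Rightarrow> bool" where
  "obtained_by_attaching G A X j D S \<longleftrightarrow>
     (\<exists>\<phi> \<theta>. gmap G S A \<phi> \<and> ghomeomorphism G (attach A D S \<phi>) X \<theta> \<and>
        (\<forall>a\<in>topspace (spc A). \<theta> (attach_equiv A D S \<phi> `` {Inl a}) = j a))"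

section \<open>Representations of cyclic groups\<close>

text \<open>The cyclic group of order \<open>n\<close> is \<open>integer_mod_group n\<close>, with carrier \<open>{0..<n}\<close> and
  generator \<open>1 mod n\<close>. A representation on a type is given by its action map.\<close>

definition zeta :: "nat \<Rightarrow> complex" where
  "zeta n = exp (2 * complex_of_real pi * \<i> / of_nat n)"

definition Phi :: "nat \<Rightarrow> int \<Rightarrow> int \<Rightarrow> complex \<Rightarrow> complex" where
  "Phi n r g z = z * (zeta n powi r) powi g"

definition Psi :: "nat \<Rightarrow> int \<Rightarrow> int \<Rightarrow> quat \<Rightarrow> quat" where
  "Psi n r g q = q * quat_of_complex ((zeta n powi r) powi g)"

definition quaternionic_rep :: "nat \<Rightarrow> (int \<Rightarrow> 'w::quaternion_module \<Rightarrow> 'w) \<Rightarrow> bool" where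
  "quaternionic_rep n \<rho> \<longleftrightarrow> group_action (integer_mod_group n) UNIV \<rho> \<and>
     (\<forall>g\<in>carrier (integer_mod_group n). quat_linear (\<rho> g))"

definition rep_sum :: "('g \<Rightarrow> 'v \<Rightarrow> 'v) \<Rightarrow> ('g \<Rightarrow> 'w \<Rightarrow> 'w) \<Rightarrow> 'g \<Rightarrow> 'v \<times> 'w \<Rightarrow> 'v \<times> 'w" where
  "rep_sum \<rho> \<sigma> g = map_prod (\<rho> g) (\<sigma> g)"

text \<open>The diagonal action. Its factors are complex linear when they are representations, so
  \<open>ctensor_map\<close> does not depend on choices here.\<close>

definition rep_ctensor_prod :: "('g \<Rightarrow> 'v \<Rightarrow> 'v) \<Rightarrow> ('g \<Rightarrow> 'w \<Rightarrow> 'w) \<Rightarrow>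
    'g \<Rightarrow> ('v::complex_vector, 'w::complex_vector) ctensor \<Rightarrow> ('v, 'w) ctensor" where
  "rep_ctensor_prod \<rho> \<sigma> g = ctensor_map (\<rho> g) (\<sigma> g)"

definition rep_sphere :: "('g \<Rightarrow> 'v \<Rightarrow> 'v) \<Rightarrow> ('g, 'v::real_vector option) based_gspace" where
  "rep_sphere \<rho> = \<lparr>spc = Alexandroff_compactification vector_topology,
     act = (\<lambda>g. map_option (\<rho> g)), base = None\<rparr>"

text \<open>A real orthogonal structure on a representation is a choice of invariant real inner
  product. Its unit disk and sphere carry the canonical topology of the underlying space.\<close>

definition invariant_inner_product :: "('g, 'm) monoid_scheme \<Rightarrow>
    ('g \<Rightarrow> 'v \<Rightarrow> 'v) \<Rightarrow> ('v::real_vector \<Rightarrow> 'v \<Rightarrow> real) \<Rightarrow> bool" where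
  "invariant_inner_product G \<rho> ip \<longleftrightarrow>
     bilinear ip \<and> (\<forall>v w. ip v w = ip w v) \<and> (\<forall>v. v \<noteq> 0 \<longrightarrow> 0 < ip v v) \<and>
     (\<forall>g\<in>carrier G. \<forall>v w. ip (\<rho> g v) (\<rho> g w) = ip v w)"

definition unit_disk :: "('v \<Rightarrow> 'v \<Rightarrow> real) \<Rightarrow> ('g \<Rightarrow> 'v \<Rightarrow> 'v) \<Rightarrow> ('g, 'v::real_vector) gspace" where
  "unit_disk ip \<rho> = \<lparr>spc = subtopology vector_topology {v. ip v v \<le> 1}, act = \<rho>\<rparr>"

definition unit_sphere :: "('v \<Rightarrow> 'v \<Rightarrow> real) \<Rightarrow> ('g \<Rightarrow> 'v \<Rightarrow> 'v) \<Rightarrow> ('g, 'v::real_vector) gspace" where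
  "unit_sphere ip \<rho> = \<lparr>spc = subtopology vector_topology {v. ip v v = 1}, act = \<rho>\<rparr>"

definition proj_equiv :: "('w::quaternion_module \<times> 'w) set" where
  "proj_equiv = {(w, scaleH p w) | w p. w \<noteq> 0 \<and> p \<noteq> 0}"

definition PH :: "('g \<Rightarrow> 'w \<Rightarrow> 'w) \<Rightarrow> ('g, 'w::quaternion_module set) gspace" where
  "PH \<rho> = quotient_gspace \<lparr>spc = subtopology vector_topology (UNIV - {0}), act = \<rho>\<rparr> proj_equiv"

text \<open>A point of the projective space is a class, that is, a quaternionic line without zero;
  the map induced by the inclusion of the first summand sends it to its image.\<close>

definition PH_incl :: "'w::quaternion_module set \<Rightarrow> ('w \<times> 'v::quaternion_module) set" where
  "PH_incl c = (\<lambda>w. (w, 0)) ` c"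

lemma proj_equiv_class: "w \<noteq> 0 \<Longrightarrow> proj_equiv `` {w} = {scaleH p w | p. p \<noteq> 0}"
  by (auto simp: proj_equiv_def)

lemma PH_action_class:
  assumes "quat_linear f" "w \<noteq> 0" "f w \<noteq> 0"
  shows "f ` (proj_equiv `` {w}) = proj_equiv `` {f w}"
proof -
  have "f (scaleH p w) = scaleH p (f w)" for p
    using assms(1) by (simp add: quat_linear_def)
  then show ?thesis
    unfolding proj_equiv_class [OF assms(2)] proj_equiv_class [OF assms(3)]
    by (simp add: setcompr_eq_image image_image)
qed

lemma PH_incl_class:
  fixes w :: "'w::quaternion_module"
  assumes "w \<noteq> 0"
  shows "PH_incl (proj_equiv `` {w}) =
    (proj_equiv `` {(w, 0)} :: ('w \<times> 'v::quaternion_module) set)"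
proof -
  have "scaleH p (0::'v) = 0" for p
    using scaleH_add_right [of p "0::'v" 0] by simp
  moreover have "(w, 0::'v) \<noteq> 0"
    using assms by (simp add: zero_prod_def)
  ultimately show ?thesis
    unfolding PH_incl_def proj_equiv_class [OF assms] proj_equiv_class [OF \<open>(w, 0) \<noteq> 0\<close>]
    by (auto simp: scaleH_prod_def)
qed

end

theory Submission
  imports Defs
begin

text \<open>Write a point of \<open>P(W \<oplus> \<Psi>\<^sub>k)\<close> as a class \<open>[w, q]\<close>. If \<open>q \<noteq> 0\<close>, it has a unique representative of
  the form \<open>(v, 1)\<close>, and the generator sends \<open>[v, 1]\<close> to \<open>[g v, \<zeta>\<^sup>k] = [\<zeta>\<^sup>-\<^sup>k g v, 1]\<close>. Hence the complement of
  \<open>P(W)\<close> is the space \<open>W\<close> with its action twisted by \<open>\<zeta>\<^sup>-\<^sup>k\<close>, and that is \<open>V = \<Phi>\<^sub>-\<^sub>k \<otimes> W\<close> by means of the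
  isomorphism \<open>z \<otimes> w \<mapsto> z w\<close> (\<open>ctensor_eval\<close>).

  For an invariant norm on \<open>V\<close> the map \<open>v \<mapsto> [v, 1 - |v|]\<close> (\<open>cell\<close>) is equivariant on the unit disk. It sends
  the open disk bijectively onto the complement of \<open>P(W)\<close>, and on the unit sphere it is the projection
  \<open>v \<mapsto> [v]\<close> onto \<open>P(W)\<close>. So it identifies two points only if both lie on the sphere and on the same
  quaternionic line (\<open>cell_eq\<close>). It is moreover a quotient map (\<open>quotient_map_cell\<close>); since quotient maps
  with the same fibres have homeomorphic targets, \<open>P(W \<oplus> \<Psi>\<^sub>k)\<close> is \<open>P(W)\<close> with the disk attached along the
  sphere (\<open>projective_space_obtained_by_attaching\<close>).

  For the cofiber sequence, the map \<open>cell\<close> extends radially from the unit disk to a map \<open>R\<close> (\<open>radial\<close>) from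
  \<open>V\<close> to the mapping cone of the inclusion: on the shell \<open>1 \<le> |v| \<le> 2\<close> the ray through \<open>v\<close> runs along the
  cone line of \<open>[v]\<close> down to the cone point. Likewise \<open>v \<mapsto> v / (1 - |v|)\<close>
  (\<open>wrap\<close>) maps the unit disk to the sphere \<open>S\<^sup>V\<close> and collapses the unit sphere to infinity. Collapsing the cone sends
  \<open>R v\<close> to \<open>wrap v\<close>, and \<open>wrap v \<mapsto> R (2 v)\<close> is a homotopy inverse: both composites are, up to a move inside
  the cone, the stretching by 2, and stretching by \<open>2 - t\<close> is a homotopy from it to the identity
  (\<open>ex_homotopy_sph\<close>, \<open>ex_homotopy_cone\<close>). All these maps are defined on quotients; they and the homotopies are
  obtained by descending from the disk and from the pieces of the cone.\<close>

section \<open>Quotients, sums and disjoint basepoints of topological spaces\<close>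

lemma topspace_quotient_topology [simp]: "topspace (quotient_topology X r) = topspace X // r"
proof
  show "topspace (quotient_topology X r) \<subseteq> topspace X // r"
    using openin_quotient_topology openin_topspace by blast
  have "{x \<in> topspace X. r `` {x} \<in> topspace X // r} = topspace X"
    by (auto intro: quotientI)
  then have "openin (quotient_topology X r) (topspace X // r)"
    by (simp add: openin_quotient_topology)
  then show "topspace X // r \<subseteq> topspace (quotient_topology X r)"
    by (rule openin_subset)
qed

lemma quotient_map_quotient_topology: "quotient_map X (quotient_topology X r) (\<lambda>x. r `` {x})"
  by (auto simp: quotient_map_def openin_quotient_topology quotient_def)

lemma topspace_disjoint_union_topology [simp]:
  "topspace (disjoint_union_topology X Y) = Inl ` topspace X \<union> Inr ` topspace Y" (is "?L = ?R")
proof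
  have "openin X (Inl -` ?L)" "openin Y (Inr -` ?L)"
    using openin_topspace openin_disjoint_union_topology by blast+
  then have "Inl -` ?L \<subseteq> topspace X" "Inr -` ?L \<subseteq> topspace Y"
    by (auto dest: openin_subset)
  show "?L \<subseteq> ?R"
  proof
    fix z assume "z \<in> ?L"
    then show "z \<in> ?R"
      using \<open>Inl -` ?L \<subseteq> topspace X\<close> \<open>Inr -` ?L \<subseteq> topspace Y\<close> by (cases z) auto
  qed
  have "Inl -` ?R = topspace X" "Inr -` ?R = topspace Y"
    by auto
  then have "openin (disjoint_union_topology X Y) ?R"
    by (simp add: openin_disjoint_union_topology)
  then show "?R \<subseteq> ?L"
    by (rule openin_subset)
qed

lemma open_map_Inl: "open_map X (disjoint_union_topology X Y) Inl"
proof -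
  have "Inl -` (Inl ` U :: ('a + 'b) set) = U" "Inr -` (Inl ` U :: ('a + 'b) set) = {}" for U
    by auto
  then show ?thesis
    by (simp add: open_map_def openin_disjoint_union_topology)
qed

lemma open_map_Inr: "open_map (Y :: 'b topology) (disjoint_union_topology (X :: 'a topology) Y) Inr"
proof -
  have "Inr -` (Inr ` U :: ('a + 'b) set) = U" "Inl -` (Inr ` U :: ('a + 'b) set) = {}" for U
    by auto
  then show ?thesis
    by (simp add: open_map_def openin_disjoint_union_topology)
qed

lemma continuous_map_Inl: "continuous_map X (disjoint_union_topology X Y) Inl"
  and continuous_map_Inr: "continuous_map Y (disjoint_union_topology X Y) Inr"
proof -
  have "{x \<in> topspace X. Inl x \<in> U} = Inl -` U" "{y \<in> topspace Y. Inr y \<in> U} = Inr -` U"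
    if "openin (disjoint_union_topology X Y) U" for U
    using openin_subset [OF that] by auto
  then show "continuous_map X (disjoint_union_topology X Y) Inl"
    "continuous_map Y (disjoint_union_topology X Y) Inr"
    by (auto simp: continuous_map_def openin_disjoint_union_topology)
qed

lemma topspace_plus_topology [simp]: "topspace (plus_topology X) = insert None (Some ` topspace X)"
  (is "?L = ?R")
proof
  have "openin X (Some -` ?L)"
    using openin_topspace openin_plus_topology by blast
  then have "Some -` ?L \<subseteq> topspace X"
    by (rule openin_subset)
  show "?L \<subseteq> ?R"
  proof
    fix z assume "z \<in> ?L"
    then show "z \<in> ?R"
      using \<open>Some -` ?L \<subseteq> topspace X\<close> by (cases z) auto
  qed
  have "Some -` ?R = topspace X"
    by auto
  then have "openin (plus_topology X) ?R"
    by (simp add: openin_plus_topology)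
  then show "?R \<subseteq> ?L"
    by (rule openin_subset)
qed

lemma open_map_Some_plus: "open_map X (plus_topology X) Some"
proof -
  have "Some -` Some ` U = U" for U :: "'a set"
    by auto
  then show ?thesis
    by (simp add: open_map_def openin_plus_topology)
qed

lemma continuous_map_Some_plus: "continuous_map X (plus_topology X) Some"
proof -
  have "{x \<in> topspace X. Some x \<in> U} = Some -` U" if "openin (plus_topology X) U" for U
    using openin_subset [OF that] by auto
  then show ?thesis
    by (auto simp: continuous_map_def openin_plus_topology)
qed

lemma open_map_None_plus: "open_map (discrete_topology {()}) (plus_topology X) (\<lambda>_. None)"
proof -
  have "Some -` (\<lambda>_. None) ` U = ({} :: 'a set)" for U :: "unit set"
    by auto
  then show ?thesis
    by (simp add: open_map_def openin_plus_topology)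
qed

text \<open>Two open maps that together cover \<open>X\<close> detect continuity on \<open>X\<close>, also after taking the
  product with a parameter space: maps out of a sum may be built summand by summand, and so may
  homotopies.\<close>

lemma continuous_map_prod_open_cover:
  assumes i: "open_map X1 X i" and j: "open_map X2 X j"
    and cover: "topspace X \<subseteq> i ` topspace X1 \<union> j ` topspace X2"
    and fi: "continuous_map (prod_topology Z X1) T (\<lambda>(z, x). f (z, i x))"
    and fj: "continuous_map (prod_topology Z X2) T (\<lambda>(z, x). f (z, j x))"
  shows "continuous_map (prod_topology Z X) T f"
proof -
  have *: "\<exists>N. openin (prod_topology Z X) N \<and> (z, k y) \<in> N \<and> N \<subseteq> {p \<in> topspace (prod_topology Z X). f p \<in> U}"
    if k: "open_map Y X k" and fk: "continuous_map (prod_topology Z Y) T (\<lambda>(z, x). f (z, k x))"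
      and U: "openin T U" and zy: "z \<in> topspace Z" "y \<in> topspace Y" "f (z, k y) \<in> U"
    for k and Y :: "'x topology" and U z y
  proof -
    have "openin (prod_topology Z Y) {p \<in> topspace (prod_topology Z Y). (\<lambda>(z, x). f (z, k x)) p \<in> U}"
      using fk U by (rule openin_continuous_map_preimage)
    moreover have "(z, y) \<in> {p \<in> topspace (prod_topology Z Y). (\<lambda>(z, x). f (z, k x)) p \<in> U}"
      using zy by simp
    ultimately have "\<exists>A B. openin Z A \<and> openin Y B \<and> z \<in> A \<and> y \<in> B \<and>
        A \<times> B \<subseteq> {p \<in> topspace (prod_topology Z Y). (\<lambda>(z, x). f (z, k x)) p \<in> U}"
      by (rule openin_prod_topology_alt [THEN iffD1, rule_format])
    then obtain A B where AB: "openin Z A" "openin Y B" "z \<in> A" "y \<in> B"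
      "A \<times> B \<subseteq> {p \<in> topspace (prod_topology Z Y). (\<lambda>(z, x). f (z, k x)) p \<in> U}"
      by blast
    have "openin X (k ` B)"
      using k AB(2) by (simp add: open_map_def)
    then have "openin (prod_topology Z X) (A \<times> k ` B)"
      using AB(1) by (simp add: openin_prod_Times_iff)
    moreover have "A \<times> k ` B \<subseteq> {p \<in> topspace (prod_topology Z X). f p \<in> U}"
      using AB(5) openin_subset [OF AB(1)] openin_subset [OF \<open>openin X (k ` B)\<close>] by auto
    ultimately show ?thesis
      using AB(3,4) by blast
  qed
  have ft: "f p \<in> topspace T" if "p \<in> topspace (prod_topology Z X)" for p
  proof -
    obtain z x where p: "p = (z, x)"
      by (cases p)
    then have z: "z \<in> topspace Z" and "x \<in> topspace X"
      using that by auto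
    with cover consider y where "y \<in> topspace X1" "x = i y" | y where "y \<in> topspace X2" "x = j y"
      by blast
    then show ?thesis
    proof cases
      case 1
      then show ?thesis
        using continuous_map_image_subset_topspace [OF fi] z unfolding p image_subset_iff by force
    next
      case 2
      then show ?thesis
        using continuous_map_image_subset_topspace [OF fj] z unfolding p image_subset_iff by force
    qed
  qed
  show ?thesis
    unfolding continuous_map_def
  proof (intro conjI allI impI)
    show "f \<in> topspace (prod_topology Z X) \<rightarrow> topspace T"
      using ft by blast
    fix U assume U: "openin T U"
    show "openin (prod_topology Z X) {p \<in> topspace (prod_topology Z X). f p \<in> U}"
    proof (subst openin_subopen, intro ballI)
      fix p assume p: "p \<in> {p \<in> topspace (prod_topology Z X). f p \<in> U}"
      then obtain z x where "p = (z, x)" "z \<in> topspace Z" "x \<in> topspace X"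
        by auto
      with cover consider y where "y \<in> topspace X1" "p = (z, i y)" | y where "y \<in> topspace X2" "p = (z, j y)"
        by blast
      then show "\<exists>N. openin (prod_topology Z X) N \<and> p \<in> N \<and> N \<subseteq> {p \<in> topspace (prod_topology Z X). f p \<in> U}"
        using *[OF i fi U \<open>z \<in> topspace Z\<close>] *[OF j fj U \<open>z \<in> topspace Z\<close>] p by cases auto
    qed
  qed
qed

lemma continuous_map_prod_disjoint_union:
  assumes "continuous_map (prod_topology Z X) T (\<lambda>(z, x). f (z, Inl x))"
    and "continuous_map (prod_topology Z Y) T (\<lambda>(z, y). f (z, Inr y))"
  shows "continuous_map (prod_topology Z (disjoint_union_topology X Y)) T f"
  by (rule continuous_map_prod_open_cover [OF open_map_Inl open_map_Inr _ assms]) simp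

lemma continuous_map_prod_plus:
  assumes "continuous_map Z T (\<lambda>z. f (z, None))"
    and "continuous_map (prod_topology Z X) T (\<lambda>(z, x). f (z, Some x))"
  shows "continuous_map (prod_topology Z (plus_topology X)) T f"
proof (rule continuous_map_prod_open_cover [OF open_map_None_plus open_map_Some_plus _ _ assms(2)])
  show "continuous_map (prod_topology Z (discrete_topology {()})) T (\<lambda>(z, x). f (z, None))"
    using continuous_map_compose [OF continuous_map_fst assms(1)]
    by (simp add: comp_def split_def)
qed auto

text \<open>A one-point parameter space turns the criteria for homotopies into criteria for single maps.\<close>

lemma continuous_map_from_prod_point:
  assumes "continuous_map (prod_topology (discrete_topology {()}) X) T (\<lambda>(z, x). f x)"
  shows "continuous_map X T f"
proof -
  have "continuous_map X (prod_topology (discrete_topology {()}) X) (\<lambda>x. ((), x))"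
    by (simp add: continuous_map_pairwise comp_def)
  from continuous_map_compose [OF this assms] show ?thesis
    by (simp add: comp_def)
qed

lemma continuous_map_prod_snd: "continuous_map X T f \<Longrightarrow> continuous_map (prod_topology Z X) T (\<lambda>(z, x). f x)"
  using continuous_map_compose [OF continuous_map_snd, of X T f Z] by (simp add: comp_def split_def)

lemma continuous_map_disjoint_union:
  assumes "continuous_map X T (\<lambda>x. f (Inl x))" "continuous_map Y T (\<lambda>y. f (Inr y))"
  shows "continuous_map (disjoint_union_topology X Y) T f"
  by (rule continuous_map_from_prod_point, rule continuous_map_prod_disjoint_union)
    (simp_all add: assms continuous_map_prod_snd)

lemma continuous_map_plus:
  assumes "f None \<in> topspace T" "continuous_map X T (\<lambda>x. f (Some x))"
  shows "continuous_map (plus_topology X) T f"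
  by (rule continuous_map_from_prod_point, rule continuous_map_prod_plus)
    (simp_all add: assms continuous_map_prod_snd)

section \<open>Generated equivalence relations\<close>

lemma generated_equiv_least:
  assumes "equiv A r" "S \<inter> A \<times> A \<subseteq> r"
  shows "generated_equiv A S \<subseteq> r"
  using assms by (auto simp: generated_equiv_def)

lemma equiv_generated_equiv: "equiv A (generated_equiv A S)"
proof (rule equivI)
  have full: "equiv A (A \<times> A)"
    by (auto simp: equiv_def refl_on_def sym_def trans_def)
  then show "generated_equiv A S \<subseteq> A \<times> A"
    by (rule generated_equiv_least) blast
  show "refl_on A (generated_equiv A S)"
    by (auto simp: refl_on_def generated_equiv_def equiv_def)
  show "sym (generated_equiv A S)"
    unfolding generated_equiv_def by (rule sym_INTER [of _ id, simplified]) (simp add: equiv_def)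
  show "trans (generated_equiv A S)"
    unfolding generated_equiv_def by (rule trans_INTER [of _ id, simplified]) (simp add: equiv_def)
qed

lemma generated_equiv_generator: "(x, y) \<in> S \<Longrightarrow> x \<in> A \<Longrightarrow> y \<in> A \<Longrightarrow> (x, y) \<in> generated_equiv A S"
  by (auto simp: generated_equiv_def)

text \<open>A function that respects the generators respects the generated relation, because its kernel is an
  equivalence relation. This is how maps out of a glued space are defined.\<close>

lemma generated_equiv_invariant:
  assumes "(x, y) \<in> generated_equiv A S"
    and "\<And>a b. (a, b) \<in> S \<Longrightarrow> a \<in> A \<Longrightarrow> b \<in> A \<Longrightarrow> f a = f b"
  shows "f x = f y"
proof -
  have "equiv A {(a, b) \<in> A \<times> A. f a = f b}"
    by (auto simp: equiv_def refl_on_def sym_def trans_def)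
  then have "generated_equiv A S \<subseteq> {(a, b) \<in> A \<times> A. f a = f b}"
    by (rule generated_equiv_least) (use assms(2) in auto)
  with assms(1) show ?thesis
    by auto
qed

lemma generated_equiv_map:
  assumes "(x, y) \<in> generated_equiv A S"
    and "\<And>a. a \<in> A \<Longrightarrow> f a \<in> A" "\<And>a b. (a, b) \<in> S \<Longrightarrow> a \<in> A \<Longrightarrow> b \<in> A \<Longrightarrow> (f a, f b) \<in> S"
  shows "(f x, f y) \<in> generated_equiv A S"
proof -
  have xy: "x \<in> A" "y \<in> A"
    using assms(1) equiv_generated_equiv [of A S] by (auto simp: equiv_def)
  have "generated_equiv A S `` {f a} = generated_equiv A S `` {f b}"
    if "(a, b) \<in> S" "a \<in> A" "b \<in> A" for a b
    using that by (intro equiv_class_eq [OF equiv_generated_equiv] generated_equiv_generator assms(2,3))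
  then have "generated_equiv A S `` {f x} = generated_equiv A S `` {f y}"
    by (rule generated_equiv_invariant [OF assms(1)])
  then show ?thesis
    by (rule eq_equiv_class [OF _ equiv_generated_equiv]) (rule assms(2), rule xy)
qed

section \<open>Constructions on spaces with a group action\<close>

lemma is_gspaceI:
  assumes G: "group G"
    and cont: "\<And>g. g \<in> carrier G \<Longrightarrow> continuous_map (spc X) (spc X) (act X g)"
    and one: "\<And>x. x \<in> topspace (spc X) \<Longrightarrow> act X \<one>\<^bsub>G\<^esub> x = x"
    and mult: "\<And>g h x. g \<in> carrier G \<Longrightarrow> h \<in> carrier G \<Longrightarrow> x \<in> topspace (spc X) \<Longrightarrow>
      act X (g \<otimes>\<^bsub>G\<^esub> h) x = act X g (act X h x)"
  shows "is_gspace G X"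
proof -
  interpret group G by (rule G)
  let ?S = "topspace (spc X)"
  let ?f = "\<lambda>g. restrict (act X g) ?S"
  have cl: "act X g x \<in> ?S" if "g \<in> carrier G" "x \<in> ?S" for g x
    using cont [OF that(1)] that(2) by (auto simp: continuous_map_def)
  have bij: "?f g \<in> Bij ?S" if g: "g \<in> carrier G" for g
  proof -
    have "act X g (act X (inv\<^bsub>G\<^esub> g) x) = x" "act X (inv\<^bsub>G\<^esub> g) (act X g x) = x" if "x \<in> ?S" for x
      using mult [of g "inv\<^bsub>G\<^esub> g" x] mult [of "inv\<^bsub>G\<^esub> g" g x] g that one [of x] by auto
    then have "bij_betw (?f g) ?S ?S"
      by (intro bij_betwI [where g = "?f (inv\<^bsub>G\<^esub> g)"]) (use g cl in auto)
    then show ?thesis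
      by (simp add: Bij_def)
  qed
  have "group_hom G (BijGroup ?S) ?f"
  proof (rule group_hom.intro [OF G group_BijGroup], rule group_hom_axioms.intro)
    show "?f \<in> hom G (BijGroup ?S)"
    proof (rule homI)
      show "?f g \<in> carrier (BijGroup ?S)" if "g \<in> carrier G" for g
        using bij [OF that] by (simp add: BijGroup_def)
      show "?f (g \<otimes>\<^bsub>G\<^esub> h) = ?f g \<otimes>\<^bsub>BijGroup ?S\<^esub> ?f h" if "g \<in> carrier G" "h \<in> carrier G" for g h
      proof -
        have "?f (g \<otimes>\<^bsub>G\<^esub> h) = compose ?S (?f g) (?f h)"
          using that by (auto simp: compose_def mult cl)
        then show ?thesis
          using bij that by (simp add: BijGroup_def)
      qed
    qed
  qed
  then show ?thesis
    by (simp add: is_gspace_def group_action_def cont)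
qed

lemma is_gspaceD:
  assumes "is_gspace G X"
  shows is_gspace_continuous: "\<And>g. g \<in> carrier G \<Longrightarrow> continuous_map (spc X) (spc X) (act X g)"
    and is_gspace_closed: "\<And>g x. g \<in> carrier G \<Longrightarrow> x \<in> topspace (spc X) \<Longrightarrow> act X g x \<in> topspace (spc X)"
    and is_gspace_one: "\<And>x. x \<in> topspace (spc X) \<Longrightarrow> act X \<one>\<^bsub>G\<^esub> x = x"
    and is_gspace_mult: "\<And>g h x. g \<in> carrier G \<Longrightarrow> h \<in> carrier G \<Longrightarrow> x \<in> topspace (spc X) \<Longrightarrow>
      act X (g \<otimes>\<^bsub>G\<^esub> h) x = act X g (act X h x)"
proof -
  let ?S = "topspace (spc X)"
  interpret group_action G ?S "\<lambda>g. restrict (act X g) ?S"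
    using assms by (simp add: is_gspace_def)
  show cont: "\<And>g. g \<in> carrier G \<Longrightarrow> continuous_map (spc X) (spc X) (act X g)"
    using assms by (simp add: is_gspace_def)
  show cl: "\<And>g x. g \<in> carrier G \<Longrightarrow> x \<in> ?S \<Longrightarrow> act X g x \<in> ?S"
    using cont by (auto simp: continuous_map_def)
  show "act X \<one>\<^bsub>G\<^esub> x = x" if "x \<in> ?S" for x
    using fun_cong [OF id_eq_one, of x] that by simp
  show "act X (g \<otimes>\<^bsub>G\<^esub> h) x = act X g (act X h x)"
    if "g \<in> carrier G" "h \<in> carrier G" "x \<in> ?S" for g h x
    using composition_rule [of x g h] that cl by simp
qed

lemma is_gspace_inverse:
  assumes "group G" "is_gspace G X" "g \<in> carrier G" "x \<in> topspace (spc X)"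
  shows "act X g (act X (inv\<^bsub>G\<^esub> g) x) = x"
proof -
  interpret group G by (rule assms(1))
  show ?thesis
    using is_gspace_mult [OF assms(2), of g "inv\<^bsub>G\<^esub> g" x] is_gspace_one [OF assms(2)] assms(3,4) by simp
qed

text \<open>An invariant relation has invariant classes; surjectivity of the action on a class comes
  from acting by the inverse.\<close>

lemma quotient_gspace_act_class:
  assumes "group G" "is_gspace G X" "equiv (topspace (spc X)) r"
    and inv: "\<And>g x y. g \<in> carrier G \<Longrightarrow> (x, y) \<in> r \<Longrightarrow> (act X g x, act X g y) \<in> r"
    and g: "g \<in> carrier G" and x: "x \<in> topspace (spc X)"
  shows "act (quotient_gspace X r) g (r `` {x}) = r `` {act X g x}"
proof -
  interpret group G by (rule assms(1))
  have sub: "r \<subseteq> topspace (spc X) \<times> topspace (spc X)"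
    using assms(3) by (simp add: equiv_def)
  have "z \<in> act X g ` (r `` {x})" if z: "(act X g x, z) \<in> r" for z
  proof (rule image_eqI)
    have zt: "z \<in> topspace (spc X)"
      using sub z by auto
    show "z = act X g (act X (inv\<^bsub>G\<^esub> g) z)"
      using is_gspace_inverse [OF assms(1,2) g zt] by simp
    have "act X (inv\<^bsub>G\<^esub> g) (act X g x) = x"
      using is_gspace_mult [OF assms(2), of "inv\<^bsub>G\<^esub> g" g x] is_gspace_one [OF assms(2) x] g x by simp
    then show "act X (inv\<^bsub>G\<^esub> g) z \<in> r `` {x}"
      using inv [OF inv_closed [OF g] z] by simp
  qed
  then show ?thesis
    using inv [OF g] by (auto simp: quotient_gspace_def)
qed

lemma is_gspace_quotient:
  assumes "group G" "is_gspace G X" "equiv (topspace (spc X)) r"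
    and inv: "\<And>g x y. g \<in> carrier G \<Longrightarrow> (x, y) \<in> r \<Longrightarrow> (act X g x, act X g y) \<in> r"
  shows "is_gspace G (quotient_gspace X r)"
proof -
  interpret group G by (rule assms(1))
  let ?Q = "quotient_gspace X r" and ?p = "\<lambda>x. r `` {x}"
  note [simp] = quotient_gspace_act_class [OF assms]
  have spc: "spc ?Q = quotient_topology (spc X) r"
    by (simp add: quotient_gspace_def)
  show ?thesis
  proof (rule is_gspaceI [OF assms(1)])
    fix g assume g: "g \<in> carrier G"
    have "continuous_map (spc X) (quotient_topology (spc X) r) (?p \<circ> act X g)"
      using is_gspace_continuous [OF assms(2) g] quotient_imp_continuous_map [OF quotient_map_quotient_topology]
      by (rule continuous_map_compose)
    then have "continuous_map (spc X) (quotient_topology (spc X) r) (act ?Q g \<circ> ?p)"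
      by (rule continuous_map_eq) (simp add: g)
    then show "continuous_map (spc ?Q) (spc ?Q) (act ?Q g)"
      unfolding spc by (rule continuous_compose_quotient_map [OF quotient_map_quotient_topology])
  next
    fix c assume "c \<in> topspace (spc ?Q)"
    then obtain x where x: "x \<in> topspace (spc X)" "c = ?p x"
      by (auto simp: spc quotient_def)
    then show "act ?Q \<one>\<^bsub>G\<^esub> c = c"
      by (simp add: is_gspace_one [OF assms(2)])
    fix g h assume "g \<in> carrier G" "h \<in> carrier G"
    then show "act ?Q (g \<otimes>\<^bsub>G\<^esub> h) c = act ?Q g (act ?Q h c)"
      using x by (simp add: is_gspace_mult [OF assms(2)] is_gspace_closed [OF assms(2)])
  qed
qed

lemma is_gspace_disjoint_union:
  assumes "group G" "is_gspace G X" "is_gspace G Y"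
  shows "is_gspace G (disjoint_union_gspace X Y)"
proof (rule is_gspaceI [OF assms(1)])
  interpret group G by (rule assms(1))
  fix g assume g: "g \<in> carrier G"
  show "continuous_map (spc (disjoint_union_gspace X Y)) (spc (disjoint_union_gspace X Y))
      (act (disjoint_union_gspace X Y) g)"
    unfolding disjoint_union_gspace_def
    using continuous_map_compose [OF is_gspace_continuous [OF assms(2) g] continuous_map_Inl]
      continuous_map_compose [OF is_gspace_continuous [OF assms(3) g] continuous_map_Inr]
    by (auto intro!: continuous_map_disjoint_union simp: comp_def)
qed (auto simp: disjoint_union_gspace_def is_gspaceD(3,4) [OF assms(2)] is_gspaceD(3,4) [OF assms(3)])

lemma is_gspace_cylinder:
  assumes "group G" "is_gspace G X"
  shows "is_gspace G (cylinder X)"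
proof (rule is_gspaceI [OF assms(1)])
  interpret group G by (rule assms(1))
  fix g assume g: "g \<in> carrier G"
  show "continuous_map (spc (cylinder X)) (spc (cylinder X)) (act (cylinder X) g)"
    using continuous_map_compose [OF continuous_map_fst is_gspace_continuous [OF assms(2) g]]
    by (auto simp: cylinder_def map_prod_def case_prod_beta comp_def continuous_map_pairwise
        intro: continuous_map_snd)
qed (auto simp: cylinder_def is_gspaceD(3,4) [OF assms(2)])

lemma is_based_gspace_disjoint_basepoint:
  assumes "group G" "is_gspace G X"
  shows "is_based_gspace G (disjoint_basepoint X)"
proof -
  have "is_gspace G (disjoint_basepoint X)"
  proof (rule is_gspaceI [OF assms(1)])
    fix g assume g: "g \<in> carrier G"
    show "continuous_map (spc (disjoint_basepoint X)) (spc (disjoint_basepoint X)) (act (disjoint_basepoint X) g)"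
      using continuous_map_compose [OF is_gspace_continuous [OF assms(2) g] continuous_map_Some_plus]
      by (auto simp: disjoint_basepoint_def comp_def intro!: continuous_map_plus)
  qed (auto simp: disjoint_basepoint_def is_gspaceD(3,4) [OF assms(2)])
  then show ?thesis
    by (auto simp: is_based_gspace_def disjoint_basepoint_def)
qed

section \<open>The canonical topology of a finite-dimensional real vector space\<close>

lemma topspace_vector_topology [simp]: "topspace (vector_topology :: 'v::real_vector topology) = UNIV"
proof -
  have "linear (\<lambda>_ :: 'v. 0 :: real)"
    by (simp add: linear_iff)
  then have "openin vector_topology ((\<lambda>_ :: 'v. 0 :: real) -` UNIV)"
    unfolding vector_topology_def by (intro topology_generated_by_Basis) blast
  then show ?thesis
    using openin_subset by fastforce
qed

lemma continuous_map_linear_functional: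
  assumes "linear (f :: 'v::real_vector \<Rightarrow> real)"
  shows "continuous_map vector_topology euclideanreal f"
proof -
  have "openin vector_topology (f -` U)" if "open U" for U
    unfolding vector_topology_def using assms that by (intro topology_generated_by_Basis) blast
  then show ?thesis
    by (simp add: continuous_map_def vimage_def)
qed

text \<open>The initial topology for the linear functionals: continuity into it is tested on them. All
  continuity of vector-valued maps below reduces to this test.\<close>

lemma continuous_map_vector_topology_iff:
  "continuous_map X (vector_topology :: 'v::real_vector topology) h \<longleftrightarrow>
    (\<forall>f :: 'v \<Rightarrow> real. linear f \<longrightarrow> continuous_map X euclideanreal (\<lambda>x. f (h x)))" (is "?L \<longleftrightarrow> ?R")
proof
  assume ?L
  then show ?R
    using continuous_map_compose [OF _ continuous_map_linear_functional] by (fastforce simp: comp_def)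
next
  assume R: ?R
  show ?L
    unfolding vector_topology_def
  proof (rule continuous_on_generated_topo)
    fix U assume "U \<in> {f -` U | (f :: 'v \<Rightarrow> real) U. linear f \<and> open U}"
    then obtain f V where f: "linear (f :: 'v \<Rightarrow> real)" "open V" "U = f -` V"
      by blast
    have "openin X {x \<in> topspace X. f (h x) \<in> V}"
      using R f(1,2) by (auto simp: continuous_map_def)
    moreover have "{x \<in> topspace X. f (h x) \<in> V} = h -` U \<inter> topspace X"
      using f(3) by auto
    ultimately show "openin X (h -` U \<inter> topspace X)"
      by simp
  next
    show "h ` topspace X \<subseteq> \<Union> {f -` U | (f :: 'v \<Rightarrow> real) U. linear f \<and> open U}"
    proof -
      have "\<Union> {f -` U | (f :: 'v \<Rightarrow> real) U. linear f \<and> open U} = topspace (vector_topology :: 'v topology)"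
        by (simp only: vector_topology_def topology_generated_by_topspace)
      then show ?thesis
        by (simp only: topspace_vector_topology subset_UNIV)
    qed
  qed
qed

lemma continuous_map_vector_functional:
  assumes "linear f" "continuous_map X vector_topology h"
  shows "continuous_map X euclideanreal (\<lambda>x. f (h x))"
  using assms by (simp add: continuous_map_vector_topology_iff)

lemma continuous_map_vector_const: "continuous_map X vector_topology (\<lambda>_. c)"
  by (simp add: continuous_map_vector_topology_iff)

lemma continuous_map_vector_linear:
  assumes "linear L" "continuous_map X vector_topology h"
  shows "continuous_map X vector_topology (\<lambda>x. L (h x))"
  unfolding continuous_map_vector_topology_iff
proof (intro allI impI)
  fix f :: "'b \<Rightarrow> real" assume "linear f"
  then have "linear (\<lambda>v. f (L v))"
    using linear_compose [OF assms(1)] by (simp add: comp_def)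
  then show "continuous_map X euclideanreal (\<lambda>x. f (L (h x)))"
    using assms(2) by (rule continuous_map_vector_functional)
qed

lemma continuous_map_vector_add:
  assumes "continuous_map X vector_topology h" "continuous_map X vector_topology k"
  shows "continuous_map X vector_topology (\<lambda>x. h x + k x)"
  using assms by (simp add: continuous_map_vector_topology_iff linear_add continuous_map_add)

lemma continuous_map_vector_scaleR:
  assumes "continuous_map X euclideanreal c" "continuous_map X vector_topology h"
  shows "continuous_map X vector_topology (\<lambda>x. c x *\<^sub>R h x)"
  using assms by (simp add: continuous_map_vector_topology_iff linear_scale continuous_map_real_mult)

text \<open>With \<open>linear_fst\<close> and \<open>linear_snd\<close> this makes the canonical topology of a product behave as the product
  topology, without a comparison of the two topologies.\<close>

lemma continuous_map_vector_Pair: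
  fixes h :: "'a \<Rightarrow> 'v::real_vector" and k :: "'a \<Rightarrow> 'w::real_vector"
  assumes "continuous_map X vector_topology h" "continuous_map X vector_topology k"
  shows "continuous_map X vector_topology (\<lambda>x. (h x, k x))"
proof -
  have "linear (\<lambda>v :: 'v. (v, 0 :: 'w))" "linear (\<lambda>w :: 'w. (0 :: 'v, w))"
    by (simp_all add: linear_iff)
  from continuous_map_vector_add [OF continuous_map_vector_linear [OF this(1) assms(1)]
      continuous_map_vector_linear [OF this(2) assms(2)]]
  show ?thesis
    by simp
qed

lemma linear_fst: "linear fst" and linear_snd: "linear snd"
  by (simp_all add: linear_iff)

section \<open>Inner products on a finite-dimensional space\<close>

locale fin_inner_product =
  fixes ip :: "'v::real_vector \<Rightarrow> 'v \<Rightarrow> real"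
  assumes bilinear_ip: "bilinear ip"
    and ip_commute: "ip v w = ip w v"
    and ip_pos: "v \<noteq> 0 \<Longrightarrow> 0 < ip v v"
    and fin_dim: "\<exists>B :: 'v set. finite B \<and> span B = UNIV"
begin

lemma linear_ip: "linear (ip v)" and linear_ip_left: "linear (\<lambda>v. ip v w)"
  using bilinear_ip by (simp_all add: bilinear_def)

lemmas ip_simps = linear_add [OF linear_ip] linear_add [OF linear_ip_left]
  linear_diff [OF linear_ip] linear_diff [OF linear_ip_left]
  linear_scale [OF linear_ip] linear_scale [OF linear_ip_left]
  linear_sum [OF linear_ip] linear_sum [OF linear_ip_left]
  linear_0 [OF linear_ip] linear_0 [OF linear_ip_left]

definition orthonormal :: "'v set \<Rightarrow> bool" where
  "orthonormal E \<longleftrightarrow> finite E \<and> (\<forall>a\<in>E. \<forall>b\<in>E. ip a b = (if a = b then 1 else 0))"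

text \<open>Gram--Schmidt.\<close>

lemma ex_orthonormal_span:
  assumes "finite B"
  shows "\<exists>E. orthonormal E \<and> span E = span B"
  using assms
proof induction
  case empty
  show ?case
    by (rule exI [of _ "{}"]) (simp add: orthonormal_def)
next
  case (insert b B)
  then obtain E where E: "orthonormal E" "span E = span B"
    by blast
  define s where "s = (\<Sum>e\<in>E. ip b e *\<^sub>R e)"
  define d where "d = b - s"
  have fin: "finite E"
    using E(1) by (simp add: orthonormal_def)
  have s: "s \<in> span E"
    unfolding s_def by (intro span_sum span_scale span_base)
  have ip_s: "ip s e = ip b e" if "e \<in> E" for e
  proof -
    have "ip s e = (\<Sum>a\<in>E. ip b a * ip a e)"
      by (simp add: s_def ip_simps)
    also have "\<dots> = (\<Sum>a\<in>E. if a = e then ip b a else 0)"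
      using E(1) that by (intro sum.cong) (auto simp: orthonormal_def)
    finally show ?thesis
      using fin that by simp
  qed
  have span_b: "span (insert b B) = span (insert b E)"
    by (metis E(2) span_insert)
  show ?case
  proof (cases "d = 0")
    case True
    then have "b \<in> span E"
      using s by (simp add: d_def)
    then show ?thesis
      using E(1) span_b by (metis span_redundant)
  next
    case False
    define u where "u = (1 / sqrt (ip d d)) *\<^sub>R d"
    have pos: "0 < ip d d"
      using False by (rule ip_pos)
    have "ip u u = 1"
      using pos by (simp add: u_def ip_simps power2_eq_square [symmetric])
    moreover have ue: "ip u e = 0" "ip e u = 0" if "e \<in> E" for e
      using ip_s [OF that] ip_commute [of e d] by (simp_all add: u_def d_def ip_simps)
    ultimately have "orthonormal (insert u E)"
      using E(1) by (auto simp: orthonormal_def)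
    moreover have "span (insert u E) = span (insert b E)"
    proof (rule span_eq [THEN iffD2], intro conjI insert_subsetI)
      show "u \<in> span (insert b E)"
        unfolding u_def d_def
        by (intro span_scale span_diff) (use s span_mono [of E "insert b E"] in \<open>auto intro: span_base\<close>)
      have "b = sqrt (ip d d) *\<^sub>R u + s"
        using pos by (simp add: u_def d_def)
      also have "\<dots> \<in> span (insert u E)"
        by (intro span_add span_scale) (use s span_mono [of E "insert u E"] in \<open>auto intro: span_base\<close>)
      finally show "b \<in> span (insert u E)" .
    qed (auto intro: span_base)
    ultimately show ?thesis
      using span_b by metis
  qed
qed

lemma ex_orthonormal_basis: "\<exists>E. orthonormal E \<and> span E = UNIV"
  using fin_dim ex_orthonormal_span by metis

text \<open>The difference \<open>d\<close> of \<open>v\<close> and its expansion is orthogonal to the basis, hence to itself.\<close>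

lemma orthonormal_expansion:
  assumes "orthonormal E" "span E = UNIV"
  shows "v = (\<Sum>e\<in>E. ip v e *\<^sub>R e)" and "ip v v = (\<Sum>e\<in>E. (ip v e)\<^sup>2)"
proof -
  define d where "d = v - (\<Sum>e\<in>E. ip v e *\<^sub>R e)"
  have fin: "finite E"
    using assms(1) by (simp add: orthonormal_def)
  have "ip d a = 0" if "a \<in> E" for a
  proof -
    have "ip d a = ip v a - (\<Sum>e\<in>E. ip v e * ip e a)"
      by (simp add: d_def ip_simps)
    also have "(\<Sum>e\<in>E. ip v e * ip e a) = (\<Sum>e\<in>E. if e = a then ip v e else 0)"
      using assms(1) that by (intro sum.cong) (auto simp: orthonormal_def)
    finally show ?thesis
      using fin that by simp
  qed
  then have "ip d d = 0"
    using linear_eq_0_on_span [OF linear_ip, of E d d] assms(2) by simp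
  then have "d = 0"
    using ip_pos [of d] by force
  then show v: "v = (\<Sum>e\<in>E. ip v e *\<^sub>R e)"
    by (simp add: d_def)
  have "ip v v = ip v (\<Sum>e\<in>E. ip v e *\<^sub>R e)"
    using v by simp
  then show "ip v v = (\<Sum>e\<in>E. (ip v e)\<^sup>2)"
    by (simp add: ip_simps power2_eq_square)
qed

definition nrm :: "'v \<Rightarrow> real" where "nrm v = sqrt (ip v v)"

lemma ip_nonneg: "0 \<le> ip v v"
  using ip_pos [of v] by (cases "v = 0") (auto simp: ip_simps)

lemma nrm_nonneg [simp]: "0 \<le> nrm v"
  by (simp add: nrm_def ip_nonneg)

lemma nrm_0 [simp]: "nrm 0 = 0"
  by (simp add: nrm_def ip_simps)

lemma nrm_eq_0 [simp]: "nrm v = 0 \<longleftrightarrow> v = 0"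
  using ip_pos [of v] by (cases "v = 0") (simp_all add: nrm_def ip_simps)

lemma nrm_pos [simp]: "0 < nrm v \<longleftrightarrow> v \<noteq> 0"
  by (simp add: less_le)

lemma nrm_scaleR [simp]: "nrm (c *\<^sub>R v) = \<bar>c\<bar> * nrm v"
  by (simp add: nrm_def ip_simps real_sqrt_mult flip: mult.assoc)

lemma ip_le_1_iff: "ip v v \<le> 1 \<longleftrightarrow> nrm v \<le> 1" and ip_eq_1_iff: "ip v v = 1 \<longleftrightarrow> nrm v = 1"
  by (simp_all add: nrm_def)

lemma continuous_map_nrm:
  assumes "continuous_map X vector_topology h"
  shows "continuous_map X euclideanreal (\<lambda>x. nrm (h x))"
proof -
  obtain E where E: "orthonormal E" "span E = UNIV"
    using ex_orthonormal_basis by blast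
  have "continuous_map X euclideanreal (\<lambda>x. ip (h x) e)" for e
    using linear_ip_left assms by (rule continuous_map_vector_functional)
  then have "continuous_map X euclideanreal (\<lambda>x. \<Sum>e\<in>E. (ip (h x) e)\<^sup>2)"
    using E(1) by (intro continuous_map_sum continuous_map_real_pow) (auto simp: orthonormal_def)
  then have "continuous_map X euclideanreal (\<lambda>x. ip (h x) (h x))"
    using orthonormal_expansion(2) [OF E] by simp
  then show ?thesis
    unfolding nrm_def by (intro continuous_map_sqrt)
qed

text \<open>In orthonormal coordinates the ball lies in a cube, which is compact by Tychonoff's
  theorem.\<close>

lemma compactin_ball: "compactin vector_topology {v. nrm v \<le> r}"
proof -
  obtain E where E: "orthonormal E" "span E = UNIV"
    using ex_orthonormal_basis by blast
  then have fin: "finite E"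
    by (simp add: orthonormal_def)
  let ?T = "product_topology (\<lambda>_ :: 'v. euclideanreal) E"
  define \<Phi> where "\<Phi> c = (\<Sum>e\<in>E. c e *\<^sub>R e)" for c :: "'v \<Rightarrow> real"
  have "continuous_map ?T vector_topology \<Phi>"
    unfolding continuous_map_vector_topology_iff \<Phi>_def
  proof (intro allI impI)
    fix f :: "'v \<Rightarrow> real" assume f: "linear f"
    have "continuous_map ?T euclideanreal (\<lambda>c. \<Sum>e\<in>E. c e * f e)"
      using fin by (intro continuous_map_sum continuous_map_real_mult continuous_map_product_projection) auto
    then show "continuous_map ?T euclideanreal (\<lambda>c. f (\<Sum>e\<in>E. c e *\<^sub>R e))"
      by (simp add: linear_sum [OF f] linear_scale [OF f])
  qed
  moreover have "compactin ?T (PiE E (\<lambda>_. {-r..r}))"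
    by (simp add: compactin_PiE)
  ultimately have cube: "compactin vector_topology (\<Phi> ` PiE E (\<lambda>_. {-r..r}))"
    by (rule image_compactin [rotated])
  have "{v. nrm v \<le> r} \<subseteq> \<Phi> ` PiE E (\<lambda>_. {-r..r})"
  proof clarify
    fix v assume v: "nrm v \<le> r"
    have "\<bar>ip v e\<bar> \<le> r" if "e \<in> E" for e
    proof -
      have "(ip v e)\<^sup>2 \<le> (\<Sum>e\<in>E. (ip v e)\<^sup>2)"
        using fin that by (intro member_le_sum) auto
      then have "\<bar>ip v e\<bar> \<le> nrm v"
        unfolding nrm_def orthonormal_expansion(2) [OF E, of v] by (metis real_sqrt_abs real_sqrt_le_iff)
      then show ?thesis
        using v by simp
    qed
    then have "restrict (ip v) E \<in> PiE E (\<lambda>_. {-r..r})"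
      by (auto simp: abs_le_iff minus_le_iff)
    moreover have "v = \<Phi> (restrict (ip v) E)"
      using orthonormal_expansion(1) [OF E, of v] by (simp add: \<Phi>_def)
    ultimately show "v \<in> \<Phi> ` PiE E (\<lambda>_. {-r..r})"
      by blast
  qed
  moreover have "closedin vector_topology {v. nrm v \<le> r}"
    using closedin_continuous_map_preimage [OF continuous_map_nrm [OF continuous_map_id [unfolded id_def]], of "{..r}"]
    by simp
  ultimately show ?thesis
    by (rule closed_compactin [OF cube])
qed

text \<open>Distinct points \<open>x\<close> and \<open>y\<close> are separated by the functional \<open>ip (x - y)\<close>.\<close>

lemma Hausdorff_space_vector: "Hausdorff_space (vector_topology :: 'v topology)"
  unfolding Hausdorff_space_def
proof (intro allI impI)
  fix x y :: 'v
  assume "x \<in> topspace vector_topology \<and> y \<in> topspace vector_topology \<and> x \<noteq> y"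
  then have "0 < ip (x - y) (x - y)"
    by (intro ip_pos) simp
  then have less: "ip (x - y) y < ip (x - y) x"
    by (simp add: ip_simps)
  define m where "m = (ip (x - y) x + ip (x - y) y) / 2"
  have "openin vector_topology {v. ip (x - y) v \<in> U}" if "open U" for U
    using openin_continuous_map_preimage [OF continuous_map_linear_functional [OF linear_ip]] that by fastforce
  from this [of "{m<..}"] this [of "{..<m}"]
  have op: "openin vector_topology {v. m < ip (x - y) v}" "openin vector_topology {v. ip (x - y) v < m}"
    by auto
  show "\<exists>U V. openin vector_topology U \<and> openin vector_topology V \<and> x \<in> U \<and> y \<in> V \<and> disjnt U V"
    by (intro exI conjI, rule op(1), rule op(2)) (use less in \<open>auto simp: m_def disjnt_def field_simps\<close>)
qed

lemma locally_compact_space_vector: "locally_compact_space (vector_topology :: 'v topology)"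
  unfolding locally_compact_space_def
proof
  fix x :: 'v
  have "openin vector_topology {v. nrm v < nrm x + 1}"
    using openin_continuous_map_preimage [OF continuous_map_nrm [OF continuous_map_id [unfolded id_def]], of "{..<nrm x + 1}"]
    by simp
  moreover have "{v. nrm v < nrm x + 1} \<subseteq> {v. nrm v \<le> nrm x + 1}"
    by auto
  ultimately show "\<exists>U K. openin vector_topology U \<and> compactin vector_topology K \<and> x \<in> U \<and> U \<subseteq> K"
    using compactin_ball by (intro exI [of _ "{v. nrm v < nrm x + 1}"] exI [of _ "{v. nrm v \<le> nrm x + 1}"]) simp
qed

end

text \<open>The standard inner product in the coordinates of some basis.\<close>

lemma ex_fin_inner_product:
  assumes "\<exists>B :: 'v::real_vector set. finite B \<and> span B = UNIV"
  shows "\<exists>ip :: 'v \<Rightarrow> 'v \<Rightarrow> real. fin_inner_product ip"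
proof -
  obtain S :: "'v set" where S: "finite S" "span S = UNIV"
    using assms by blast
  obtain B where B: "B \<subseteq> S" "independent B" "S \<subseteq> span B"
    using maximal_independent_subset by blast
  then have span: "span B = UNIV" and fin: "finite B"
    using S span_minimal [OF B(3) subspace_span] finite_subset by auto
  define c where "c = representation B"
  have c: "c (v + w) b = c v b + c w b" "c (r *\<^sub>R v) b = r * c v b" for v w r b
    using B(2) span by (simp_all add: c_def representation_add representation_scale)
  define ip where "ip v w = (\<Sum>b\<in>B. c v b * c w b)" for v w
  have "bilinear ip"
    by (simp add: bilinear_def linear_iff ip_def c algebra_simps sum.distrib sum_distrib_left)
  moreover have "ip v w = ip w v" for v w
    by (simp add: ip_def mult.commute)
  moreover have "0 < ip v v" if v: "v \<noteq> 0" for v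
  proof -
    have "(\<Sum>b\<in>B. c v b *\<^sub>R b) = v"
      unfolding c_def using B(2) span fin by (intro sum_representation_eq) auto
    moreover have "(\<Sum>b\<in>B. c v b *\<^sub>R b) = 0" if "\<forall>b\<in>B. c v b = 0"
      using that by simp
    ultimately obtain b where "b \<in> B" "c v b \<noteq> 0"
      using v by metis
    then show ?thesis
      unfolding ip_def using fin by (intro sum_pos2 [of B b]) (auto simp: zero_less_mult_iff linorder_neq_iff)
  qed
  ultimately show ?thesis
    using assms by (auto simp: fin_inner_product_def)
qed

text \<open>Averaging over the group makes an inner product invariant.\<close>

lemma ex_invariant_inner_product:
  fixes \<sigma> :: "'g \<Rightarrow> 'v::real_vector \<Rightarrow> 'v"
  assumes "group G" and fin: "finite (carrier G)" and "\<exists>B :: 'v set. finite B \<and> span B = UNIV"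
    and lin: "\<And>g. g \<in> carrier G \<Longrightarrow> linear (\<sigma> g)"
    and one: "\<And>v. \<sigma> \<one>\<^bsub>G\<^esub> v = v"
    and mult: "\<And>g h v. g \<in> carrier G \<Longrightarrow> h \<in> carrier G \<Longrightarrow> \<sigma> (g \<otimes>\<^bsub>G\<^esub> h) v = \<sigma> g (\<sigma> h v)"
  shows "\<exists>ip. invariant_inner_product G \<sigma> ip"
proof -
  interpret group G by (rule assms(1))
  obtain ip :: "'v \<Rightarrow> 'v \<Rightarrow> real" where "fin_inner_product ip"
    using ex_fin_inner_product [OF assms(3)] by blast
  then interpret fin_inner_product ip .
  define ip' where "ip' v w = (\<Sum>g\<in>carrier G. ip (\<sigma> g v) (\<sigma> g w))" for v w
  have "bilinear ip'"
    by (simp add: bilinear_def linear_iff ip'_def linear_add [OF lin] linear_scale [OF lin]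
        ip_simps sum.distrib sum_distrib_left)
  moreover have "ip' v w = ip' w v" for v w
    by (simp add: ip'_def ip_commute)
  moreover have "0 < ip' v v" if "v \<noteq> 0" for v
    unfolding ip'_def
    by (rule sum_pos2 [OF fin one_closed]) (simp_all add: one ip_pos that ip_nonneg)
  moreover have "ip' (\<sigma> h v) (\<sigma> h w) = ip' v w" if h: "h \<in> carrier G" for h v w
  proof -
    have "ip' (\<sigma> h v) (\<sigma> h w) = (\<Sum>g\<in>carrier G. ip (\<sigma> (g \<otimes>\<^bsub>G\<^esub> h) v) (\<sigma> (g \<otimes>\<^bsub>G\<^esub> h) w))"
      unfolding ip'_def using h by (intro sum.cong) (simp_all add: mult)
    also have "\<dots> = ip' v w"
      unfolding ip'_def
      by (rule sum.reindex_bij_witness [of _ "\<lambda>g. g \<otimes>\<^bsub>G\<^esub> inv\<^bsub>G\<^esub> h" "\<lambda>g. g \<otimes>\<^bsub>G\<^esub> h"])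
        (use h in \<open>auto simp: m_assoc\<close>)
    finally show ?thesis .
  qed
  ultimately show ?thesis
    unfolding invariant_inner_product_def by blast
qed

section \<open>Quaternionic scalars\<close>

lemma quat_eq_iff: "p = q \<longleftrightarrow> qre p = qre q \<and> qi p = qi q \<and> qj p = qj q \<and> qk p = qk q"
  by (cases p; cases q) simp

lemmas quat_defs = zero_quat_def one_quat_def plus_quat_def minus_quat_def uminus_quat_def
  scaleR_quat_def times_quat_def quat_of_complex_def

lemma quat_of_complex_of_real: "quat_of_complex (complex_of_real r) = r *\<^sub>R 1"
  by (simp add: quat_defs)

lemma quat_of_complex_mult: "quat_of_complex (c * d) = quat_of_complex c * quat_of_complex d"
  by (simp add: quat_defs)

lemma quat_of_complex_1 [simp]: "quat_of_complex 1 = 1"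
  by (simp add: quat_defs)

lemma quat_of_complex_eq_0 [simp]: "quat_of_complex c = 0 \<longleftrightarrow> c = 0"
  by (simp add: quat_defs complex_eq_iff)

lemma scaleH_0_right [simp]: "scaleH p 0 = 0"
  using scaleH_add_right [of p 0 0] by simp

lemma scaleH_0_left [simp]: "scaleH 0 x = 0"
  using scaleH_add_left [of 0 0 x] by simp

lemma scaleH_scaleR_left: "scaleH (r *\<^sub>R p) x = r *\<^sub>R scaleH p x"
proof -
  have "r *\<^sub>R scaleH p x = scaleH (quat_of_complex (complex_of_real r)) (scaleH p x)"
    by (simp only: scaleC_of_real scaleH_of_complex)
  also have "\<dots> = scaleH (r *\<^sub>R p) x"
    by (simp add: scaleH_scaleH quat_of_complex_of_real)
  finally show ?thesis ..
qed

lemma scaleH_of_real [simp]: "scaleH (r *\<^sub>R 1) x = r *\<^sub>R x"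
  by (simp add: scaleH_scaleR_left scaleH_one)

lemma scaleH_scaleR_right: "scaleH p (r *\<^sub>R x) = r *\<^sub>R scaleH p x"
proof -
  have "scaleH p (r *\<^sub>R x) = scaleH p (scaleH (r *\<^sub>R 1) x)"
    by simp
  also have "\<dots> = scaleH (p * (r *\<^sub>R 1)) x"
    by (rule scaleH_scaleH)
  finally show ?thesis
    by (simp add: scaleH_scaleR_left)
qed

lemma linear_scaleH: "linear (scaleH p)"
  by (simp add: linear_iff scaleH_add_right scaleH_scaleR_right)

lemma scaleH_eq_0_iff [simp]: "scaleH p x = 0 \<longleftrightarrow> p = 0 \<or> x = 0"
proof -
  have "x = 0" if "scaleH p x = 0" "p \<noteq> 0"
    using arg_cong [OF that(1), of "scaleH (inverse p)"] that(2) by (simp add: scaleH_scaleH scaleH_one)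
  then show ?thesis
    by auto
qed

lemma quat_linear_imp_linear: "quat_linear f \<Longrightarrow> linear f"
  unfolding quat_linear_def linear_iff by (metis scaleH_of_real)

lemma quat_linear_imp_complex_linear: "quat_linear f \<Longrightarrow> complex_linear f"
  unfolding quat_linear_def complex_linear_def by (metis scaleH_of_complex)

lemma quat_linear_0: "quat_linear f \<Longrightarrow> f 0 = 0"
  by (rule linear_0 [OF quat_linear_imp_linear])

text \<open>Scalar multiplication is real bilinear, so in the real coordinates of the scalar it is a
  combination of continuous functions with fixed linear maps.\<close>

lemma continuous_map_scaleH:
  fixes h :: "'a \<Rightarrow> 'w::quaternion_module"
  assumes p: "continuous_map X vector_topology p" and h: "continuous_map X vector_topology h"
  shows "continuous_map X vector_topology (\<lambda>x. scaleH (p x) (h x))"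
proof -
  have comp: "linear qre" "linear qi" "linear qj" "linear qk"
    by (simp_all add: linear_iff plus_quat_def scaleR_quat_def)
  have "q = qre q *\<^sub>R 1 + qi q *\<^sub>R Quat 0 1 0 0 + qj q *\<^sub>R Quat 0 0 1 0 + qk q *\<^sub>R Quat 0 0 0 1" for q
    by (simp add: quat_defs)
  from arg_cong [OF this, of "\<lambda>q. scaleH q x" for x]
  have "(\<lambda>x. scaleH (p x) (h x)) = (\<lambda>x. qre (p x) *\<^sub>R h x + qi (p x) *\<^sub>R scaleH (Quat 0 1 0 0) (h x)
      + qj (p x) *\<^sub>R scaleH (Quat 0 0 1 0) (h x) + qk (p x) *\<^sub>R scaleH (Quat 0 0 0 1) (h x))"
    unfolding scaleH_add_left scaleH_scaleR_left scaleH_one by (rule ext)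
  moreover have "continuous_map X vector_topology \<dots>"
    by (intro continuous_map_vector_add continuous_map_vector_scaleR
        continuous_map_vector_functional [OF _ p] comp h continuous_map_vector_linear [OF linear_scaleH])
  ultimately show ?thesis
    by (simp only:)
qed

definition quat_inner :: "quat \<Rightarrow> quat \<Rightarrow> real" where
  "quat_inner p q = qre p * qre q + qi p * qi q + qj p * qj q + qk p * qk q"

interpretation quat: fin_inner_product quat_inner
proof
  show "bilinear quat_inner"
    by (simp add: bilinear_def linear_iff quat_inner_def plus_quat_def scaleR_quat_def algebra_simps)
  show "quat_inner v w = quat_inner w v" for v w
    by (simp add: quat_inner_def mult.commute)
  show "0 < quat_inner v v" if "v \<noteq> 0" for v
  proof -
    have "0 \<le> quat_inner v v" "quat_inner v v \<noteq> 0"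
      using that by (auto simp: quat_inner_def zero_quat_def quat_eq_iff add_nonneg_eq_0_iff)
    then show ?thesis
      by simp
  qed
  let ?B = "{1, Quat 0 1 0 0, Quat 0 0 1 0, Quat 0 0 0 1}"
  have "q = qre q *\<^sub>R 1 + qi q *\<^sub>R Quat 0 1 0 0 + qj q *\<^sub>R Quat 0 0 1 0 + qk q *\<^sub>R Quat 0 0 0 1" for q
    by (simp add: quat_defs)
  moreover have "qre q *\<^sub>R 1 + qi q *\<^sub>R Quat 0 1 0 0 + qj q *\<^sub>R Quat 0 0 1 0 + qk q *\<^sub>R Quat 0 0 0 1 \<in> span ?B" for q
    by (intro span_add span_scale span_base) auto
  ultimately have "span ?B = UNIV"
    by (metis UNIV_eq_I)
  then show "\<exists>B :: quat set. finite B \<and> span B = UNIV"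
    by (intro exI [of _ ?B]) simp
qed

text \<open>Conjugation inverts unit quaternions and, unlike the inverse, is linear and hence continuous for
  free.\<close>

definition qconj :: "quat \<Rightarrow> quat" where "qconj p = Quat (qre p) (- qi p) (- qj p) (- qk p)"

lemma linear_qconj: "linear qconj"
  by (simp add: linear_iff qconj_def plus_quat_def scaleR_quat_def)

lemma qconj_mult_unit: "quat.nrm u = 1 \<Longrightarrow> qconj u * u = 1"
  by (simp add: quat.nrm_def quat_inner_def qconj_def times_quat_def one_quat_def algebra_simps)

section \<open>Quaternionic representations of cyclic groups and their projective spaces\<close>

abbreviation punctured :: "'w::real_vector topology" where
  "punctured \<equiv> subtopology vector_topology (UNIV - {0})"

abbreviation line :: "'w::quaternion_module \<Rightarrow> 'w set" where
  "line w \<equiv> proj_equiv `` {w}"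

lemma equiv_proj_equiv: "equiv (UNIV - {0}) (proj_equiv :: ('w::quaternion_module \<times> 'w) set)"
proof (rule equivI)
  show "(proj_equiv :: ('w \<times> 'w) set) \<subseteq> (UNIV - {0}) \<times> (UNIV - {0})"
    by (auto simp: proj_equiv_def)
  show "refl_on (UNIV - {0}) (proj_equiv :: ('w \<times> 'w) set)"
  proof (rule refl_onI)
    fix w :: 'w assume "w \<in> UNIV - {0}"
    then have "(w, scaleH 1 w) \<in> (proj_equiv :: ('w \<times> 'w) set)"
      unfolding proj_equiv_def by (intro CollectI exI [of _ w] exI [of _ 1]) simp
    then show "(w, w) \<in> (proj_equiv :: ('w \<times> 'w) set)"
      by (simp add: scaleH_one)
  qed
  show "sym (proj_equiv :: ('w \<times> 'w) set)"
  proof (rule symI)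
    fix v w :: 'w assume "(v, w) \<in> (proj_equiv :: ('w \<times> 'w) set)"
    then obtain p where "v \<noteq> 0" "p \<noteq> 0" "w = scaleH p v"
      by (auto simp: proj_equiv_def)
    then have "v = scaleH (inverse p) w" "w \<noteq> 0" "inverse p \<noteq> 0"
      by (simp_all add: scaleH_scaleH scaleH_one)
    then show "(w, v) \<in> (proj_equiv :: ('w \<times> 'w) set)"
      unfolding proj_equiv_def by blast
  qed
  show "trans (proj_equiv :: ('w \<times> 'w) set)"
  proof (rule transI)
    fix u v w :: 'w assume "(u, v) \<in> proj_equiv" "(v, w) \<in> (proj_equiv :: ('w \<times> 'w) set)"
    then obtain p q where "u \<noteq> 0" "p \<noteq> 0" "q \<noteq> 0" "w = scaleH (q * p) u"
      by (auto simp: proj_equiv_def scaleH_scaleH)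
    then show "(u, w) \<in> (proj_equiv :: ('w \<times> 'w) set)"
      unfolding proj_equiv_def by force
  qed
qed

lemma line_eq_iff:
  assumes "v \<noteq> 0" "w \<noteq> 0"
  shows "line v = line w \<longleftrightarrow> (\<exists>p. p \<noteq> 0 \<and> w = scaleH p v)"
proof -
  have "line v = line w \<longleftrightarrow> (v, w) \<in> proj_equiv"
    using eq_equiv_class_iff [OF equiv_proj_equiv] assms by auto
  then show ?thesis
    using assms by (auto simp: proj_equiv_def)
qed

lemma line_scaleH [simp]: "p \<noteq> 0 \<Longrightarrow> w \<noteq> 0 \<Longrightarrow> line (scaleH p w) = line w"
  using line_eq_iff [of w "scaleH p w"] by auto

lemma line_scaleR: "c \<noteq> 0 \<Longrightarrow> w \<noteq> 0 \<Longrightarrow> line (c *\<^sub>R w) = line w"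
  using line_scaleH [of "c *\<^sub>R 1" w] by (simp del: line_scaleH)

lemma topspace_PH: "topspace (spc (PH \<rho>)) = line ` (UNIV - {0})"
  by (auto simp: PH_def quotient_gspace_def quotient_def)

lemma line_in_topspace_PH [simp]: "w \<noteq> 0 \<Longrightarrow> line w \<in> topspace (spc (PH \<rho>))"
  by (auto simp: topspace_PH)

lemma quotient_map_line: "quotient_map punctured (spc (PH \<rho>)) line"
  using quotient_map_quotient_topology [of punctured proj_equiv]
  by (simp add: PH_def quotient_gspace_def)

lemma continuous_map_line:
  assumes "continuous_map X vector_topology h" "\<And>x. x \<in> topspace X \<Longrightarrow> h x \<noteq> 0"
  shows "continuous_map X (spc (PH \<rho>)) (\<lambda>x. line (h x))"
proof -
  have "continuous_map X punctured h"
    using assms by (auto intro: continuous_map_into_subtopology)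
  from continuous_map_compose [OF this quotient_imp_continuous_map [OF quotient_map_line]]
  show ?thesis
    by (simp add: comp_def)
qed

lemma quaternionic_repD:
  assumes "quaternionic_rep n \<rho>"
  shows rep_quat_linear: "\<And>g. g \<in> carrier (integer_mod_group n) \<Longrightarrow> quat_linear (\<rho> g)"
    and rep_one: "\<rho> 0 x = x"
    and rep_mult: "\<And>g h. g \<in> carrier (integer_mod_group n) \<Longrightarrow> h \<in> carrier (integer_mod_group n) \<Longrightarrow>
      \<rho> ((g + h) mod int n) x = \<rho> g (\<rho> h x)"
proof -
  interpret group_action "integer_mod_group n" UNIV \<rho>
    using assms by (simp add: quaternionic_rep_def)
  show "\<And>g. g \<in> carrier (integer_mod_group n) \<Longrightarrow> quat_linear (\<rho> g)"
    using assms by (simp add: quaternionic_rep_def)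
  show "\<rho> 0 x = x"
    using fun_cong [OF id_eq_one, of x] by simp
  show "\<rho> ((g + h) mod int n) x = \<rho> g (\<rho> h x)"
    if "g \<in> carrier (integer_mod_group n)" "h \<in> carrier (integer_mod_group n)" for g h
    using composition_rule [of x g h] that by simp
qed

lemma is_gspace_vector:
  fixes \<rho> :: "int \<Rightarrow> 'v::real_vector \<Rightarrow> 'v"
  assumes "\<And>g. g \<in> carrier (integer_mod_group n) \<Longrightarrow> linear (\<rho> g)" "\<And>x. \<rho> 0 x = x"
    and "\<And>g h x. g \<in> carrier (integer_mod_group n) \<Longrightarrow> h \<in> carrier (integer_mod_group n) \<Longrightarrow>
      \<rho> ((g + h) mod int n) x = \<rho> g (\<rho> h x)"
  shows "is_gspace (integer_mod_group n) \<lparr>spc = vector_topology, act = \<rho>\<rparr>"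
proof (rule is_gspaceI)
  fix g assume "g \<in> carrier (integer_mod_group n)"
  then have "continuous_map vector_topology vector_topology (\<rho> g)"
    by (intro continuous_map_vector_linear [OF _ continuous_map_id [unfolded id_def]] assms(1))
  then show "continuous_map (spc \<lparr>spc = vector_topology, act = \<rho>\<rparr>) (spc \<lparr>spc = vector_topology, act = \<rho>\<rparr>)
      (act \<lparr>spc = vector_topology, act = \<rho>\<rparr> g)"
    by simp
qed (simp_all add: assms)

lemma quaternionic_repI:
  fixes \<rho> :: "int \<Rightarrow> 'w::quaternion_module \<Rightarrow> 'w"
  assumes "\<And>g. g \<in> carrier (integer_mod_group n) \<Longrightarrow> quat_linear (\<rho> g)" "\<And>x. \<rho> 0 x = x"
    and "\<And>g h x. g \<in> carrier (integer_mod_group n) \<Longrightarrow> h \<in> carrier (integer_mod_group n) \<Longrightarrow>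
      \<rho> ((g + h) mod int n) x = \<rho> g (\<rho> h x)"
  shows "quaternionic_rep n \<rho>"
  using is_gspace_vector [OF quat_linear_imp_linear [OF assms(1)] assms(2,3)] assms(1)
  by (simp add: quaternionic_rep_def is_gspace_def restrict_def)

lemma rep_eq_0_iff:
  assumes "quaternionic_rep n \<rho>" "g \<in> carrier (integer_mod_group n)"
  shows "\<rho> g x = 0 \<longleftrightarrow> x = 0"
proof
  interpret group "integer_mod_group n" by simp
  have [simp]: "\<rho> h 0 = 0" if "h \<in> carrier (integer_mod_group n)" for h
    using quat_linear_0 [OF rep_quat_linear [OF assms(1) that]] .
  show "x = 0" if "\<rho> g x = 0"
  proof -
    let ?h = "inv\<^bsub>integer_mod_group n\<^esub> g"
    have h: "?h \<in> carrier (integer_mod_group n)" and "(?h + g) mod int n = 0"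
      using l_inv [OF assms(2)] assms(2) by (simp_all only: inv_closed mult_integer_mod_group one_integer_mod_group)
    then have "x = \<rho> ?h (\<rho> g x)"
      using rep_mult [OF assms(1) h assms(2), of x] rep_one [OF assms(1)] by simp
    then show ?thesis
      using that h by simp
  qed
qed (use assms(2) quat_linear_0 [OF rep_quat_linear [OF assms]] in simp)

lemma is_gspace_punctured:
  assumes "quaternionic_rep n \<rho>"
  shows "is_gspace (integer_mod_group n) \<lparr>spc = punctured, act = \<rho>\<rparr>"
proof (rule is_gspaceI)
  fix g assume g: "g \<in> carrier (integer_mod_group n)"
  have "continuous_map punctured vector_topology (\<rho> g)"
    by (intro continuous_map_from_subtopology continuous_map_vector_linear [OF _ continuous_map_id [unfolded id_def]]
        quat_linear_imp_linear rep_quat_linear [OF assms g])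
  then show "continuous_map (spc \<lparr>spc = punctured, act = \<rho>\<rparr>) (spc \<lparr>spc = punctured, act = \<rho>\<rparr>) (act \<lparr>spc = punctured, act = \<rho>\<rparr> g)"
    using rep_eq_0_iff [OF assms g] by (simp add: continuous_map_into_subtopology)
qed (use rep_one [OF assms] rep_mult [OF assms] in auto)

lemma proj_equiv_invariant:
  assumes "quaternionic_rep n \<rho>" "g \<in> carrier (integer_mod_group n)" "(x, y) \<in> proj_equiv"
  shows "(\<rho> g x, \<rho> g y) \<in> proj_equiv"
proof -
  obtain p where "x \<noteq> 0" "p \<noteq> 0" "y = scaleH p x"
    using assms(3) by (auto simp: proj_equiv_def)
  then have "\<rho> g x \<noteq> 0" "\<rho> g y = scaleH p (\<rho> g x)"
    using rep_quat_linear [OF assms(1,2)] rep_eq_0_iff [OF assms(1,2)] by (auto simp: quat_linear_def)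
  then show ?thesis
    using \<open>p \<noteq> 0\<close> unfolding proj_equiv_def by blast
qed

lemma is_gspace_PH:
  assumes "quaternionic_rep n \<rho>"
  shows "is_gspace (integer_mod_group n) (PH \<rho>)"
  unfolding PH_def
  by (rule is_gspace_quotient [OF _ is_gspace_punctured [OF assms]])
    (use equiv_proj_equiv proj_equiv_invariant [OF assms] in simp_all)

lemma act_PH_line:
  assumes "quaternionic_rep n \<rho>" "g \<in> carrier (integer_mod_group n)" "w \<noteq> 0"
  shows "act (PH \<rho>) g (line w) = line (\<rho> g w)"
  using PH_action_class [OF rep_quat_linear [OF assms(1,2)] assms(3)] rep_eq_0_iff [OF assms(1,2)] assms(3)
  by (simp add: PH_def quotient_gspace_def)

lemma zeta_powi_n: "n \<ge> 1 \<Longrightarrow> zeta n powi int n = 1"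
proof -
  assume "n \<ge> 1"
  then have "zeta n ^ n = exp (of_nat n * (2 * complex_of_real pi * \<i> / of_nat n))"
    by (simp only: zeta_def exp_of_nat_mult)
  also have "of_nat n * (2 * complex_of_real pi * \<i> / of_nat n) = 2 * complex_of_real pi * \<i>"
    using \<open>n \<ge> 1\<close> by simp
  finally show ?thesis
    by simp
qed

lemma zeta_nonzero [simp]: "zeta n \<noteq> 0"
  by (simp add: zeta_def)

text \<open>Group elements are residues, so the exponent is reduced modulo \<open>n\<close>; this is harmless because
  \<open>\<zeta>\<close> has order dividing \<open>n\<close>.\<close>

lemma character_mod:
  assumes "n \<ge> 1"
  shows "(zeta n powi r) powi ((g + h) mod int n) = (zeta n powi r) powi g * (zeta n powi r) powi h"
proof -
  have per: "(zeta n powi r) powi (int n * m) = 1" for m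
  proof -
    have "(zeta n powi r) powi (int n * m) = zeta n powi (int n * (r * m))"
      by (simp only: power_int_mult [symmetric] mult.left_commute)
    also have "\<dots> = 1"
      unfolding power_int_mult zeta_powi_n [OF assms] by simp
    finally show ?thesis .
  qed
  have "(zeta n powi r) powi (g + h) = (zeta n powi r) powi (int n * ((g + h) div int n) + (g + h) mod int n)"
    by simp
  also have "\<dots> = (zeta n powi r) powi ((g + h) mod int n)"
    by (subst power_int_add) (simp_all add: per)
  finally show ?thesis
    by (simp add: power_int_add)
qed

lemma quaternionic_rep_sum_Psi:
  assumes "n \<ge> 1" "quaternionic_rep n \<rho>"
  shows "quaternionic_rep n (rep_sum \<rho> (Psi n k))"
proof (rule quaternionic_repI)
  fix g assume "g \<in> carrier (integer_mod_group n)"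
  from rep_quat_linear [OF assms(2) this] show "quat_linear (rep_sum \<rho> (Psi n k) g)"
    by (auto simp: quat_linear_def rep_sum_def Psi_def scaleH_prod_def scaleH_quat_def algebra_simps)
next
  show "rep_sum \<rho> (Psi n k) 0 x = x" for x
    by (cases x) (simp add: rep_sum_def Psi_def rep_one [OF assms(2)])
  fix g h x
  assume "g \<in> carrier (integer_mod_group n)" "h \<in> carrier (integer_mod_group n)"
  moreover have "quat_of_complex ((zeta n powi k) powi ((g + h) mod int n)) =
      quat_of_complex ((zeta n powi k) powi h) * quat_of_complex ((zeta n powi k) powi g)"
    by (simp only: character_mod [OF assms(1)] quat_of_complex_mult [symmetric] mult.commute)
  ultimately show "rep_sum \<rho> (Psi n k) ((g + h) mod int n) x = rep_sum \<rho> (Psi n k) g (rep_sum \<rho> (Psi n k) h x)"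
    by (cases x) (simp add: rep_sum_def Psi_def rep_mult [OF assms(2)] mult.assoc)
qed

section \<open>Tensoring with the one-dimensional representation\<close>

lemma tensor_add_right: "tensor a (b + b') = tensor a b + tensor a b'"
  by transfer (use tensor_relators.add_right in \<open>simp add: tensor_equiv_def diff_diff_add [symmetric]\<close>)

lemma tensor_balanced: "tensor (scaleC c a) b = tensor a (scaleC c b)"
  by transfer (simp add: tensor_equiv_def tensor_relators.balanced)

lemma tensor_diff_right: "tensor a (b - b') = tensor a b - tensor a b'"
  using tensor_add_right [of a "b - b'" b'] by simp

text \<open>The multiplication \<open>z \<otimes> w \<mapsto> z w\<close> on representatives, which are formal integer combinations of pairs.
  It is needed to see that \<open>w \<mapsto> 1 \<otimes> w\<close> is injective; surjectivity is a matter of moving scalars across.\<close>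

definition frag_eval :: "(complex \<times> 'w::complex_vector \<Rightarrow>\<^sub>0 int) \<Rightarrow> 'w" where
  "frag_eval x = (\<Sum>p\<in>Poly_Mapping.keys x. of_int (Poly_Mapping.lookup x p) *\<^sub>R scaleC (fst p) (snd p))"

lemma frag_eval_superset:
  assumes "finite S" "Poly_Mapping.keys x \<subseteq> S"
  shows "frag_eval x = (\<Sum>p\<in>S. of_int (Poly_Mapping.lookup x p) *\<^sub>R scaleC (fst p) (snd p))"
  unfolding frag_eval_def
  by (rule sum.mono_neutral_left [OF assms]) (simp add: in_keys_iff)

lemma frag_eval_diff: "frag_eval (x - y) = frag_eval x - frag_eval y"
proof -
  let ?S = "Poly_Mapping.keys x \<union> Poly_Mapping.keys y"
  have "finite ?S" "Poly_Mapping.keys (x - y) \<subseteq> ?S"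
    by (simp_all add: keys_diff)
  then show ?thesis
    using frag_eval_superset [of ?S x] frag_eval_superset [of ?S y] frag_eval_superset [of ?S "x - y"]
    by (simp add: lookup_minus scaleR_left_diff_distrib sum_subtractf)
qed

lemma frag_eval_0 [simp]: "frag_eval 0 = 0"
  by (simp add: frag_eval_def)

lemma frag_eval_frag_of [simp]: "frag_eval (frag_of (z, w)) = scaleC z w"
  by (simp add: frag_eval_def)

lemma frag_eval_relators: "x \<in> tensor_relators \<Longrightarrow> frag_eval x = 0"
  by (induction rule: tensor_relators.induct)
    (simp_all add: frag_eval_diff scaleC_add_left scaleC_add_right scaleC_scaleC scaleC_complex_def mult.commute)

lift_definition ctensor_eval :: "(complex, 'w::complex_vector) ctensor \<Rightarrow> 'w" is frag_eval
proof -
  fix x y :: "complex \<times> 'w \<Rightarrow>\<^sub>0 int"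
  assume "tensor_equiv x y"
  then have "frag_eval (x - y) = 0"
    unfolding tensor_equiv_def by (rule frag_eval_relators)
  then show "frag_eval x = frag_eval y"
    by (simp add: frag_eval_diff)
qed

lemma ctensor_eval_tensor [simp]: "ctensor_eval (tensor z w) = scaleC z w"
  by transfer simp

lemma tensor_ctensor_eval [simp]: "tensor 1 (ctensor_eval t) = t"
proof (induct t rule: ctensor.abs_induct)
  fix x :: "complex \<times> 'a \<Rightarrow>\<^sub>0 int"
  have "tensor 1 (frag_eval x) = abs_ctensor x"
  proof (induction x rule: frag_pair_induct)
    case zero
    show ?case
      using tensor_diff_right [of 1 0 0] by (simp add: zero_ctensor.abs_eq [symmetric])
  next
    case (one z w)
    show ?case
      using tensor_balanced [of z "1 :: complex" w] by (simp add: scaleC_complex_def tensor.abs_eq [symmetric])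
  next
    case (diff x y)
    then show ?case
      by (simp add: frag_eval_diff tensor_diff_right minus_ctensor.abs_eq [symmetric])
  qed
  then show "tensor 1 (ctensor_eval (abs_ctensor x)) = abs_ctensor x"
    by (simp add: ctensor_eval.abs_eq)
qed

lemma bij_ctensor_eval: "bij ctensor_eval"
  by (rule bij_betwI [where g = "tensor 1"]) (auto simp: scaleC_one)

lemma linear_ctensor_eval: "linear ctensor_eval"
proof (rule linearI)
  fix s t :: "(complex, 'a) ctensor" and r :: real
  have "tensor 1 (ctensor_eval s) + tensor 1 (ctensor_eval t) = tensor 1 (ctensor_eval s + ctensor_eval t)"
    by (simp only: tensor_add_right)
  from arg_cong [OF this, of ctensor_eval] show "ctensor_eval (s + t) = ctensor_eval s + ctensor_eval t"
    by (simp add: scaleC_one)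
  have "scaleC c (tensor 1 w) = tensor c w" for c and w :: 'a
    by transfer (simp add: frag_map2_simps tensor_equiv_def tensor_relators.zero scaleC_complex_def)
  then have "r *\<^sub>R tensor 1 (ctensor_eval s) = tensor (complex_of_real r) (ctensor_eval s)"
    by (simp only: scaleC_of_real [symmetric])
  from arg_cong [OF this, of ctensor_eval] show "ctensor_eval (r *\<^sub>R s) = r *\<^sub>R ctensor_eval s"
    by (simp add: scaleC_of_real)
qed

lemma complex_linear_Phi: "complex_linear (Phi n r g)"
  by (simp add: complex_linear_def Phi_def scaleC_complex_def algebra_simps)

lemma ctensor_eval_rep_ctensor_prod:
  assumes "complex_linear (\<rho> g)"
  shows "ctensor_eval (rep_ctensor_prod (Phi n r) \<rho> g t) = scaleC ((zeta n powi r) powi g) (\<rho> g (ctensor_eval t))"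
proof -
  have "rep_ctensor_prod (Phi n r) \<rho> g (tensor 1 (ctensor_eval t)) = tensor (Phi n r g 1) (\<rho> g (ctensor_eval t))"
    unfolding rep_ctensor_prod_def by (rule ctensor_map_tensor [OF complex_linear_Phi assms])
  from arg_cong [OF this, of ctensor_eval] show ?thesis
    by (simp add: Phi_def)
qed

section \<open>The cell of the projective space\<close>

text \<open>The tensor product enters only through the following data: a space \<open>V\<close> with an action \<open>\<sigma>\<close> and an
  isomorphism \<open>\<mu>\<close> onto \<open>W\<close> that turns \<open>\<sigma>\<close> into \<open>\<rho>\<close> twisted by a character.\<close>

locale twisted_rep =
  fixes n :: nat and k :: int
    and \<rho> :: "int \<Rightarrow> 'w::quaternion_module \<Rightarrow> 'w"
    and \<sigma> :: "int \<Rightarrow> 'v::real_vector \<Rightarrow> 'v"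
    and \<mu> :: "'v \<Rightarrow> 'w"
  assumes n_pos: "n \<ge> 1"
    and rep: "quaternionic_rep n \<rho>"
    and fin_W: "\<exists>B :: 'w set. finite B \<and> span B = UNIV"
    and linear_\<mu>: "linear \<mu>" and bij_\<mu>: "bij \<mu>"
    and \<mu>_\<sigma>: "g \<in> carrier (integer_mod_group n) \<Longrightarrow>
      \<mu> (\<sigma> g v) = scaleC ((zeta n powi (- k)) powi g) (\<rho> g (\<mu> v))"
begin

abbreviation "\<Gamma> \<equiv> integer_mod_group n"

abbreviation "PA \<equiv> PH \<rho>"

abbreviation "PX \<equiv> PH (rep_sum \<rho> (Psi n k))"

lemma repX: "quaternionic_rep n (rep_sum \<rho> (Psi n k))"
  by (rule quaternionic_rep_sum_Psi [OF n_pos rep])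

definition \<nu> :: "'w \<Rightarrow> 'v" where "\<nu> = inv_into UNIV \<mu>"

lemma \<mu>_\<nu> [simp]: "\<mu> (\<nu> w) = w" and \<nu>_\<mu> [simp]: "\<nu> (\<mu> v) = v"
  using bij_\<mu> by (simp_all add: \<nu>_def bij_is_surj surj_f_inv_f bij_is_inj)

lemma linear_\<nu>: "linear \<nu>"
proof (rule linearI)
  have "\<nu> (\<mu> (\<nu> v + \<nu> w)) = \<nu> (v + w)" for v w
    by (simp add: linear_add [OF linear_\<mu>])
  then show "\<nu> (v + w) = \<nu> v + \<nu> w" for v w
    by simp
  have "\<nu> (\<mu> (r *\<^sub>R \<nu> v)) = \<nu> (r *\<^sub>R v)" for r v
    by (simp add: linear_scale [OF linear_\<mu>])
  then show "\<nu> (r *\<^sub>R v) = r *\<^sub>R \<nu> v" for r v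
    by simp
qed

lemma \<mu>_eq_0_iff [simp]: "\<mu> v = 0 \<longleftrightarrow> v = 0"
  by (metis \<nu>_\<mu> linear_0 linear_\<mu>)

lemma \<nu>_eq_0_iff [simp]: "\<nu> w = 0 \<longleftrightarrow> w = 0"
  by (metis \<mu>_\<nu> linear_0 linear_\<nu>)

lemma \<mu>_scaleR [simp]: "\<mu> (r *\<^sub>R v) = r *\<^sub>R \<mu> v"
  by (rule linear_scale [OF linear_\<mu>])

lemma \<sigma>_eq: "g \<in> carrier \<Gamma> \<Longrightarrow> \<sigma> g v = \<nu> (scaleC ((zeta n powi (- k)) powi g) (\<rho> g (\<mu> v)))"
  by (metis \<mu>_\<sigma> \<nu>_\<mu>)

lemma linear_\<sigma>:
  assumes g: "g \<in> carrier \<Gamma>"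
  shows "linear (\<sigma> g)"
proof -
  have "linear (\<nu> \<circ> (scaleH (quat_of_complex ((zeta n powi (- k)) powi g)) \<circ> (\<rho> g \<circ> \<mu>)))"
    by (intro linear_compose linear_\<mu> linear_\<nu> linear_scaleH quat_linear_imp_linear rep_quat_linear [OF rep g])
  moreover have "\<sigma> g = \<dots>"
    by (simp add: fun_eq_iff \<sigma>_eq [OF g] scaleH_of_complex)
  ultimately show ?thesis
    by simp
qed

lemma \<sigma>_0: "\<sigma> 0 v = v"
  by (simp add: \<sigma>_eq rep_one [OF rep] scaleC_one)

lemma \<sigma>_mult:
  assumes g: "g \<in> carrier \<Gamma>" and h: "h \<in> carrier \<Gamma>"
  shows "\<sigma> ((g + h) mod int n) v = \<sigma> g (\<sigma> h v)"
proof -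
  interpret group \<Gamma> by simp
  have gh: "(g + h) mod int n \<in> carrier \<Gamma>"
    using m_closed [OF g h] by simp
  have "\<rho> g (scaleC c x) = scaleC c (\<rho> g x)" for c x
    using quat_linear_imp_complex_linear [OF rep_quat_linear [OF rep g]] by (simp add: complex_linear_def)
  then show ?thesis
    by (simp add: \<sigma>_eq [OF gh] \<sigma>_eq [OF g] \<sigma>_eq [OF h] rep_mult [OF rep g h] character_mod [OF n_pos] scaleC_scaleC)
qed

lemma \<sigma>_scaleR: "g \<in> carrier \<Gamma> \<Longrightarrow> \<sigma> g (r *\<^sub>R v) = r *\<^sub>R \<sigma> g v"
  by (rule linear_scale [OF linear_\<sigma>])

lemma fin_V: "\<exists>B :: 'v set. finite B \<and> span B = UNIV"
proof -
  obtain B :: "'w set" where B: "finite B" "span B = UNIV"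
    using fin_W by blast
  have "span (\<nu> ` B) = \<nu> ` UNIV"
    unfolding B(2) [symmetric] by (rule linear_span_image [OF linear_\<nu>])
  also have "\<dots> = UNIV"
    by (metis \<nu>_\<mu> surjI)
  finally show ?thesis
    using B(1) by blast
qed

lemma ex_invariant_ip: "\<exists>ip. invariant_inner_product \<Gamma> \<sigma> ip"
  by (rule ex_invariant_inner_product [OF _ _ fin_V])
    (use n_pos in \<open>simp_all add: carrier_integer_mod_group linear_\<sigma> [unfolded carrier_integer_mod_group]
      \<sigma>_0 \<sigma>_mult [unfolded carrier_integer_mod_group]\<close>)

end

locale projective_cell = fin_inner_product ip + twisted_rep n k \<rho> \<sigma> \<mu>
  for ip :: "'v::real_vector \<Rightarrow> 'v \<Rightarrow> real" and n k
    and \<rho> :: "int \<Rightarrow> 'w::quaternion_module \<Rightarrow> 'w"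
    and \<sigma> :: "int \<Rightarrow> 'v \<Rightarrow> 'v" and \<mu> :: "'v \<Rightarrow> 'w" +
  assumes ip_invariant: "g \<in> carrier (integer_mod_group n) \<Longrightarrow> ip (\<sigma> g v) (\<sigma> g w) = ip v w"

lemma (in twisted_rep) projective_cell_invariant_ip:
  assumes "invariant_inner_product \<Gamma> \<sigma> ip"
  shows "projective_cell ip n k \<rho> \<sigma> \<mu>"
proof
  show "bilinear ip" "\<And>v w. ip v w = ip w v" "\<And>v. v \<noteq> 0 \<Longrightarrow> 0 < ip v v"
    "\<And>g v w. g \<in> carrier \<Gamma> \<Longrightarrow> ip (\<sigma> g v) (\<sigma> g w) = ip v w"
    using assms by (auto simp: invariant_inner_product_def)
qed (rule fin_V)

context projective_cell
begin

lemma nrm_\<sigma> [simp]: "g \<in> carrier \<Gamma> \<Longrightarrow> nrm (\<sigma> g v) = nrm v"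
  by (simp add: nrm_def ip_invariant)

lemma continuous_map_\<mu>: "continuous_map X vector_topology h \<Longrightarrow> continuous_map X vector_topology (\<lambda>x. \<mu> (h x))"
  by (rule continuous_map_vector_linear [OF linear_\<mu>])

lemma line_\<mu>_\<sigma>:
  assumes g: "g \<in> carrier \<Gamma>" and v: "v \<noteq> 0"
  shows "act PA g (line (\<mu> v)) = line (\<mu> (\<sigma> g v))"
proof -
  have "\<rho> g (\<mu> v) \<noteq> 0"
    using v rep_eq_0_iff [OF rep g] by simp
  then show ?thesis
    using act_PH_line [OF rep g, of "\<mu> v"] v by (simp add: \<mu>_\<sigma> [OF g] scaleH_of_complex [symmetric])
qed

text \<open>The second coordinate is cut off at 0 so that the map is continuous on all of \<open>V\<close>; outside the unit
  disk its class is just the line through \<open>\<mu> v\<close>.\<close>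

definition cell_vec :: "'v \<Rightarrow> 'w \<times> quat" where
  "cell_vec v = (\<mu> v, max 0 (1 - nrm v) *\<^sub>R 1)"

definition cell :: "'v \<Rightarrow> ('w \<times> quat) set" where
  "cell v = line (cell_vec v)"

lemma cell_vec_nonzero: "cell_vec v \<noteq> 0"
  by (cases "v = 0") (simp_all add: cell_vec_def zero_prod_def)

lemma continuous_map_cell:
  assumes "continuous_map X vector_topology h"
  shows "continuous_map X (spc PX) (\<lambda>x. cell (h x))"
  unfolding cell_def cell_vec_def
  by (intro continuous_map_line continuous_map_vector_Pair continuous_map_\<mu> assms
      continuous_map_vector_scaleR continuous_map_vector_const continuous_map_real_max
      continuous_map_diff continuous_map_nrm cell_vec_nonzero [unfolded cell_vec_def]) simp_all

lemma cell_in_PX [simp]: "cell v \<in> topspace (spc PX)"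
  by (simp add: cell_def cell_vec_nonzero)

text \<open>On \<open>cell_vec v\<close> the group acts by \<open>\<rho>\<close> and by the character \<open>\<zeta>\<^sup>k\<close> on the two coordinates. Scaling by the
  inverse character makes the second coordinate real again and turns \<open>\<rho>\<close> into \<open>\<sigma>\<close>.\<close>

lemma act_cell:
  assumes g: "g \<in> carrier \<Gamma>"
  shows "act PX g (cell v) = cell (\<sigma> g v)"
proof -
  let ?z = "(zeta n powi k) powi g" and ?z' = "(zeta n powi (- k)) powi g" and ?r = "max 0 (1 - nrm v)"
  have z: "?z' * ?z = 1" "?z' \<noteq> 0"
    by (simp_all add: power_int_minus field_simps)
  have "act PX g (cell v) = line (rep_sum \<rho> (Psi n k) g (cell_vec v))"
    unfolding cell_def by (rule act_PH_line [OF repX g cell_vec_nonzero])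
  also have "\<dots> = line (scaleH (quat_of_complex ?z') (rep_sum \<rho> (Psi n k) g (cell_vec v)))"
    using z(2) rep_eq_0_iff [OF repX g] cell_vec_nonzero by (intro line_scaleH [symmetric]) auto
  also have "scaleH (quat_of_complex ?z') (rep_sum \<rho> (Psi n k) g (cell_vec v)) =
      (\<mu> (\<sigma> g v), ?r *\<^sub>R (quat_of_complex ?z' * quat_of_complex ?z))"
    by (simp add: rep_sum_def cell_vec_def scaleH_prod_def \<mu>_\<sigma> [OF g] Psi_def scaleH_of_complex scaleH_quat_def)
  also have "\<dots> = cell_vec (\<sigma> g v)"
    using z(1) g by (simp add: cell_vec_def quat_of_complex_mult [symmetric])
  finally show ?thesis
    by (simp add: cell_def)
qed

lemma cell_boundary:
  assumes "1 \<le> nrm v"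
  shows "cell v = PH_incl (line (\<mu> v))"
proof -
  have "v \<noteq> 0"
    using assms by auto
  then show ?thesis
    using assms by (simp add: cell_def cell_vec_def PH_incl_class)
qed

text \<open>A scalar relating two such representatives with nonzero real second coordinates is itself a
  nonnegative real \<open>c\<close>; then \<open>1 - c |v| = c (1 - |v|)\<close> forces \<open>c = 1\<close>.\<close>

lemma cell_eq:
  assumes "nrm v \<le> 1" "nrm v' \<le> 1" "cell v = cell v'"
  shows "v = v' \<or> (nrm v = 1 \<and> nrm v' = 1 \<and> line (\<mu> v) = line (\<mu> v'))"
proof -
  define r r' where "r = 1 - nrm v" and "r' = 1 - nrm v'"
  have r: "0 \<le> r" "0 \<le> r'" and vec: "cell_vec v = (\<mu> v, r *\<^sub>R 1)" "cell_vec v' = (\<mu> v', r' *\<^sub>R 1)"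
    using assms by (simp_all add: r_def r'_def cell_vec_def)
  obtain p where p: "p \<noteq> 0" "cell_vec v' = scaleH p (cell_vec v)"
    using assms(3) line_eq_iff [OF cell_vec_nonzero cell_vec_nonzero] by (auto simp: cell_def)
  then have eq: "\<mu> v' = scaleH p (\<mu> v)" "r' *\<^sub>R 1 = r *\<^sub>R p"
    by (simp_all add: vec scaleH_prod_def scaleH_quat_def)
  show ?thesis
  proof (cases "r = 0")
    case True
    then have "r' = 0"
      using eq(2) by simp
    with True have nrm: "nrm v = 1" "nrm v' = 1"
      by (simp_all add: r_def r'_def)
    then have "v \<noteq> 0"
      by auto
    then show ?thesis
      using nrm eq(1) p(1) by simp
  next
    case False
    define c where "c = r' / r"
    have "c *\<^sub>R 1 = (1 / r) *\<^sub>R (r *\<^sub>R p)"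
      unfolding eq(2) [symmetric] by (simp add: c_def)
    then have cone_class: "p = c *\<^sub>R 1"
      using False by simp
    have c: "0 \<le> c" "r' = c * r"
      using r False by (simp_all add: c_def)
    have "\<mu> v' = \<mu> (c *\<^sub>R v)"
      using eq(1) by (simp add: cone_class)
    then have v': "v' = c *\<^sub>R v"
      by (metis \<nu>_\<mu>)
    then have "1 - c * nrm v = c * (1 - nrm v)"
      using c by (simp add: r_def r'_def)
    then have "c = 1"
      by (simp add: algebra_simps)
    then show ?thesis
      using v' by simp
  qed
qed

abbreviation disk :: "'v topology" where
  "disk \<equiv> subtopology vector_topology {v. nrm v \<le> 1}"

lemma compact_space_disk: "compact_space disk"
  using compactin_ball [of 1] by (simp add: compact_space_subtopology)

text \<open>Every point of the projective space has a representative \<open>(w, q)\<close> with \<open>q \<ge> 0\<close>, unique up to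
  scaling by a positive number when \<open>q \<noteq> 0\<close>, and normalizing it gives a point of the disk. For
  \<open>q = 0\<close> the unit quaternion \<open>u\<close> that rotates \<open>q\<close> into a nonnegative real is not determined, so it
  is kept as a parameter; it ranges over a compact space, hence forgetting it is a closed map.\<close>

lemma quotient_map_cell: "quotient_map disk (spc PX) cell"
proof -
  let ?U = "punctured :: ('w \<times> quat) topology"
  let ?S = "subtopology vector_topology {u. quat.nrm u = 1}"
  \<comment> \<open>Pairs of a nonzero vector \<open>(w, q)\<close> and a polar part \<open>u\<close> of \<open>q\<close>, which is arbitrary when \<open>q = 0\<close>.\<close>
  define Z where "Z = {x \<in> topspace (prod_topology ?U ?S). snd (fst x) = quat.nrm (snd (fst x)) *\<^sub>R snd x}"
  let ?Z = "subtopology (prod_topology ?U ?S) Z"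
  have fst_U: "continuous_map (prod_topology ?U ?S) vector_topology fst"
    using continuous_map_fst [of ?U ?S] by (simp add: continuous_map_in_subtopology)
  have snd_S: "continuous_map (prod_topology ?U ?S) vector_topology snd"
    using continuous_map_snd [of ?U ?S] by (simp add: continuous_map_in_subtopology)
  have q: "continuous_map (prod_topology ?U ?S) vector_topology (\<lambda>x. snd (fst x))"
    and w: "continuous_map (prod_topology ?U ?S) vector_topology (\<lambda>x. fst (fst x))"
    by (intro continuous_map_vector_linear [OF linear_snd] continuous_map_vector_linear [OF linear_fst] fst_U)+
  have closedZ: "closedin (prod_topology ?U ?S) Z"
    unfolding Z_def
    by (intro closedin_continuous_maps_eq [OF quat.Hausdorff_space_vector] q continuous_map_vector_scaleR
        quat.continuous_map_nrm snd_S)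
  have compactS: "compact_space ?S"
  proof -
    have "closedin vector_topology {u. quat.nrm u = 1}"
      using closedin_continuous_map_preimage [OF quat.continuous_map_nrm [OF continuous_map_id [unfolded id_def]], of "{1}"]
      by simp
    then have "compactin vector_topology {u. quat.nrm u = 1}"
      by (rule closed_compactin [OF quat.compactin_ball [of 1] _, rotated]) auto
    then show ?thesis
      by (simp add: compact_space_subtopology)
  qed
  have "quotient_map ?Z ?U fst"
  proof (rule continuous_closed_imp_quotient_map)
    show "continuous_map ?Z ?U fst"
      by (intro continuous_map_from_subtopology continuous_map_fst)
    show "closed_map ?Z ?U fst"
      using closed_map_fst [OF compactS, of ?U] closedZ closedin_trans_full
      unfolding closed_map_def by blast
    have "z \<in> fst ` Z" if z: "z \<noteq> 0" for z :: "'w \<times> quat"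
    proof -
      let ?q = "snd z"
      define u where "u = (if ?q = 0 then 1 else (1 / quat.nrm ?q) *\<^sub>R ?q)"
      have "quat.nrm (1 :: quat) = 1"
        by (simp add: quat.nrm_def quat_inner_def one_quat_def)
      then have "quat.nrm u = 1" "?q = quat.nrm ?q *\<^sub>R u"
        by (simp_all add: u_def)
      then have "(z, u) \<in> Z"
        using z by (simp add: Z_def)
      then show ?thesis
        by force
    qed
    then show "fst ` topspace ?Z = topspace ?U"
      by (auto simp: Z_def)
  qed
  then have "quotient_map ?Z (spc PX) (line \<circ> fst)"
    by (rule quotient_map_compose [OF _ quotient_map_line])
  moreover
  \<comment> \<open>For \<open>y = ((w, q), u)\<close> in \<open>Z\<close>, multiplying \<open>(w, q)\<close> by the conjugate of \<open>u\<close> makes the second coordinate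
    the real number \<open>|q|\<close>; dividing by \<open>d\<close> then makes the two norms add up to 1, as in the cell.\<close>
  define x where "x y = \<nu> (scaleH (qconj (snd y)) (fst (fst y)))" for y :: "('w \<times> quat) \<times> quat"
  define d where "d y = quat.nrm (snd (fst y)) + nrm (x y)" for y
  define T where "T y = (1 / d y) *\<^sub>R x y" for y
  have Zq: "d y > 0" "T y \<in> {v. nrm v \<le> 1}" "cell (T y) = line (fst y)" if y: "y \<in> topspace ?Z" for y
  proof -
    obtain w q u where wqu: "y = ((w, q), u)"
      by (metis prod.collapse)
    have u: "quat.nrm u = 1" "q = quat.nrm q *\<^sub>R u" and wq: "(w, q) \<noteq> 0"
      using y by (auto simp: Z_def wqu)
    have cu: "qconj u \<noteq> 0"
      using qconj_mult_unit [OF u(1)] by auto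
    then have "x y \<noteq> 0" if "q = 0"
      using wq that by (simp add: x_def wqu zero_prod_def)
    then show d: "d y > 0"
      by (cases "q = 0") (simp_all add: d_def wqu add_pos_nonneg)
    have nT: "nrm (T y) = nrm (x y) / d y"
      using d by (simp add: T_def)
    then have r: "1 - nrm (T y) = quat.nrm q / d y"
      using d by (simp add: d_def wqu field_simps)
    then have "0 \<le> 1 - nrm (T y)"
      using d by simp
    then show "T y \<in> {v. nrm v \<le> 1}"
      by simp
    have "qconj u * q = quat.nrm q *\<^sub>R 1"
      by (subst u(2)) (simp add: qconj_mult_unit [OF u(1)])
    then have "cell_vec (T y) = scaleH ((1 / d y) *\<^sub>R qconj u) (w, q)"
      using \<open>0 \<le> 1 - nrm (T y)\<close> r
      by (simp add: cell_vec_def scaleH_prod_def scaleH_quat_def T_def x_def wqu scaleH_scaleR_left)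
    then show "cell (T y) = line (fst y)"
      using cu d wq by (simp add: cell_def wqu)
  qed
  then have "quotient_map ?Z (spc PX) (cell \<circ> T) \<longleftrightarrow> quotient_map ?Z (spc PX) (line \<circ> fst)"
    by (intro iffI; elim quotient_map_eq) simp_all
  ultimately have "quotient_map ?Z (spc PX) (cell \<circ> T)"
    by blast
  moreover have "continuous_map ?Z disk T"
  proof (intro continuous_map_into_subtopology Pi_I Zq(2))
    have x: "continuous_map ?Z vector_topology x"
      unfolding x_def
      by (intro continuous_map_vector_linear [OF linear_\<nu>] continuous_map_scaleH
          continuous_map_vector_linear [OF linear_qconj] continuous_map_from_subtopology w snd_S)
    have "continuous_map ?Z euclideanreal d"
      unfolding d_def
      by (intro continuous_map_add continuous_map_nrm quat.continuous_map_nrm x continuous_map_from_subtopology q)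
    then show "continuous_map ?Z vector_topology T"
      unfolding T_def using Zq(1)
      by (intro continuous_map_vector_scaleR continuous_map_real_divide x) (auto simp: less_imp_neq [symmetric])
  qed
  moreover have "continuous_map disk (spc PX) cell"
    by (intro continuous_map_cell continuous_map_from_subtopology continuous_map_id [unfolded id_def])
  ultimately show ?thesis
    using quotient_map_from_composition by blast
qed

end

section \<open>Attaching the cell\<close>

context projective_cell
begin

lemma continuous_map_PH_incl: "continuous_map (spc PA) (spc PX) PH_incl"
proof (rule continuous_compose_quotient_map [OF quotient_map_line])
  have "continuous_map punctured (spc PX) (\<lambda>w. line (w, 0 :: quat))"
    by (intro continuous_map_line continuous_map_vector_Pair continuous_map_vector_const
        continuous_map_from_subtopology continuous_map_id [unfolded id_def]) (auto simp: zero_prod_def)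
  then show "continuous_map punctured (spc PX) (PH_incl \<circ> line)"
    by (rule continuous_map_eq) (simp add: PH_incl_class)
qed

text \<open>The subspace is swept out by the boundary of the disk; this reduces statements about it to
  statements about the cell.\<close>

lemma PA_eq_boundary_line:
  assumes "a \<in> topspace (spc PA)"
  shows "\<exists>v. nrm v = 1 \<and> a = line (\<mu> v)"
proof -
  obtain w where w: "w \<noteq> 0" "a = line w"
    using assms by (auto simp: topspace_PH)
  let ?v = "(1 / nrm (\<nu> w)) *\<^sub>R \<nu> w"
  have "nrm ?v = 1" "line (\<mu> ?v) = line w"
    using w(1) line_scaleR [of "1 / nrm (\<nu> w)" w] by simp_all
  then show ?thesis
    using w(2) by blast
qed

lemma line_\<mu>_in_PA: "nrm v = 1 \<Longrightarrow> line (\<mu> v) \<in> topspace (spc PA)"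
  by (metis \<mu>_eq_0_iff line_in_topspace_PH nrm_0 zero_neq_one)

lemma PH_incl_equivariant:
  assumes "g \<in> carrier \<Gamma>" "a \<in> topspace (spc PA)"
  shows "PH_incl (act PA g a) = act PX g (PH_incl a)"
proof -
  obtain v where v: "nrm v = 1" "a = line (\<mu> v)"
    using PA_eq_boundary_line [OF assms(2)] by blast
  then have "v \<noteq> 0"
    by auto
  then have "PH_incl (act PA g a) = cell (\<sigma> g v)"
    using v assms(1) by (simp add: line_\<mu>_\<sigma> cell_boundary)
  also have "\<dots> = act PX g (cell v)"
    by (rule act_cell [OF assms(1), symmetric])
  finally show ?thesis
    using v by (simp add: cell_boundary)
qed

lemma spc_unit_disk: "spc (unit_disk ip \<sigma>) = disk" and act_unit_disk: "act (unit_disk ip \<sigma>) = \<sigma>"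
  by (simp_all add: unit_disk_def ip_le_1_iff)

lemma spc_unit_sphere: "spc (unit_sphere ip \<sigma>) = subtopology vector_topology {v. nrm v = 1}"
  by (simp add: unit_sphere_def ip_eq_1_iff)

lemma continuous_map_disk_\<sigma>: "g \<in> carrier \<Gamma> \<Longrightarrow> continuous_map disk disk (\<sigma> g)"
  by (intro continuous_map_into_subtopology continuous_map_from_subtopology
      continuous_map_vector_linear [OF linear_\<sigma> continuous_map_id [unfolded id_def]]) auto

lemma is_gspace_disk: "is_gspace \<Gamma> (unit_disk ip \<sigma>)"
  by (rule is_gspaceI) (simp_all add: spc_unit_disk act_unit_disk continuous_map_disk_\<sigma> \<sigma>_0 \<sigma>_mult)

text \<open>The inclusion and the cell together form a quotient map from the disjoint union, since the cell
  alone already is one. Its fibres are the classes of the gluing relation: every point of \<open>P(W)\<close> is glued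
  to a boundary point of the disk, so it suffices to compare points of the disk, where \<open>cell_eq\<close> applies.\<close>

lemma projective_space_obtained_by_attaching:
  "obtained_by_attaching \<Gamma> PA PX PH_incl (unit_disk ip \<sigma>) (unit_sphere ip \<sigma>)"
proof -
  let ?D = "unit_disk ip \<sigma>" and ?S = "unit_sphere ip \<sigma>"
  define \<phi> where "\<phi> v = line (\<mu> v)" for v
  let ?U = "disjoint_union_gspace PA ?D"
  define r where "r = attach_equiv PA ?D ?S \<phi>"
  let ?T = "topspace (spc ?U)"
  let ?p = "\<lambda>y. r `` {y}"
  have attach: "attach PA ?D ?S \<phi> = quotient_gspace ?U r"
    by (simp add: attach_def r_def)
  have spcU: "spc ?U = disjoint_union_topology (spc PA) disk"
    by (simp add: disjoint_union_gspace_def spc_unit_disk)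
  have T: "?T = Inl ` topspace (spc PA) \<union> Inr ` {v. nrm v \<le> 1}"
    by (simp add: spcU)
  have equiv: "equiv ?T r"
    unfolding r_def attach_equiv_def by (rule equiv_generated_equiv)
  have glue: "(Inr s, Inl (\<phi> s)) \<in> r" if "nrm s = 1" for s
    unfolding r_def attach_equiv_def
    by (rule generated_equiv_generator)
      (use that line_\<mu>_in_PA [OF that] in \<open>auto simp: T spc_unit_sphere \<phi>_def\<close>)
  have gS: "gmap \<Gamma> ?S PA \<phi>"
    unfolding gmap_def spc_unit_sphere
  proof (intro conjI ballI)
    show "continuous_map (subtopology vector_topology {v. nrm v = 1}) (spc PA) \<phi>"
      unfolding \<phi>_def
      by (intro continuous_map_line continuous_map_\<mu> continuous_map_from_subtopology continuous_map_id [unfolded id_def]) auto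
    fix g v assume "g \<in> carrier \<Gamma>" "v \<in> topspace (subtopology vector_topology {v. nrm v = 1})"
    then show "\<phi> (act ?S g v) = act PA g (\<phi> v)"
      using line_\<mu>_\<sigma> [of g v] by (force simp: unit_sphere_def \<phi>_def)
  qed
  have invariant: "(act ?U g x, act ?U g y) \<in> r" if g: "g \<in> carrier \<Gamma>" and xy: "(x, y) \<in> r" for g x y
    using xy unfolding r_def attach_equiv_def
  proof (rule generated_equiv_map)
    show "act ?U g a \<in> ?T" if "a \<in> ?T" for a
      by (rule is_gspace_closed [OF is_gspace_disjoint_union [OF _ is_gspace_PH [OF rep] is_gspace_disk] g that]) simp
    fix a b :: "'w set + 'v"
    assume "(a, b) \<in> {(Inr s, Inl (\<phi> s)) |s. s \<in> topspace (spc ?S)}"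
    then obtain s where s: "nrm s = 1" "a = Inr s" "b = Inl (\<phi> s)"
      by (auto simp: spc_unit_sphere)
    have "s \<noteq> 0"
      using s(1) by auto
    then have "act ?U g b = Inl (\<phi> (\<sigma> g s))"
      using line_\<mu>_\<sigma> [OF g, of s] s(3) by (simp add: disjoint_union_gspace_def \<phi>_def)
    then show "(act ?U g a, act ?U g b) \<in> {(Inr s, Inl (\<phi> s)) |s. s \<in> topspace (spc ?S)}"
      using s g by (auto simp: disjoint_union_gspace_def spc_unit_sphere act_unit_disk)
  qed
  have act_class: "act (attach PA ?D ?S \<phi>) g (?p y) = ?p (act ?U g y)" if "g \<in> carrier \<Gamma>" "y \<in> ?T" for g y
    unfolding attach
    by (rule quotient_gspace_act_class [OF _ is_gspace_disjoint_union [OF _ is_gspace_PH [OF rep] is_gspace_disk]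
          equiv invariant that]) simp_all
  have quot_p: "quotient_map (spc ?U) (spc (attach PA ?D ?S \<phi>)) ?p"
    unfolding attach quotient_gspace_def by (simp add: quotient_map_quotient_topology)
  define h where "h = case_sum PH_incl cell"
  have h [simp]: "h (Inl a) = PH_incl a" "h (Inr v) = cell v" for a v
    by (simp_all add: h_def)
  have cont_h: "continuous_map (spc ?U) (spc PX) h"
    unfolding spcU
    by (rule continuous_map_disjoint_union)
      (simp_all add: continuous_map_PH_incl quotient_imp_continuous_map [OF quotient_map_cell])
  have quot_h: "quotient_map (spc ?U) (spc PX) h"
    unfolding spcU
  proof (rule quotient_map_from_composition [OF continuous_map_Inr cont_h [unfolded spcU]])
    show "quotient_map disk (spc PX) (h \<circ> Inr)"
      using quotient_map_cell by (simp add: comp_def)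
  qed
  have h_const: "h x = h y" if "(x, y) \<in> r" for x y
    using that unfolding r_def attach_equiv_def
    by (rule generated_equiv_invariant) (auto simp: spc_unit_sphere \<phi>_def cell_boundary)
  have h_inj: "?p x = ?p y" if xy: "x \<in> ?T" "y \<in> ?T" "h x = h y" for x y
  proof -
    \<comment> \<open>Both points may be moved into the disk within their gluing classes.\<close>
    have repr: "\<exists>v. nrm v \<le> 1 \<and> ?p z = ?p (Inr v) \<and> h z = cell v" if "z \<in> ?T" for z
    proof (cases z)
      case (Inl a)
      then have "a \<in> topspace (spc PA)"
        using that T by auto
      then obtain v where v: "nrm v = 1" "a = line (\<mu> v)"
        using PA_eq_boundary_line by blast
      have "?p z = ?p (Inr v)"
        using equiv_class_eq [OF equiv glue [OF v(1)]] v by (simp add: Inl \<phi>_def)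
      then show ?thesis
        using v cell_boundary [of v] Inl by (intro exI [of _ v]) simp
    qed (use that T in auto)
    obtain v v' where v: "nrm v \<le> 1" "?p x = ?p (Inr v)" "h x = cell v"
      and v': "nrm v' \<le> 1" "?p y = ?p (Inr v')" "h y = cell v'"
      using repr [OF xy(1)] repr [OF xy(2)] by blast
    from cell_eq [OF v(1) v'(1)] xy(3) v(3) v'(3)
    consider "v = v'" | "nrm v = 1" "nrm v' = 1" "\<phi> v = \<phi> v'"
      unfolding \<phi>_def by auto
    then show ?thesis
    proof cases
      case 2
      then have "?p (Inr v) = ?p (Inr v')"
        using equiv_class_eq [OF equiv glue [OF 2(1)]] equiv_class_eq [OF equiv glue [OF 2(2)]] by simp
      then show ?thesis
        using v v' by simp
    qed (use v v' in simp)
  qed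
  obtain \<theta> where \<theta>: "continuous_map (spc (attach PA ?D ?S \<phi>)) (spc PX) \<theta>"
    "\<And>y. y \<in> ?T \<Longrightarrow> \<theta> (?p y) = h y"
    using quotient_map_lift_exists [OF quot_p cont_h] h_const eq_equiv_class_iff [OF equiv] by metis
  have points: "\<exists>y\<in>?T. c = ?p y" if "c \<in> topspace (spc (attach PA ?D ?S \<phi>))" for c
    using quot_p that unfolding quotient_map_def by blast
  have "quotient_map (spc (attach PA ?D ?S \<phi>)) (spc PX) \<theta>"
    by (rule quotient_map_from_composition [OF quotient_imp_continuous_map [OF quot_p] \<theta>(1)])
      (rule quotient_map_eq [OF quot_h], simp add: \<theta>(2))
  moreover have "inj_on \<theta> (topspace (spc (attach PA ?D ?S \<phi>)))"
    by (rule inj_onI) (metis points h_inj \<theta>(2))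
  ultimately have homeo: "homeomorphic_map (spc (attach PA ?D ?S \<phi>)) (spc PX) \<theta>"
    by (simp add: homeomorphic_map_def)
  have "\<theta> (act (attach PA ?D ?S \<phi>) g c) = act PX g (\<theta> c)"
    if g: "g \<in> carrier \<Gamma>" and c: "c \<in> topspace (spc (attach PA ?D ?S \<phi>))" for g c
  proof -
    obtain y where y: "y \<in> ?T" "c = ?p y"
      using points [OF c] by blast
    have "h (act ?U g y) = act PX g (h y)"
      using y(1) PH_incl_equivariant [OF g] act_cell [OF g]
      by (auto simp: T disjoint_union_gspace_def act_unit_disk)
    moreover have "act ?U g y \<in> ?T"
      by (rule is_gspace_closed [OF is_gspace_disjoint_union [OF _ is_gspace_PH [OF rep] is_gspace_disk] g y(1)]) simp
    ultimately show ?thesis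
      by (simp add: y act_class [OF g] \<theta>(2))
  qed
  then have "ghomeomorphism \<Gamma> (attach PA ?D ?S \<phi>) PX \<theta>"
    unfolding ghomeomorphism_def gmap_def using homeo \<theta>(1) by blast
  moreover have "\<theta> (attach_equiv PA ?D ?S \<phi> `` {Inl a}) = PH_incl a" if "a \<in> topspace (spc PA)" for a
    using \<theta>(2) [of "Inl a"] that T unfolding r_def by auto
  ultimately show ?thesis
    unfolding obtained_by_attaching_def using gS by blast
qed

end

section \<open>Based equivariant homotopies\<close>

lemma based_gmap_cong:
  assumes X: "is_based_gspace G X" and eq: "\<And>x. x \<in> topspace (spc X) \<Longrightarrow> h x = k x"
  shows "based_gmap G X Y h \<longleftrightarrow> based_gmap G X Y k"
proof -
  have closed: "act X g x \<in> topspace (spc X)" if "g \<in> carrier G" "x \<in> topspace (spc X)" for g x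
    using X is_gspace_closed [OF _ that] by (simp add: is_based_gspace_def)
  have base: "base X \<in> topspace (spc X)"
    using X by (simp add: is_based_gspace_def)
  have "continuous_map (spc X) (spc Y) h \<longleftrightarrow> continuous_map (spc X) (spc Y) k"
    using eq continuous_map_eq by metis
  then show ?thesis
    unfolding based_gmap_def gmap_def using eq closed base by auto
qed

lemma based_ghomotopicI:
  fixes h :: "real \<times> 'a \<Rightarrow> 'b"
  assumes X: "is_based_gspace G X"
    and cont: "continuous_map (prod_topology (top_of_set {0..1}) (spc X)) (spc Y) h"
    and ends: "\<And>x. x \<in> topspace (spc X) \<Longrightarrow> h (0, x) = f x" "\<And>x. x \<in> topspace (spc X) \<Longrightarrow> h (1, x) = g x"
    and equivariant: "\<And>t a x. t \<in> {0..1} \<Longrightarrow> a \<in> carrier G \<Longrightarrow> x \<in> topspace (spc X) \<Longrightarrow>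
      h (t, act X a x) = act Y a (h (t, x))"
    and based: "\<And>t. t \<in> {0..1} \<Longrightarrow> h (t, base X) = base Y"
  shows "based_ghomotopic G X Y f g"
  unfolding based_ghomotopic_def
proof (subst homotopic_with)
  show "\<exists>h :: real \<times> 'a \<Rightarrow> 'b. continuous_map (prod_topology (top_of_set {0..1}) (spc X)) (spc Y) h \<and>
      (\<forall>x\<in>topspace (spc X). h (0, x) = f x) \<and> (\<forall>x\<in>topspace (spc X). h (1, x) = g x) \<and>
      (\<forall>t\<in>{0..1}. based_gmap G X Y (\<lambda>x. h (t, x)))"
  proof (intro exI [of _ h] conjI ballI)
    fix t :: real assume t: "t \<in> {0..1}"
    have "continuous_map (spc X) (prod_topology (top_of_set {0..1::real}) (spc X)) (\<lambda>x. (t, x))"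
      using t by (simp add: continuous_map_pairwise comp_def)
    from continuous_map_compose [OF this cont] have "continuous_map (spc X) (spc Y) (\<lambda>x. h (t, x))"
      by (simp add: comp_def)
    then show "based_gmap G X Y (\<lambda>x. h (t, x))"
      using t equivariant based by (simp add: based_gmap_def gmap_def)
  qed (use cont ends in auto)
qed (use based_gmap_cong [OF X] in metis)

lemma quotient_map_interval_prod:
  "quotient_map X Y f \<Longrightarrow>
    quotient_map (prod_topology (top_of_set {0..1::real}) X) (prod_topology (top_of_set {0..1}) Y) (\<lambda>(t, x). (t, f x))"
  by (intro quotient_map_prod_right disjI1 compact_imp_locally_compact_space Hausdorff_space_subtopology)
    (simp_all add: compact_space_subtopology)

lemma ex_continuous_quotient_lift:
  assumes "quotient_map X Y f" "continuous_map X Z h"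
    and "\<And>x y. x \<in> topspace X \<Longrightarrow> y \<in> topspace X \<Longrightarrow> f x = f y \<Longrightarrow> h x = h y"
  shows "\<exists>g. continuous_map Y Z g \<and> (\<forall>x\<in>topspace X. g (f x) = h x)"
  by (rule quotient_map_lift_exists [OF assms(1,2)]) (use assms(3) in blast)+

text \<open>Homotopies descend along quotient maps, because the unit interval is locally compact.\<close>

lemma ex_homotopy_lift:
  fixes h :: "real \<times> 'a \<Rightarrow> 'c"
  assumes f: "quotient_map X Y f"
    and h: "continuous_map (prod_topology (top_of_set {0..1}) X) Z h"
    and const: "\<And>t x y. t \<in> {0..1} \<Longrightarrow> x \<in> topspace X \<Longrightarrow> y \<in> topspace X \<Longrightarrow> f x = f y \<Longrightarrow> h (t, x) = h (t, y)"
  shows "\<exists>k. continuous_map (prod_topology (top_of_set {0..1}) Y) Z k \<and>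
    (\<forall>t\<in>{0..1 :: real}. \<forall>x\<in>topspace X. k (t, f x) = h (t, x))"
proof -
  have "h p = h q"
    if "p \<in> topspace (prod_topology (top_of_set {0..1}) X)" "q \<in> topspace (prod_topology (top_of_set {0..1}) X)"
      "(\<lambda>(t, x). (t, f x)) p = (\<lambda>(t, x). (t, f x)) q" for p q
    using that const [of "fst p" "snd p" "snd q"] by (simp add: split_def mem_Times_iff prod_eq_iff)
      (metis prod.collapse)
  then have "\<exists>k. continuous_map (prod_topology (top_of_set {0..1}) Y) Z k \<and>
      (\<forall>p\<in>topspace (prod_topology (top_of_set {0..1}) X). k ((\<lambda>(t, x). (t, f x)) p) = h p)"
    by (rule ex_continuous_quotient_lift [OF quotient_map_interval_prod [OF f] h])
  then show ?thesis
    by (rule ex_forward) auto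
qed

section \<open>The representation sphere as a quotient of the disk\<close>

context projective_cell
begin

abbreviation "sph \<equiv> rep_sphere \<sigma>"

definition wrap :: "'v \<Rightarrow> 'v option" where
  "wrap v = (if nrm v < 1 then Some ((1 / (1 - nrm v)) *\<^sub>R v) else None)"

lemma wrap_eq_None [simp]: "wrap v = None \<longleftrightarrow> 1 \<le> nrm v"
  by (simp add: wrap_def)

text \<open>The inverse of \<open>v \<mapsto> v / (1 - |v|)\<close> is \<open>x \<mapsto> x / (1 + |x|)\<close>.\<close>

lemma wrap_eq_Some:
  "wrap v = Some x \<longleftrightarrow> v = (1 / (1 + nrm x)) *\<^sub>R x"
proof
  assume "wrap v = Some x"
  then have v: "nrm v < 1" "x = (1 / (1 - nrm v)) *\<^sub>R v"
    by (auto simp: wrap_def split: if_splits)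
  then have "1 + nrm x = 1 / (1 - nrm v)"
    by (simp add: field_simps)
  then show "v = (1 / (1 + nrm x)) *\<^sub>R x"
    using v by simp
next
  assume v: "v = (1 / (1 + nrm x)) *\<^sub>R x"
  have "0 < 1 + nrm x"
    by (simp add: add_pos_nonneg)
  moreover have "nrm v = nrm x / (1 + nrm x)"
    using v by simp
  ultimately have "1 - nrm v = 1 / (1 + nrm x)"
    by (simp add: field_simps)
  moreover have "nrm v < 1"
    unfolding \<open>nrm v = nrm x / (1 + nrm x)\<close> using \<open>0 < 1 + nrm x\<close> by (simp add: pos_divide_less_eq)
  ultimately show "wrap v = Some x"
    using v \<open>0 < 1 + nrm x\<close> by (simp add: wrap_def)
qed

lemma wrap_\<sigma>: "g \<in> carrier \<Gamma> \<Longrightarrow> wrap (\<sigma> g v) = map_option (\<sigma> g) (wrap v)"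
  by (simp add: wrap_def \<sigma>_scaleR)

lemma topspace_sph [simp]: "topspace (spc sph) = UNIV"
  by (auto simp: rep_sphere_def UNIV_option_conv)

text \<open>Near infinity continuity holds because the preimage of a compact set \<open>C\<close> is its image under the
  inverse map, hence compact and closed.\<close>

lemma continuous_map_wrap: "continuous_map vector_topology (spc sph) wrap"
proof -
  have id: "continuous_map vector_topology vector_topology (\<lambda>v :: 'v. v)"
    by simp
  have nrm: "continuous_map vector_topology euclideanreal nrm"
    by (rule continuous_map_nrm [OF id])
  have ball: "openin vector_topology {v. nrm v < 1}"
    using openin_continuous_map_preimage [OF nrm, of "{..<1}"] by simp
  have "openin vector_topology {v \<in> topspace vector_topology. wrap v \<in> U}"
    if U: "openin (Alexandroff_compactification vector_topology) U" for U
    using U unfolding openin_Alexandroff_compactification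
  proof (elim disjE exE conjE)
    fix V assume V: "openin vector_topology V" "U = Some ` V"
    let ?g = "\<lambda>v. (1 / (1 - nrm v)) *\<^sub>R v"
    have "continuous_map (subtopology vector_topology {v. nrm v < 1}) vector_topology ?g"
      by (intro continuous_map_vector_scaleR continuous_map_real_divide continuous_map_diff
          continuous_map_from_subtopology nrm id) auto
    from openin_continuous_map_preimage [OF this V(1)]
    have "openin vector_topology {v. nrm v < 1 \<and> ?g v \<in> V}"
      using ball openin_trans_full by simp
    moreover have "{v. nrm v < 1 \<and> ?g v \<in> V} = {v \<in> topspace vector_topology. wrap v \<in> U}"
      by (auto simp: V(2) wrap_def)
    ultimately show ?thesis
      by simp
  next
    fix C assume C: "compactin vector_topology C" "closedin vector_topology C"
      "U = insert None (Some ` (topspace vector_topology - C))"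
    let ?f = "\<lambda>x. (1 / (1 + nrm x)) *\<^sub>R x"
    have "1 + nrm x \<noteq> 0" for x
      using nrm_nonneg [of x] by linarith
    then have "continuous_map vector_topology vector_topology ?f"
      by (intro continuous_map_vector_scaleR continuous_map_real_divide continuous_map_add nrm id) auto
    then have "closedin vector_topology (?f ` C)"
      using image_compactin [OF C(1)] compactin_imp_closedin [OF Hausdorff_space_vector] by blast
    then have "openin vector_topology (topspace vector_topology - ?f ` C)"
      by (simp add: closedin_def)
    moreover have "topspace vector_topology - ?f ` C = {v \<in> topspace vector_topology. wrap v \<in> U}"
    proof -
      have "v \<in> ?f ` C \<longleftrightarrow> wrap v \<in> Some ` C" for v
        using wrap_eq_Some [of v] by (auto simp: image_iff eq_commute [of "Some _"])
      moreover have "y \<in> U \<longleftrightarrow> y \<notin> Some ` C" for y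
        using C(3) by (cases y) auto
      ultimately show ?thesis
        by auto
    qed
    ultimately show ?thesis
      by simp
  qed
  then show ?thesis
    unfolding continuous_map_def topspace_sph by (simp add: rep_sphere_def)
qed

text \<open>The extra point covers the point at infinity when the representation is zero, where the disk
  has no boundary.\<close>

definition wrap_plus :: "'v option \<Rightarrow> 'v option" where
  "wrap_plus = case_option None wrap"

lemma wrap_plus_simps [simp]: "wrap_plus None = None" "wrap_plus (Some v) = wrap v"
  by (simp_all add: wrap_plus_def)

lemma quotient_map_wrap_plus: "quotient_map (plus_topology disk) (spc sph) wrap_plus"
proof (rule continuous_closed_imp_quotient_map)
  show cont: "continuous_map (plus_topology disk) (spc sph) wrap_plus"
    by (rule continuous_map_plus)
      (simp_all add: rep_sphere_def continuous_map_from_subtopology continuous_map_wrap [unfolded rep_sphere_def, simplified])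
  \<comment> \<open>The source is compact and the target is Hausdorff, so continuity and surjectivity suffice.\<close>
  have "compactin (plus_topology disk) ({None} \<union> Some ` topspace disk)"
  proof (rule compactin_Un)
    show "compactin (plus_topology disk) (Some ` topspace disk)"
      using image_compactin [OF compact_space_disk [unfolded compact_space_def] continuous_map_Some_plus] .
  qed simp
  then have "compact_space (plus_topology disk)"
    by (simp add: compact_space_def)
  moreover have "Hausdorff_space (spc sph)"
    using Hausdorff_space_vector locally_compact_space_vector
    by (simp add: rep_sphere_def Hausdorff_space_Alexandroff_compactification)
  ultimately show "closed_map (plus_topology disk) (spc sph) wrap_plus"
    using cont continuous_imp_closed_map by blast
  have "y \<in> wrap_plus ` topspace (plus_topology disk)" for y
  proof (cases y)
    case None
    then show ?thesis
      by (intro image_eqI [of _ _ None]) simp_all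
  next
    case (Some x)
    let ?v = "(1 / (1 + nrm x)) *\<^sub>R x"
    have "wrap ?v = Some x"
      by (simp add: wrap_eq_Some)
    moreover from this have "nrm ?v \<le> 1"
      by (metis linorder_not_le less_imp_le option.distinct(1) wrap_eq_None)
    ultimately show ?thesis
      using Some by (intro image_eqI [of _ _ "Some ?v"]) simp_all
  qed
  then show "wrap_plus ` topspace (plus_topology disk) = topspace (spc sph)"
    by auto
qed

lemma act_sph: "act sph g = map_option (\<sigma> g)" and base_sph [simp]: "base sph = None"
  by (simp_all add: rep_sphere_def)

lemma wrap_plus_cases:
  obtains "y = None" | v where "nrm v \<le> 1" "y = wrap v"
proof -
  have "y \<in> wrap_plus ` topspace (plus_topology disk)"
    using quotient_map_wrap_plus by (simp add: quotient_map_def)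
  then show thesis
    using that by auto
qed

lemma wrap_eq_cases:
  assumes "nrm v \<le> 1" "nrm v' \<le> 1" "wrap v = wrap v'"
  shows "v = v' \<or> (nrm v = 1 \<and> nrm v' = 1)"
proof (cases "wrap v")
  case None
  then show ?thesis
    using assms wrap_eq_None [of v] wrap_eq_None [of v'] by (simp del: wrap_eq_None)
next
  case (Some x)
  then have "v = (1 / (1 + nrm x)) *\<^sub>R x" "v' = (1 / (1 + nrm x)) *\<^sub>R x"
    using assms(3) by (metis wrap_eq_Some)+
  then show ?thesis
    by simp
qed

lemma is_based_gspace_sph: "is_based_gspace \<Gamma> sph"
proof -
  have "is_gspace \<Gamma> sph"
  proof (rule is_gspaceI)
    fix g assume g: "g \<in> carrier \<Gamma>"
    have "continuous_map (plus_topology disk) (spc sph) (act sph g \<circ> wrap_plus)"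
    proof (rule continuous_map_plus)
      have "continuous_map disk (spc sph) (wrap \<circ> \<sigma> g)"
        by (rule continuous_map_compose [OF continuous_map_disk_\<sigma> [OF g]])
          (intro continuous_map_from_subtopology continuous_map_wrap)
      then show "continuous_map disk (spc sph) (\<lambda>x. (act sph g \<circ> wrap_plus) (Some x))"
        by (simp add: comp_def act_sph wrap_\<sigma> [OF g])
    qed simp
    then show "continuous_map (spc sph) (spc sph) (act sph g)"
      by (rule continuous_compose_quotient_map [OF quotient_map_wrap_plus])
  qed (auto simp: act_sph option.map_comp comp_def \<sigma>_0 \<sigma>_mult option.map_ident cong: option.map_cong)
  then show ?thesis
    by (simp add: is_based_gspace_def act_sph)
qed

section \<open>The mapping cone\<close>

abbreviation "plusA \<equiv> disjoint_basepoint PA"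

abbreviation "plusX \<equiv> disjoint_basepoint PX"

abbreviation "incl \<equiv> map_option PH_incl"

text \<open>The space that the mapping cone is a quotient of, and below its projection \<open>cone_class\<close>. The cone
  point is the class of the basepoint, at parameter 0; parameter 1 is glued to the projective space.\<close>

abbreviation "pieces \<equiv> disjoint_union_gspace plusX (cylinder plusA)"

abbreviation "mcone \<equiv> mapping_cone plusA plusX incl"

abbreviation "cone_rel \<equiv> cone_equiv plusA plusX incl"

definition cone_class :: "('w \<times> quat) set option + 'w set option \<times> real \<Rightarrow> (('w \<times> quat) set option + 'w set option \<times> real) set" where
  "cone_class y = cone_rel `` {y}"

lemma spc_pieces: "spc pieces = disjoint_union_topology (plus_topology (spc PX)) (prod_topology (plus_topology (spc PA)) (top_of_set {0..1}))"
  by (simp add: disjoint_union_gspace_def cylinder_def disjoint_basepoint_def)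

lemma topspace_pieces: "topspace (spc pieces) = Inl ` insert None (Some ` topspace (spc PX)) \<union>
    Inr ` (insert None (Some ` topspace (spc PA)) \<times> {0..1})"
  by (simp add: spc_pieces)

lemma act_pieces [simp]: "act pieces g (Inl x) = Inl (map_option (act PX g) x)"
  "act pieces g (Inr (a, t)) = Inr (map_option (act PA g) a, t)"
  by (simp_all add: disjoint_union_gspace_def cylinder_def disjoint_basepoint_def)

lemma pieces_cases:
  assumes "y \<in> topspace (spc pieces)"
  obtains "y = Inl None" | v where "nrm v \<le> 1" "y = Inl (Some (cell v))"
    | t where "t \<in> {0..1}" "y = Inr (None, t)"
    | v t where "nrm v = 1" "t \<in> {0..1}" "y = Inr (Some (line (\<mu> v)), t)"
proof -
  have "\<exists>v. nrm v \<le> 1 \<and> x = cell v" if "x \<in> topspace (spc PX)" for x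
  proof -
    have "x \<in> cell ` topspace disk"
      using quotient_map_cell that by (simp only: quotient_map_def)
    then show ?thesis
      by auto
  qed
  note cell = this
  from assms consider "y = Inl None" | x where "x \<in> topspace (spc PX)" "y = Inl (Some x)"
    | t where "t \<in> {0..1}" "y = Inr (None, t)"
    | a t where "a \<in> topspace (spc PA)" "t \<in> {0..1}" "y = Inr (Some a, t)"
    unfolding topspace_pieces by fast
  then show thesis
  proof cases
    case (2 x)
    then show thesis
      using cell that(2) by metis
  next
    case (4 a t)
    then show thesis
      using PA_eq_boundary_line [of a] that(4) by metis
  qed (use that(1,3) in simp_all)
qed

lemma is_gspace_pieces: "is_gspace \<Gamma> pieces"
  using is_based_gspace_disjoint_basepoint [OF _ is_gspace_PH [OF rep]]
    is_based_gspace_disjoint_basepoint [OF _ is_gspace_PH [OF repX]]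
  by (intro is_gspace_disjoint_union is_gspace_cylinder) (simp_all add: is_based_gspace_def)

lemma equiv_cone_rel: "equiv (topspace (spc pieces)) cone_rel"
  unfolding cone_equiv_def by (rule equiv_generated_equiv)

lemma spc_A: "spc plusA = plus_topology (spc PA)" and base_A: "base plusA = None" and base_X: "base plusX = None"
  by (simp_all add: disjoint_basepoint_def)

lemma PH_incl_in_PX: "a \<in> topspace (spc PA) \<Longrightarrow> PH_incl a \<in> topspace (spc PX)"
  using continuous_map_PH_incl by (auto simp: continuous_map_def)

lemma cone_class_one: "a \<in> topspace (spc PA) \<Longrightarrow> cone_class (Inr (Some a, 1)) = cone_class (Inl (Some (PH_incl a)))"
  and cone_class_zero: "a \<in> topspace (spc PA) \<Longrightarrow> cone_class (Inr (Some a, 0)) = cone_class (Inl None)"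
  and cone_class_base: "t \<in> {0..1} \<Longrightarrow> cone_class (Inr (None, t)) = cone_class (Inl None)"
proof -
  have gen: "cone_class x = cone_class y" if "x \<in> topspace (spc pieces)" "y \<in> topspace (spc pieces)"
    "(x, y) \<in> {(Inr (a, 1), Inl (incl a)) | a. a \<in> topspace (spc plusA)} \<union>
        {(Inr (a, 0), Inl (base plusX)) | a. a \<in> topspace (spc plusA)} \<union>
        {(Inr (base plusA, t), Inl (base plusX)) | t. t \<in> {0..1}}" for x y
    unfolding cone_class_def
    by (rule equiv_class_eq [OF equiv_cone_rel], unfold cone_equiv_def, rule generated_equiv_generator [OF that(3,1,2)])
  show "a \<in> topspace (spc PA) \<Longrightarrow> cone_class (Inr (Some a, 1)) = cone_class (Inl (Some (PH_incl a)))"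
    by (rule gen) (auto simp: topspace_pieces spc_A PH_incl_in_PX)
  show "a \<in> topspace (spc PA) \<Longrightarrow> cone_class (Inr (Some a, 0)) = cone_class (Inl None)"
    by (rule gen) (auto simp: topspace_pieces spc_A base_X)
  show "t \<in> {0..1} \<Longrightarrow> cone_class (Inr (None, t)) = cone_class (Inl None)"
    by (rule gen) (auto simp: topspace_pieces base_A base_X)
qed

text \<open>The gluing relation, stated in terms of boundary points \<open>v\<close> of the disk: a function on the pieces
  descends to the cone if it respects these three kinds of identification.\<close>

lemma cone_class_invariant:
  assumes "x \<in> topspace (spc pieces)" "y \<in> topspace (spc pieces)" "cone_class x = cone_class y"
    and "\<And>v. nrm v = 1 \<Longrightarrow> f (Inr (Some (line (\<mu> v)), 1)) = f (Inl (Some (cell v)))"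
    and "\<And>v. nrm v = 1 \<Longrightarrow> f (Inr (Some (line (\<mu> v)), 0)) = f (Inl None)"
    and "\<And>t. t \<in> {0..1} \<Longrightarrow> f (Inr (None, t)) = f (Inl None)"
  shows "f x = f y"
proof -
  have "(x, y) \<in> cone_rel"
    using assms(3) eq_equiv_class_iff [OF equiv_cone_rel assms(1,2)] by (simp add: cone_class_def)
  then show ?thesis
    unfolding cone_equiv_def
  proof (rule generated_equiv_invariant)
    fix a b :: "('w \<times> quat) set option + 'w set option \<times> real"
    assume "(a, b) \<in> {(Inr (a, 1), Inl (incl a)) | a. a \<in> topspace (spc plusA)} \<union>
        {(Inr (a, 0), Inl (base plusX)) | a. a \<in> topspace (spc plusA)} \<union>
        {(Inr (base plusA, t), Inl (base plusX)) | t. t \<in> {0..1}}"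
    then consider c where "c \<in> topspace (spc plusA)" "a = Inr (c, 1)" "b = Inl (incl c)"
      | c where "c \<in> topspace (spc plusA)" "a = Inr (c, 0)" "b = Inl None"
      | t where "t \<in> {0..1}" "a = Inr (None, t)" "b = Inl None"
      unfolding base_A base_X by blast
    then show "f a = f b"
    proof cases
      case (1 c)
      show ?thesis
      proof (cases c)
        case None
        then show ?thesis
          using 1 assms(6) [of 1] by simp
      next
        case (Some d)
        then obtain v where "nrm v = 1" "d = line (\<mu> v)"
          using 1(1) PA_eq_boundary_line [of d] by (auto simp: spc_A)
        then show ?thesis
          using 1 Some assms(4) [of v] cell_boundary [of v] by simp
      qed
    next
      case (2 c)
      show ?thesis
      proof (cases c)
        case None
        then show ?thesis
          using 2 assms(6) [of 0] by simp
      next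
        case (Some d)
        then obtain v where "nrm v = 1" "d = line (\<mu> v)"
          using 2(1) PA_eq_boundary_line [of d] by (auto simp: spc_A)
        then show ?thesis
          using 2 Some assms(5) [of v] by simp
      qed
    qed (use assms(6) in simp)
  qed
qed

lemma cone_rel_act:
  assumes g: "g \<in> carrier \<Gamma>" and xy: "(x, y) \<in> cone_rel"
  shows "(act pieces g x, act pieces g y) \<in> cone_rel"
proof -
  have T: "x \<in> topspace (spc pieces)" "y \<in> topspace (spc pieces)"
    using equiv_cone_rel xy by (auto simp: equiv_def)
  have "cone_class (act pieces g x) = cone_class (act pieces g y)"
  proof (rule cone_class_invariant [OF T])
    show "cone_class x = cone_class y"
      unfolding cone_class_def by (rule equiv_class_eq [OF equiv_cone_rel xy])
    fix v assume v: "nrm v = 1"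
    then have "v \<noteq> 0" "nrm (\<sigma> g v) = 1"
      using g by auto
    then show "cone_class (act pieces g (Inr (Some (line (\<mu> v)), 1))) = cone_class (act pieces g (Inl (Some (cell v))))"
      using cone_class_one [OF line_\<mu>_in_PA, of "\<sigma> g v"] by (simp add: line_\<mu>_\<sigma> [OF g] act_cell [OF g] cell_boundary)
    show "cone_class (act pieces g (Inr (Some (line (\<mu> v)), 0))) = cone_class (act pieces g (Inl None))"
      using cone_class_zero [OF line_\<mu>_in_PA, of "\<sigma> g v"] \<open>v \<noteq> 0\<close> \<open>nrm (\<sigma> g v) = 1\<close> by (simp add: line_\<mu>_\<sigma> [OF g])
  qed (simp add: cone_class_base)
  moreover have "act pieces g x \<in> topspace (spc pieces)" "act pieces g y \<in> topspace (spc pieces)"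
    using is_gspace_closed [OF is_gspace_pieces g] T by blast+
  ultimately show ?thesis
    using eq_equiv_class_iff [OF equiv_cone_rel] by (simp add: cone_class_def)
qed

lemma spc_cone: "spc mcone = quotient_topology (spc pieces) cone_rel"
  by (simp add: mapping_cone_def quotient_gspace_def Let_def)

lemma quotient_map_cone_class: "quotient_map (spc pieces) (spc mcone) cone_class"
  unfolding spc_cone cone_class_def by (rule quotient_map_quotient_topology)

lemma base_cone: "base mcone = cone_class (Inl None)"
  by (simp add: mapping_cone_def Let_def cone_class_def base_X)

lemma act_cone: "g \<in> carrier \<Gamma> \<Longrightarrow> y \<in> topspace (spc pieces) \<Longrightarrow> act mcone g (cone_class y) = cone_class (act pieces g y)"
  using quotient_gspace_act_class [OF _ is_gspace_pieces equiv_cone_rel cone_rel_act]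
  by (simp add: mapping_cone_def Let_def cone_class_def)

lemma cone_class_in_cone: "y \<in> topspace (spc pieces) \<Longrightarrow> cone_class y \<in> topspace (spc mcone)"
  by (simp add: spc_cone cone_class_def quotientI)

lemma is_based_gspace_cone: "is_based_gspace \<Gamma> mcone"
proof -
  have "is_gspace \<Gamma> (quotient_gspace pieces cone_rel)"
    by (rule is_gspace_quotient [OF _ is_gspace_pieces equiv_cone_rel cone_rel_act]) simp_all
  then have "is_gspace \<Gamma> mcone"
    by (simp add: is_gspace_def mapping_cone_def Let_def)
  moreover have "act mcone g (base mcone) = base mcone" if "g \<in> carrier \<Gamma>" for g
    using act_cone [OF that, of "Inl None"] by (simp add: base_cone topspace_pieces)
  ultimately show ?thesis
    by (simp add: is_based_gspace_def base_cone cone_class_in_cone topspace_pieces)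
qed

lemma cone_cases:
  assumes "c \<in> topspace (spc mcone)"
  obtains y where "y \<in> topspace (spc pieces)" "c = cone_class y"
  using quotient_map_cone_class assms unfolding quotient_map_def by blast

end

section \<open>The radial coordinate on the mapping cone\<close>

context projective_cell
begin

lemma continuous_map_cone_class_Inl: "continuous_map (plus_topology (spc PX)) (spc mcone) (\<lambda>x. cone_class (Inl x))"
  and continuous_map_cone_class_Inr: "continuous_map (prod_topology (plus_topology (spc PA)) (top_of_set {0..1})) (spc mcone) (\<lambda>y. cone_class (Inr y))"
  using continuous_map_compose [OF continuous_map_Inl quotient_imp_continuous_map [OF quotient_map_cone_class, unfolded spc_pieces]]
    continuous_map_compose [OF continuous_map_Inr quotient_imp_continuous_map [OF quotient_map_cone_class, unfolded spc_pieces]]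
  by (simp_all add: comp_def)

lemma spc_X: "spc plusX = plus_topology (spc PX)"
  by (simp add: disjoint_basepoint_def)

text \<open>The cutoff at 0 keeps the parameter in the unit interval, so that everything of norm at least 2 goes
  to the cone point.\<close>

definition radial :: "'v \<Rightarrow> (('w \<times> quat) set option + 'w set option \<times> real) set" where
  "radial v = (if nrm v \<le> 1 then cone_class (Inl (Some (cell v)))
     else cone_class (Inr (Some (line (\<mu> v)), max 0 (2 - nrm v))))"

lemma radial_le: "nrm v \<le> 1 \<Longrightarrow> radial v = cone_class (Inl (Some (cell v)))"
  by (simp add: radial_def)

lemma radial_ge:
  assumes "1 \<le> nrm v"
  shows "radial v = cone_class (Inr (Some (line (\<mu> v)), max 0 (2 - nrm v)))"
proof (cases "nrm v = 1")
  case True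
  then show ?thesis
    using cone_class_one [OF line_\<mu>_in_PA [OF True]] by (simp add: radial_def cell_boundary)
qed (use assms in \<open>simp add: radial_def\<close>)

lemma radial_far:
  assumes "2 \<le> nrm v"
  shows "radial v = cone_class (Inl None)"
proof -
  have "v \<noteq> 0"
    using assms by auto
  then show ?thesis
    using assms cone_class_zero [of "line (\<mu> v)"] by (simp add: radial_ge)
qed

text \<open>Along the cone the radial coordinate at distance \<open>2 - t\<close> is the cone parameter \<open>t\<close>, and the value
  depends only on the line through \<open>\<mu> v\<close>. Hence formulas in the radial coordinate descend to the cone.\<close>

lemma radial_scale:
  assumes "nrm v = 1" "t \<in> {0..1}"
  shows "radial ((2 - t) *\<^sub>R v) = cone_class (Inr (Some (line (\<mu> v)), t))"
proof -
  have "v \<noteq> 0"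
    using assms(1) by auto
  then show ?thesis
    using assms line_scaleR [of "2 - t" "\<mu> v"] by (simp add: radial_ge)
qed

lemma continuous_map_radial: "continuous_map vector_topology (spc mcone) radial"
proof -
  have id: "continuous_map vector_topology vector_topology (\<lambda>v :: 'v. v)"
    by simp
  have "continuous_map vector_topology (spc mcone)
      (\<lambda>v. if nrm v \<le> 1 then cone_class (Inl (Some (cell v))) else cone_class (Inr (Some (line (\<mu> v)), max 0 (2 - nrm v))))"
  proof (rule continuous_map_cases_le)
    show "continuous_map vector_topology euclideanreal nrm"
      by (rule continuous_map_nrm [OF id])
    have "continuous_map vector_topology (spc PX) cell"
      by (rule continuous_map_cell [OF id])
    from continuous_map_compose [OF continuous_map_compose [OF this continuous_map_Some_plus] continuous_map_cone_class_Inl]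
    show "continuous_map (subtopology vector_topology {v \<in> topspace vector_topology. nrm v \<le> 1}) (spc mcone)
        (\<lambda>v. cone_class (Inl (Some (cell v))))"
      by (simp add: comp_def continuous_map_from_subtopology)
    let ?Y = "subtopology vector_topology {v \<in> topspace vector_topology. 1 \<le> nrm v}"
    have "continuous_map ?Y (spc PA) (\<lambda>v. line (\<mu> v))"
      by (intro continuous_map_line continuous_map_\<mu> continuous_map_from_subtopology id) auto
    from continuous_map_compose [OF this continuous_map_Some_plus]
    have "continuous_map ?Y (plus_topology (spc PA)) (\<lambda>v. Some (line (\<mu> v)))"
      by (simp add: comp_def)
    moreover have "continuous_map ?Y (top_of_set {0..1}) (\<lambda>v. max 0 (2 - nrm v))"
      by (intro continuous_map_into_subtopology continuous_map_real_max continuous_map_diff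
          continuous_map_nrm continuous_map_from_subtopology id) auto
    ultimately have "continuous_map ?Y (prod_topology (plus_topology (spc PA)) (top_of_set {0..1}))
        (\<lambda>v. (Some (line (\<mu> v)), max 0 (2 - nrm v)))"
      by (simp add: continuous_map_pairwise comp_def)
    from continuous_map_compose [OF this continuous_map_cone_class_Inr]
    show "continuous_map ?Y (spc mcone) (\<lambda>v. cone_class (Inr (Some (line (\<mu> v)), max 0 (2 - nrm v))))"
      by (simp add: comp_def)
  next
    fix v :: 'v assume "nrm v = 1"
    then show "cone_class (Inl (Some (cell v))) = cone_class (Inr (Some (line (\<mu> v)), max 0 (2 - nrm v)))"
      using radial_le [of v] radial_ge [of v] by simp
  qed simp
  then show ?thesis
    by (simp add: radial_def [abs_def])
qed

lemma act_radial:
  assumes g: "g \<in> carrier \<Gamma>"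
  shows "act mcone g (radial v) = radial (\<sigma> g v)"
proof (cases "nrm v \<le> 1")
  case True
  then show ?thesis
    using act_cone [OF g, of "Inl (Some (cell v))"] g by (simp add: radial_le act_cell topspace_pieces)
next
  case False
  then have "v \<noteq> 0"
    by auto
  then show ?thesis
    using act_cone [OF g, of "Inr (Some (line (\<mu> v)), max 0 (2 - nrm v))"] g False
    by (simp add: radial_ge line_\<mu>_\<sigma> topspace_pieces)
qed

lemma act_base_cone: "g \<in> carrier \<Gamma> \<Longrightarrow> act mcone g (cone_class (Inl None)) = cone_class (Inl None)"
  using is_based_gspace_cone by (simp add: is_based_gspace_def base_cone)

section \<open>The mapping cone and the representation sphere are homotopy equivalent\<close>

text \<open>The map \<open>wrap\<close> is constant on the boundary of the disk, so it descends along the cell. The result is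
  the second map of the cofiber sequence.\<close>

lemma ex_collapse:
  "\<exists>q. based_gmap \<Gamma> plusX sph q \<and> (\<forall>v. nrm v \<le> 1 \<longrightarrow> q (Some (cell v)) = wrap v)"
proof -
  have "wrap v = wrap v'" if "v \<in> topspace disk" "v' \<in> topspace disk" "cell v = cell v'" for v v'
    using cell_eq [of v v'] that by (auto simp: wrap_def)
  moreover have "continuous_map disk (spc sph) wrap"
    by (intro continuous_map_from_subtopology continuous_map_wrap)
  ultimately have "\<exists>c. continuous_map (spc PX) (spc sph) c \<and> (\<forall>v\<in>topspace disk. c (cell v) = wrap v)"
    by (intro ex_continuous_quotient_lift [OF quotient_map_cell])
  then obtain c where c: "continuous_map (spc PX) (spc sph) c"
    "\<And>v. v \<in> topspace disk \<Longrightarrow> c (cell v) = wrap v"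
    by blast
  define q where "q = case_option None c"
  have q: "q None = None" "q (Some (cell v)) = wrap v" if "nrm v \<le> 1" for v
    using c(2) [of v] that by (simp_all add: q_def)
  have "based_gmap \<Gamma> plusX sph q"
    unfolding based_gmap_def gmap_def
  proof (intro conjI ballI)
    show "continuous_map (spc plusX) (spc sph) q"
      unfolding disjoint_basepoint_def gspace.simps based_gspace.simps
      by (rule continuous_map_plus) (simp_all add: q_def c(1))
    show "q (base plusX) = base sph"
      by (simp add: base_X q_def)
    fix g x assume g: "g \<in> carrier \<Gamma>" and "x \<in> topspace (spc plusX)"
    then consider "x = None" | z where "z \<in> topspace (spc PX)" "x = Some z"
      by (auto simp: disjoint_basepoint_def)
    then show "q (act plusX g x) = act sph g (q x)"
    proof cases
      case (2 z)
      then have "z \<in> cell ` topspace disk"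
        using quotient_map_cell by (simp only: quotient_map_def)
      then obtain v where v: "nrm v \<le> 1" "z = cell v"
        by auto
      then show ?thesis
        using q(2) [of v] q(2) [of "\<sigma> g v"] g 2
        by (simp add: disjoint_basepoint_def act_cell act_sph wrap_\<sigma>)
    qed (simp add: disjoint_basepoint_def act_sph q_def)
  qed
  then show ?thesis
    using q by blast
qed

text \<open>The collapse sends the subspace \<open>P(W)\<close> to infinity, so it extends to the cone by the constant map.\<close>

lemma ex_cone_collapse:
  assumes "based_gmap \<Gamma> plusX sph q" and q: "\<And>v. nrm v \<le> 1 \<Longrightarrow> q (Some (cell v)) = wrap v"
  shows "\<exists>e. based_gmap \<Gamma> mcone sph e \<and>
    (\<forall>x\<in>topspace (spc plusX). e (cone_class (Inl x)) = q x) \<and>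
    (\<forall>y. Inr y \<in> topspace (spc pieces) \<longrightarrow> e (cone_class (Inr y)) = None)"
proof -
  have contq: "continuous_map (plus_topology (spc PX)) (spc sph) q" and q0: "q None = None"
    using assms(1) by (simp_all add: based_gmap_def gmap_def disjoint_basepoint_def)
  have eqq: "\<And>g x. g \<in> carrier \<Gamma> \<Longrightarrow> x \<in> topspace (plus_topology (spc PX)) \<Longrightarrow>
      q (map_option (act PX g) x) = map_option (\<sigma> g) (q x)"
    using assms(1) by (auto simp: based_gmap_def gmap_def disjoint_basepoint_def act_sph)
  define h where "h = case_sum q (\<lambda>_ :: 'w set option \<times> real. None :: 'v option)"
  have h: "h (Inl x) = q x" "h (Inr y) = None" for x y
    by (simp_all add: h_def)
  have cont: "continuous_map (spc pieces) (spc sph) h"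
    unfolding spc_pieces by (rule continuous_map_disjoint_union) (simp_all add: h contq)
  have "h x = h y" if "x \<in> topspace (spc pieces)" "y \<in> topspace (spc pieces)" "cone_class x = cone_class y" for x y
    using that by (rule cone_class_invariant) (simp_all add: h q q0 wrap_def)
  with cont have "\<exists>e. continuous_map (spc mcone) (spc sph) e \<and> (\<forall>y\<in>topspace (spc pieces). e (cone_class y) = h y)"
    by (rule ex_continuous_quotient_lift [OF quotient_map_cone_class])
  then obtain e where e: "continuous_map (spc mcone) (spc sph) e"
    "\<And>y. y \<in> topspace (spc pieces) \<Longrightarrow> e (cone_class y) = h y"
    by blast
  have "based_gmap \<Gamma> mcone sph e"
    unfolding based_gmap_def gmap_def
  proof (intro conjI ballI)
    show "e (base mcone) = base sph"
      using e(2) [of "Inl None"] by (simp add: base_cone topspace_pieces h q0)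
    fix g c assume g: "g \<in> carrier \<Gamma>" and "c \<in> topspace (spc mcone)"
    then obtain y where y: "y \<in> topspace (spc pieces)" "c = cone_class y"
      by (rule_tac cone_cases)
    have "act pieces g y \<in> topspace (spc pieces)"
      by (rule is_gspace_closed [OF is_gspace_pieces g y(1)])
    moreover have "h (act pieces g y) = act sph g (h y)"
    proof (cases y)
      case (Inl x)
      then have "x \<in> topspace (plus_topology (spc PX))"
        using y(1) by (auto simp: topspace_pieces)
      then show ?thesis
        by (simp add: Inl h act_sph eqq g)
    next
      case (Inr z)
      then show ?thesis
        by (cases z) (simp add: h act_sph)
    qed
    ultimately show "e (act mcone g c) = act sph g (e c)"
      using y by (simp add: act_cone [OF g] e(2))
  qed (rule e(1))
  moreover have "e (cone_class (Inl x)) = q x" if "x \<in> topspace (spc plusX)" for x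
    using e(2) [of "Inl x"] that by (auto simp: topspace_pieces h spc_X)
  moreover have "e (cone_class (Inr y)) = None" if "Inr y \<in> topspace (spc pieces)" for y
    using e(2) [OF that] by (simp add: h)
  ultimately show ?thesis
    by blast
qed

text \<open>Stretching by 2 moves the boundary of the disk to the cone point, which makes \<open>v \<mapsto> radial (2 v)\<close>
  descend to the sphere.\<close>

lemma ex_cone_section:
  "\<exists>s. based_gmap \<Gamma> sph mcone s \<and> (\<forall>v. nrm v \<le> 1 \<longrightarrow> s (wrap v) = radial (2 *\<^sub>R v))"
proof -
  define h where "h = case_option (cone_class (Inl None)) (\<lambda>v. radial (2 *\<^sub>R v))"
  have h: "h None = cone_class (Inl None)" "h (Some v) = radial (2 *\<^sub>R v)" for v
    by (simp_all add: h_def)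
  have base: "cone_class (Inl None) \<in> topspace (spc mcone)"
    by (simp add: cone_class_in_cone topspace_pieces)
  have "continuous_map vector_topology vector_topology (\<lambda>v :: 'v. 2 *\<^sub>R v)"
    by (intro continuous_map_vector_scaleR) simp_all
  from continuous_map_compose [OF this continuous_map_radial]
  have "continuous_map (plus_topology disk) (spc mcone) h"
    by (intro continuous_map_plus) (simp_all add: h base comp_def continuous_map_from_subtopology)
  moreover have "h y = h y'"
    if yy: "y \<in> topspace (plus_topology disk)" "y' \<in> topspace (plus_topology disk)" "wrap_plus y = wrap_plus y'" for y y'
  proof -
    have *: "h (Some v) = cone_class (Inl None)" if "1 \<le> nrm v" for v
      using that by (simp add: h radial_far)
    consider "wrap_plus y = None" | v v' where "nrm v \<le> 1" "nrm v' \<le> 1" "y = Some v" "y' = Some v'" "wrap v = wrap v'"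
      using yy by (cases y; cases y') auto
    then show ?thesis
    proof cases
      case 1
      have "h z = cone_class (Inl None)" if "wrap_plus z = None" for z
        using that by (cases z) (simp_all add: h(1) *)
      then show ?thesis
        using 1 yy(3) by simp
    next
      case (2 v v')
      then show ?thesis
        using wrap_eq_cases [OF 2(1,2,5)] * by auto
    qed
  qed
  ultimately have "\<exists>s. continuous_map (spc sph) (spc mcone) s \<and> (\<forall>y\<in>topspace (plus_topology disk). s (wrap_plus y) = h y)"
    by (rule ex_continuous_quotient_lift [OF quotient_map_wrap_plus])
  then obtain s where s: "continuous_map (spc sph) (spc mcone) s"
    "\<And>y. y \<in> topspace (plus_topology disk) \<Longrightarrow> s (wrap_plus y) = h y"
    by blast
  have s_wrap: "s (wrap v) = radial (2 *\<^sub>R v)" if "nrm v \<le> 1" for v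
    using s(2) [of "Some v"] that by (simp add: h)
  have "based_gmap \<Gamma> sph mcone s"
    unfolding based_gmap_def gmap_def
  proof (intro conjI ballI)
    show "s (base sph) = base mcone"
      using s(2) [of None] by (simp add: base_cone h)
    fix g y assume g: "g \<in> carrier \<Gamma>"
    show "s (act sph g y) = act mcone g (s y)"
    proof (rule wrap_plus_cases [of y])
      assume "y = None"
      then show ?thesis
        using s(2) [of None] by (simp add: act_sph h act_base_cone g)
    next
      fix v assume v: "nrm v \<le> 1" "y = wrap v"
      then show ?thesis
        using s_wrap [of v] s_wrap [of "\<sigma> g v"] g
        by (simp add: act_sph wrap_\<sigma> [symmetric] act_radial \<sigma>_scaleR)
    qed
  qed (rule s(1))
  then show ?thesis
    using s_wrap by blast
qed

text \<open>The factor \<open>2 - t\<close> is at least 1, so boundary points stay outside the open disk and keep going to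
  infinity; at \<open>t = 1\<close> the map is the identity.\<close>

lemma ex_homotopy_sph:
  "\<exists>h. continuous_map (prod_topology (top_of_set {0..1}) (spc sph)) (spc sph) h \<and>
    (\<forall>t\<in>{0..1 :: real}. h (t, None) = None) \<and>
    (\<forall>t\<in>{0..1}. \<forall>v. nrm v \<le> 1 \<longrightarrow> h (t, wrap v) = wrap ((2 - t) *\<^sub>R v))"
proof -
  define H where "H = (\<lambda>(t, y). case y of None \<Rightarrow> None | Some v \<Rightarrow> wrap ((2 - t) *\<^sub>R v))"
  have H: "H (t, None) = None" "H (t, Some v) = wrap ((2 - t) *\<^sub>R v)" for t v
    by (simp_all add: H_def)
  have far: "wrap ((2 - t) *\<^sub>R v) = None" if "t \<in> {0..1}" "1 \<le> nrm v" for t v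
  proof -
    have "1 * 1 \<le> (2 - t) * nrm v"
      using that by (intro mult_mono) auto
    then show ?thesis
      using that by simp
  qed
  have "continuous_map (prod_topology (top_of_set {0..1}) (plus_topology disk)) (spc sph) H"
  proof (rule continuous_map_prod_plus)
    let ?P = "prod_topology (top_of_set {0..1 :: real}) disk"
    have "continuous_map ?P vector_topology (\<lambda>x. (2 - fst x) *\<^sub>R snd x)"
      using continuous_map_fst [of "top_of_set {0..1 :: real}" disk] continuous_map_snd [of "top_of_set {0..1 :: real}" disk]
      by (intro continuous_map_vector_scaleR continuous_map_diff) (simp_all add: continuous_map_in_subtopology)
    from continuous_map_compose [OF this continuous_map_wrap]
    show "continuous_map ?P (spc sph) (\<lambda>(t, v). H (t, Some v))"
      by (simp add: H comp_def split_def)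
  qed (simp add: H)
  moreover have "H (t, y) = H (t, y')"
    if t: "t \<in> {0..1}" and yy: "y \<in> topspace (plus_topology disk)" "y' \<in> topspace (plus_topology disk)"
      "wrap_plus y = wrap_plus y'" for t y y'
  proof -
    consider "wrap_plus y = None" | v v' where "nrm v \<le> 1" "nrm v' \<le> 1" "y = Some v" "y' = Some v'" "wrap v = wrap v'"
      using yy by (cases y; cases y') auto
    then show ?thesis
    proof cases
      case 1
      have "H (t, z) = None" if "wrap_plus z = None" for z
        using that by (cases z) (simp_all only: H far [OF t] wrap_plus_simps wrap_eq_None)
      then show ?thesis
        using 1 yy(3) by simp
    next
      case (2 v v')
      then show ?thesis
        using wrap_eq_cases [OF 2(1,2,5)]
      proof (elim disjE conjE)
        assume "nrm v = 1" "nrm v' = 1"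
        then have "H (t, Some v) = None" "H (t, Some v') = None"
          unfolding H by (intro far [OF t]; simp)+
        then show ?thesis
          by (simp add: 2)
      qed (simp add: 2)
    qed
  qed
  ultimately have "\<exists>h. continuous_map (prod_topology (top_of_set {0..1}) (spc sph)) (spc sph) h \<and>
      (\<forall>t\<in>{0..1}. \<forall>y\<in>topspace (plus_topology disk). h (t, wrap_plus y) = H (t, y))"
    by (rule ex_homotopy_lift [OF quotient_map_wrap_plus])
  then obtain h where h: "continuous_map (prod_topology (top_of_set {0..1}) (spc sph)) (spc sph) h"
    "\<And>t y. t \<in> {0..1} \<Longrightarrow> y \<in> topspace (plus_topology disk) \<Longrightarrow> h (t, wrap_plus y) = H (t, y)"
    by blast
  show ?thesis
  proof (intro exI [of _ h] conjI ballI allI impI)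
    fix t :: real assume t: "t \<in> {0..1}"
    show "h (t, None) = None"
      using h(2) [OF t, of None] by (simp add: H)
    show "h (t, wrap v) = wrap ((2 - t) *\<^sub>R v)" if "nrm v \<le> 1" for v
      using h(2) [OF t, of "Some v"] that by (simp add: H)
  qed (rule h(1))
qed

text \<open>At time \<open>t\<close> the cell is stretched by \<open>2 - t\<close>, which pushes its rim into the cone down to parameter \<open>t\<close>. The
  cone is shrunk by the factor \<open>t\<close>, so that its top, at parameter 1, follows the rim.\<close>

lemma ex_homotopy_cone:
  "\<exists>h. continuous_map (prod_topology (top_of_set {0..1}) (spc mcone)) (spc mcone) h \<and>
    (\<forall>t\<in>{0..1 :: real}. h (t, cone_class (Inl None)) = cone_class (Inl None)) \<and>
    (\<forall>t\<in>{0..1}. \<forall>v. nrm v \<le> 1 \<longrightarrow> h (t, cone_class (Inl (Some (cell v)))) = radial ((2 - t) *\<^sub>R v)) \<and>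
    (\<forall>t\<in>{0..1}. \<forall>a s. Inr (a, s) \<in> topspace (spc pieces) \<longrightarrow> h (t, cone_class (Inr (a, s))) = cone_class (Inr (a, s * t)))"
proof -
  let ?I = "top_of_set {0..1 :: real}"
  have "continuous_map (prod_topology ?I disk) vector_topology (\<lambda>x. (2 - fst x) *\<^sub>R snd x)"
    using continuous_map_fst [of ?I disk] continuous_map_snd [of ?I disk]
    by (intro continuous_map_vector_scaleR continuous_map_diff) (simp_all add: continuous_map_in_subtopology)
  note cont = continuous_map_compose [OF this continuous_map_radial]
  define K where "K = (\<lambda>(t, v). radial ((2 - t) *\<^sub>R v))"
  have "continuous_map (prod_topology ?I disk) (spc mcone) K"
    using cont by (simp add: K_def comp_def split_def)
  moreover have "K (t, v) = K (t, v')"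
    if "t \<in> {0..1}" "v \<in> topspace disk" "v' \<in> topspace disk" "cell v = cell v'" for t v v'
    using cell_eq [of v v'] that radial_scale [of v t] radial_scale [of v' t] by (auto simp: K_def)
  ultimately have "\<exists>k. continuous_map (prod_topology ?I (spc PX)) (spc mcone) k \<and>
      (\<forall>t\<in>{0..1}. \<forall>v\<in>topspace disk. k (t, cell v) = K (t, v))"
    by (rule ex_homotopy_lift [OF quotient_map_cell])
  then obtain k where k: "continuous_map (prod_topology ?I (spc PX)) (spc mcone) k"
    and "\<And>t v. t \<in> {0..1} \<Longrightarrow> v \<in> topspace disk \<Longrightarrow> k (t, cell v) = K (t, v)"
    by blast
  then have kv: "k (t, cell v) = radial ((2 - t) *\<^sub>R v)" if "t \<in> {0..1}" "nrm v \<le> 1" for t v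
    using that by (simp add: K_def)
  define H where "H = (\<lambda>(t, y). case y of
      Inl None \<Rightarrow> cone_class (Inl None) | Inl (Some x) \<Rightarrow> k (t, x) | Inr (a, s) \<Rightarrow> cone_class (Inr (a, s * t)))"
  have H: "H (t, Inl None) = cone_class (Inl None)" "H (t, Inl (Some x)) = k (t, x)"
    "H (t, Inr (a, s)) = cone_class (Inr (a, s * t))" for t x a s
    by (simp_all add: H_def)
  have "continuous_map (prod_topology ?I (spc pieces)) (spc mcone) H"
    unfolding spc_pieces
  proof (rule continuous_map_prod_disjoint_union)
    show "continuous_map (prod_topology ?I (plus_topology (spc PX))) (spc mcone) (\<lambda>(t, x). H (t, Inl x))"
      by (rule continuous_map_prod_plus) (simp_all add: H k cone_class_in_cone topspace_pieces)
    let ?P = "prod_topology ?I (prod_topology (plus_topology (spc PA)) ?I)"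
    have a: "continuous_map ?P (plus_topology (spc PA)) (\<lambda>x. fst (snd x))"
      and s: "continuous_map ?P ?I (\<lambda>x. snd (snd x))" and t: "continuous_map ?P ?I fst"
      using continuous_map_compose [OF continuous_map_snd continuous_map_fst]
        continuous_map_compose [OF continuous_map_snd continuous_map_snd] continuous_map_fst
      by (simp_all add: comp_def)
    have "continuous_map ?P ?I (\<lambda>x. snd (snd x) * fst x)"
    proof (rule continuous_map_into_subtopology)
      show "continuous_map ?P euclideanreal (\<lambda>x. snd (snd x) * fst x)"
        using s t by (intro continuous_map_real_mult) (simp_all add: continuous_map_in_subtopology)
      show "(\<lambda>x. snd (snd x) * fst x) \<in> topspace ?P \<rightarrow> {0..1}"
        by (auto simp: mult_le_one)
    qed
    with a have "continuous_map ?P (prod_topology (plus_topology (spc PA)) ?I) (\<lambda>x. (fst (snd x), snd (snd x) * fst x))"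
      by (simp add: continuous_map_pairwise comp_def)
    from continuous_map_compose [OF this continuous_map_cone_class_Inr]
    show "continuous_map ?P (spc mcone) (\<lambda>(t, y). H (t, Inr y))"
      by (simp add: comp_def split_def H_def)
  qed
  moreover have "H (t, x) = H (t, y)"
    if t: "t \<in> {0..1}" and xy: "x \<in> topspace (spc pieces)" "y \<in> topspace (spc pieces)" "cone_class x = cone_class y" for t x y
    using xy
  proof (rule cone_class_invariant [where f = "\<lambda>y. H (t, y)"])
    fix v assume v: "nrm v = 1"
    show "H (t, Inr (Some (line (\<mu> v)), 1)) = H (t, Inl (Some (cell v)))"
      using radial_scale [OF v t] v t by (simp add: H kv)
    show "H (t, Inr (Some (line (\<mu> v)), 0)) = H (t, Inl None)"
      using cone_class_zero [OF line_\<mu>_in_PA [OF v]] by (simp add: H)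
  next
    fix s :: real assume "s \<in> {0..1}"
    then show "H (t, Inr (None, s)) = H (t, Inl None)"
      using t cone_class_base [of "s * t"] by (simp add: H mult_le_one)
  qed
  ultimately have "\<exists>h. continuous_map (prod_topology ?I (spc mcone)) (spc mcone) h \<and>
      (\<forall>t\<in>{0..1}. \<forall>y\<in>topspace (spc pieces). h (t, cone_class y) = H (t, y))"
    by (rule ex_homotopy_lift [OF quotient_map_cone_class])
  then obtain h where h: "continuous_map (prod_topology ?I (spc mcone)) (spc mcone) h"
    "\<And>t y. t \<in> {0..1} \<Longrightarrow> y \<in> topspace (spc pieces) \<Longrightarrow> h (t, cone_class y) = H (t, y)"
    by blast
  show ?thesis
  proof (intro exI [of _ h] conjI ballI allI impI)
    fix t :: real assume t: "t \<in> {0..1}"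
    show "h (t, cone_class (Inl None)) = cone_class (Inl None)"
      using h(2) [OF t, of "Inl None"] by (simp add: H topspace_pieces)
    show "h (t, cone_class (Inl (Some (cell v)))) = radial ((2 - t) *\<^sub>R v)" if "nrm v \<le> 1" for v
      using h(2) [OF t, of "Inl (Some (cell v))"] that t by (simp add: H topspace_pieces kv)
    show "h (t, cone_class (Inr (a, s))) = cone_class (Inr (a, s * t))" if "Inr (a, s) \<in> topspace (spc pieces)" for a s
      using h(2) [OF t that] by (simp add: H)
  qed (rule h(1))
qed

text \<open>The composites of collapse and section are the homotopies at time 0. On the cone part both the
  collapse followed by the section and the homotopy at time 0 give the cone point.\<close>

lemma projective_space_cofiber_sequence:
  "\<exists>q. cofiber_sequence \<Gamma> plusA plusX sph incl q"
proof -
  obtain q where q: "based_gmap \<Gamma> plusX sph q" "\<And>v. nrm v \<le> 1 \<Longrightarrow> q (Some (cell v)) = wrap v"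
    using ex_collapse by blast
  obtain e where e: "based_gmap \<Gamma> mcone sph e"
    and e_Inl: "\<And>x. x \<in> topspace (spc plusX) \<Longrightarrow> e (cone_class (Inl x)) = q x"
    and e_Inr: "\<And>y. Inr y \<in> topspace (spc pieces) \<Longrightarrow> e (cone_class (Inr y)) = None"
    using ex_cone_collapse [OF q] by blast
  obtain s where s: "based_gmap \<Gamma> sph mcone s" and s_wrap: "\<And>v. nrm v \<le> 1 \<Longrightarrow> s (wrap v) = radial (2 *\<^sub>R v)"
    using ex_cone_section by blast
  have e_base: "e (cone_class (Inl None)) = None" and s_None: "s None = cone_class (Inl None)"
    using e s by (simp_all add: based_gmap_def base_cone)
  have e_cell: "e (cone_class (Inl (Some (cell v)))) = wrap v" if "nrm v \<le> 1" for v
    using e_Inl [of "Some (cell v)"] q(2) [OF that] by (simp add: spc_X)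
  have e_radial: "e (radial v) = wrap v" for v
  proof (cases "nrm v \<le> 1")
    case True
    then show ?thesis
      by (simp add: radial_le e_cell)
  next
    case False
    then have "v \<noteq> 0"
      by auto
    then have "Inr (Some (line (\<mu> v)), max 0 (2 - nrm v)) \<in> topspace (spc pieces)"
      using False by (simp add: topspace_pieces)
    from e_Inr [OF this] show ?thesis
      using False wrap_eq_None [of v] by (simp add: radial_ge del: wrap_eq_None)
  qed
  have plusA: "is_based_gspace \<Gamma> plusA" and plusX: "is_based_gspace \<Gamma> plusX"
    by (simp_all add: is_based_gspace_disjoint_basepoint is_gspace_PH rep repX)
  have incl: "based_gmap \<Gamma> plusA plusX incl"
    unfolding based_gmap_def gmap_def
  proof (intro conjI ballI)
    show "continuous_map (spc plusA) (spc plusX) incl"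
      using continuous_map_compose [OF continuous_map_PH_incl continuous_map_Some_plus]
      by (auto simp: disjoint_basepoint_def comp_def intro!: continuous_map_plus)
    fix g a assume "g \<in> carrier \<Gamma>" "a \<in> topspace (spc plusA)"
    then show "incl (act plusA g a) = act plusX g (incl a)"
      using PH_incl_equivariant by (auto simp: disjoint_basepoint_def)
  qed (simp add: disjoint_basepoint_def)
  obtain hs where "continuous_map (prod_topology (top_of_set {0..1}) (spc sph)) (spc sph) hs \<and>
    (\<forall>t\<in>{0..1 :: real}. hs (t, None) = None) \<and>
    (\<forall>t\<in>{0..1}. \<forall>v. nrm v \<le> 1 \<longrightarrow> hs (t, wrap v) = wrap ((2 - t) *\<^sub>R v))"
    using ex_homotopy_sph by (rule exE)
  then have hs: "continuous_map (prod_topology (top_of_set {0..1}) (spc sph)) (spc sph) hs"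
    "\<And>t. t \<in> {0..1} \<Longrightarrow> hs (t, None) = None"
    "\<And>t v. t \<in> {0..1} \<Longrightarrow> nrm v \<le> 1 \<Longrightarrow> hs (t, wrap v) = wrap ((2 - t) *\<^sub>R v)"
    by blast+
  have homotopic_sph: "based_ghomotopic \<Gamma> sph sph (e \<circ> s) (\<lambda>y. y)"
  proof (rule based_ghomotopicI [OF is_based_gspace_sph hs(1)])
    fix y
    show "hs (0, y) = (e \<circ> s) y"
      by (rule wrap_plus_cases [of y]) (simp_all add: hs s_None e_base s_wrap e_radial)
    show "hs (1, y) = y"
      by (rule wrap_plus_cases [of y]) (simp_all add: hs)
    fix t :: real and g assume t: "t \<in> {0..1}" and g: "g \<in> carrier \<Gamma>"
    show "hs (t, act sph g y) = act sph g (hs (t, y))"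
    proof (rule wrap_plus_cases [of y])
      fix v assume v: "nrm v \<le> 1" "y = wrap v"
      then show ?thesis
        using hs(3) [OF t, of v] hs(3) [OF t, of "\<sigma> g v"] g by (simp add: act_sph wrap_\<sigma> [symmetric] \<sigma>_scaleR)
    qed (simp add: act_sph hs(2) [OF t])
  qed (simp add: hs)
  obtain hc where "continuous_map (prod_topology (top_of_set {0..1}) (spc mcone)) (spc mcone) hc \<and>
    (\<forall>t\<in>{0..1 :: real}. hc (t, cone_class (Inl None)) = cone_class (Inl None)) \<and>
    (\<forall>t\<in>{0..1}. \<forall>v. nrm v \<le> 1 \<longrightarrow> hc (t, cone_class (Inl (Some (cell v)))) = radial ((2 - t) *\<^sub>R v)) \<and>
    (\<forall>t\<in>{0..1}. \<forall>a s. Inr (a, s) \<in> topspace (spc pieces) \<longrightarrow> hc (t, cone_class (Inr (a, s))) = cone_class (Inr (a, s * t)))"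
    using ex_homotopy_cone by (rule exE)
  then have hc: "continuous_map (prod_topology (top_of_set {0..1}) (spc mcone)) (spc mcone) hc"
    "\<And>t. t \<in> {0..1} \<Longrightarrow> hc (t, cone_class (Inl None)) = cone_class (Inl None)"
    "\<And>t v. t \<in> {0..1} \<Longrightarrow> nrm v \<le> 1 \<Longrightarrow> hc (t, cone_class (Inl (Some (cell v)))) = radial ((2 - t) *\<^sub>R v)"
    "\<And>t a s. t \<in> {0..1} \<Longrightarrow> Inr (a, s) \<in> topspace (spc pieces) \<Longrightarrow> hc (t, cone_class (Inr (a, s))) = cone_class (Inr (a, s * t))"
    by blast+
  have homotopic_cone: "based_ghomotopic \<Gamma> mcone mcone (s \<circ> e) (\<lambda>c. c)"
  proof (rule based_ghomotopicI [OF is_based_gspace_cone hc(1)])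
    fix c assume "c \<in> topspace (spc mcone)"
    then obtain y where y: "y \<in> topspace (spc pieces)" "c = cone_class y"
      by (rule cone_cases)
    note cases = pieces_cases [OF y(1)]
    have Inr: "s (e (cone_class (Inr z))) = cone_class (Inl None)" if "y = Inr z" for z
      using e_Inr [of z] y(1) that s_None by simp
    have zero: "cone_class (Inr (a, 0)) = cone_class (Inl None)" if "y = Inr (a, t)" for a t
      using that y(1) cone_class_base [of 0] cone_class_zero by (cases a) (auto simp: topspace_pieces)
    show "hc (0, c) = (s \<circ> e) c"
    proof (cases rule: cases)
      case (3 t)
      then show ?thesis
        using y hc(4) [of 0 None t] Inr zero by simp
    next
      case (4 v t)
      then show ?thesis
        using y hc(4) [of 0 "Some (line (\<mu> v))" t] Inr zero by simp
    qed (simp_all add: y hc e_base s_None e_cell s_wrap)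
    show "hc (1, c) = c"
      by (cases rule: cases) (use y hc(4) [of 1] in \<open>simp_all add: hc radial_le\<close>)
    fix t :: real and g assume t: "t \<in> {0..1}" and g: "g \<in> carrier \<Gamma>"
    have gy: "act pieces g y \<in> topspace (spc pieces)"
      by (rule is_gspace_closed [OF is_gspace_pieces g y(1)])
    have Inr_case: "hc (t, act mcone g c) = act mcone g (hc (t, c))" if az: "y = Inr (a, z)" for a z
    proof -
      have "Inr (a, z * t) \<in> topspace (spc pieces)"
        using y(1) t az by (auto simp: topspace_pieces mult_le_one)
      then show ?thesis
        using y gy az hc(4) [OF t, of a z] hc(4) [OF t, of "map_option (act PA g) a" z]
        by (simp add: act_cone [OF g])
    qed
    show "hc (t, act mcone g c) = act mcone g (hc (t, c))"
    proof (cases rule: cases)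
      case 1
      then show ?thesis
        using y t g by (simp add: act_base_cone hc)
    next
      case (2 v)
      have "act mcone g c = cone_class (Inl (Some (cell (\<sigma> g v))))"
        using act_cone [OF g y(1)] y(2) 2 by (simp add: act_cell [OF g])
      then show ?thesis
        using hc(3) [OF t, of v] hc(3) [OF t, of "\<sigma> g v"] 2 y g by (simp add: act_radial \<sigma>_scaleR)
    qed (use Inr_case in blast)+
  qed (simp add: base_cone hc)
  have "based_ghomotopy_equivalence \<Gamma> mcone sph e"
    unfolding based_ghomotopy_equivalence_def using e s homotopic_cone homotopic_sph by blast
  moreover have "based_ghomotopic \<Gamma> plusX sph (e \<circ> mapping_cone_incl plusA plusX incl) q"
  proof -
    have eq: "(e \<circ> mapping_cone_incl plusA plusX incl) x = q x" if "x \<in> topspace (spc plusX)" for x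
      using e_Inl [OF that] by (simp add: mapping_cone_incl_def cone_class_def)
    have "based_gmap \<Gamma> plusX sph (e \<circ> mapping_cone_incl plusA plusX incl) \<longleftrightarrow> based_gmap \<Gamma> plusX sph q"
      by (rule based_gmap_cong [OF plusX]) (rule eq)
    with q(1) have "based_gmap \<Gamma> plusX sph (e \<circ> mapping_cone_incl plusA plusX incl)"
      by simp
    moreover from this have "continuous_map (spc plusX) (spc sph) (e \<circ> mapping_cone_incl plusA plusX incl)"
      by (simp add: based_gmap_def gmap_def)
    ultimately show ?thesis
      unfolding based_ghomotopic_def using q(1) eq by (intro homotopic_with_equal) auto
  qed
  ultimately show ?thesis
    unfolding cofiber_sequence_def using plusA plusX is_based_gspace_sph incl q(1) by blast
qed

end

section \<open>Adding a quaternionic line\<close>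

lemma twisted_rep_tensor:
  fixes \<rho> :: "int \<Rightarrow> 'w::quaternion_module \<Rightarrow> 'w"
  assumes "n \<ge> 1" "quaternionic_rep n \<rho>" "\<exists>B :: 'w set. finite B \<and> span B = UNIV"
  shows "twisted_rep n k \<rho> (rep_ctensor_prod (Phi n (- k)) \<rho>) ctensor_eval"
proof (rule twisted_rep.intro)
  fix g v assume g: "g \<in> carrier (integer_mod_group n)"
  show "ctensor_eval (rep_ctensor_prod (Phi n (- k)) \<rho> g v) =
      scaleC ((zeta n powi (- k)) powi g) (\<rho> g (ctensor_eval v))"
    by (rule ctensor_eval_rep_ctensor_prod)
      (rule quat_linear_imp_complex_linear [OF rep_quat_linear [OF assms(2) g]])
qed (fact assms linear_ctensor_eval bij_ctensor_eval)+

lemma projective_cell_tensor: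
  fixes \<rho> :: "int \<Rightarrow> 'w::quaternion_module \<Rightarrow> 'w"
  assumes "n \<ge> 1" "quaternionic_rep n \<rho>" "\<exists>B :: 'w set. finite B \<and> span B = UNIV"
    and "invariant_inner_product (integer_mod_group n) (rep_ctensor_prod (Phi n (- k)) \<rho>) ip"
  shows "projective_cell ip n k \<rho> (rep_ctensor_prod (Phi n (- k)) \<rho>) ctensor_eval"
  by (rule twisted_rep.projective_cell_invariant_ip [OF twisted_rep_tensor [OF assms(1-3)] assms(4)])

theorem theorem3p31:
  fixes n :: nat and k :: int
    and \<rho> :: "int \<Rightarrow> 'w::quaternion_module \<Rightarrow> 'w"
  assumes "n \<ge> 1"
    and "\<exists>B :: 'w set. finite B \<and> span B = UNIV"
    and "quaternionic_rep n \<rho>"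
  shows "(\<exists>q. cofiber_sequence (integer_mod_group n)
              (disjoint_basepoint (PH \<rho>))
              (disjoint_basepoint (PH (rep_sum \<rho> (Psi n k))))
              (rep_sphere (rep_ctensor_prod (Phi n (- k)) \<rho>))
              (map_option PH_incl) q) \<and>
         (\<forall>ip. invariant_inner_product (integer_mod_group n)
                 (rep_ctensor_prod (Phi n (- k)) \<rho>) ip \<longrightarrow>
            obtained_by_attaching (integer_mod_group n)
              (PH \<rho>) (PH (rep_sum \<rho> (Psi n k))) PH_incl
              (unit_disk ip (rep_ctensor_prod (Phi n (- k)) \<rho>))
              (unit_sphere ip (rep_ctensor_prod (Phi n (- k)) \<rho>)))"
proof (intro conjI allI impI)
  obtain ip where "invariant_inner_product (integer_mod_group n) (rep_ctensor_prod (Phi n (- k)) \<rho>) ip"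
    using twisted_rep.ex_invariant_ip [OF twisted_rep_tensor [OF assms(1,3,2)]] by blast
  then interpret projective_cell ip n k \<rho> "rep_ctensor_prod (Phi n (- k)) \<rho>" ctensor_eval
    by (rule projective_cell_tensor [OF assms(1,3,2)])
  show "\<exists>q. cofiber_sequence (integer_mod_group n) (disjoint_basepoint (PH \<rho>))
      (disjoint_basepoint (PH (rep_sum \<rho> (Psi n k))))
      (rep_sphere (rep_ctensor_prod (Phi n (- k)) \<rho>)) (map_option PH_incl) q"
    by (rule projective_space_cofiber_sequence)
next
  fix ip assume "invariant_inner_product (integer_mod_group n) (rep_ctensor_prod (Phi n (- k)) \<rho>) ip"
  then interpret projective_cell ip n k \<rho> "rep_ctensor_prod (Phi n (- k)) \<rho>" ctensor_eval
    by (rule projective_cell_tensor [OF assms(1,3,2)])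
  show "obtained_by_attaching (integer_mod_group n)
      (PH \<rho>) (PH (rep_sum \<rho> (Psi n k))) PH_incl
      (unit_disk ip (rep_ctensor_prod (Phi n (- k)) \<rho>))
      (unit_sphere ip (rep_ctensor_prod (Phi n (- k)) \<rho>))"
    by (rule projective_space_obtained_by_attaching)
qed

end
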